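(* For every integer $n\ge 1$, the number of (isomorphism classes of) rooted bridgeless combinatorial maps of size $n$ is equal to the number of (isomorphism classes of) rooted connected chord diagrams of size $n$.
   Context: A rooted chord diagram of size $n$ is (up to isomorphism) a perfect matching of the linearly ordered set $\{0<1<\dots<2n-1\}$ into $n$ pairs $(a,b)$ with $a<b$, called chords; the root chord is the chord containing $0$. Two chords $(a,b)$ and $(c,d)$ cross if $a<c<b<d$ or $c<a<d<b$. A diagram is connected if the graph whose vertices are the chords and whose edges join crossing chords is connected. A rooted combinatorial map is a quadruple $(H,\sigma,\alpha,r)$ where $H$ is a finite set of half-edges, $\sigma$ is a permutation of $H$, $\alpha$ is an involution of $H$, $r\in H$ satisfies $\alpha(r)=r$, and the group generated by $\sigma,\alpha$ acts transitively on $H$; isomorphisms are bijections commuting with $\sigma,\alpha$ and preserving $r$. Here maps are closed: $r$ is the only fixed point of $\alpha$. The underlying graph has the $\sigma$-orbits as vertices and the $\alpha$-orbits as edges (the orbit $\{r\}$ is a dangling edge, the root), an edge being incident to the vertices it meets. The size of a map is the number of $\alpha$-orbits (the root counts as an edge), so the map with a single half-edge has size $1$. A map is bridgeless if its underlying graph has no edge whose deletion disconnects it. *)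

theory Defs
  imports Main
begin

section \<open>Rooted chord diagrams\<close>

text \<open>A rooted chord diagram of size n: a perfect matching of {0,...,2n-1} into
  chords (a,b) with a < b. Since the ground set is linearly ordered and isomorphisms
  must preserve the order, isomorphism classes coincide with the matchings themselves.\<close>

definition chord_diagram :: "nat \<Rightarrow> (nat \<times> nat) set \<Rightarrow> bool" where
  "chord_diagram n C \<longleftrightarrow>
     C \<subseteq> {(a, b). a < b \<and> b < 2 * n} \<and>
     (\<forall>x < 2 * n. \<exists>!p. p \<in> C \<and> (x = fst p \<or> x = snd p))"

definition crosses :: "nat \<times> nat \<Rightarrow> nat \<times> nat \<Rightarrow> bool" where
  "crosses p q \<longleftrightarrow>
     (fst p < fst q \<and> fst q < snd p \<and> snd p < snd q) \<or>
     (fst q < fst p \<and> fst p < snd q \<and> snd q < snd p)"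

text \<open>Connected: the crossing graph on the chords is connected.\<close>
definition connected_diagram :: "(nat \<times> nat) set \<Rightarrow> bool" where
  "connected_diagram C \<longleftrightarrow>
     (\<forall>c \<in> C. \<forall>d \<in> C. (c, d) \<in> {(p, q). p \<in> C \<and> q \<in> C \<and> crosses p q}\<^sup>*)"

definition connected_chord_diagrams :: "nat \<Rightarrow> (nat \<times> nat) set set" where
  "connected_chord_diagrams n = {C. chord_diagram n C \<and> connected_diagram C}"

section \<open>Rooted closed combinatorial maps\<close>

text \<open>A map is represented as (m, sigma, alpha, r) with half-edge set H = {0..<m};
  sigma and alpha are permutations of H (extended by the identity outside H).
  Every finite map is isomorphic to one of this form.\<close>

type_synonym cmap = "nat \<times> (nat \<Rightarrow> nat) \<times> (nat \<Rightarrow> nat) \<times> nat"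

definition orbit :: "(nat \<Rightarrow> nat) \<Rightarrow> nat \<Rightarrow> nat set" where
  "orbit f h = {(f ^^ k) h | k. True}"

definition is_closed_rooted_map :: "cmap \<Rightarrow> bool" where
  "is_closed_rooted_map M \<longleftrightarrow>
     (case M of (m, \<sigma>, \<alpha>, r) \<Rightarrow>
        bij_betw \<sigma> {0..<m} {0..<m} \<and> (\<forall>h. h \<ge> m \<longrightarrow> \<sigma> h = h) \<and>
        bij_betw \<alpha> {0..<m} {0..<m} \<and> (\<forall>h. h \<ge> m \<longrightarrow> \<alpha> h = h) \<and>
        (\<forall>h < m. \<alpha> (\<alpha> h) = h) \<and>
        r < m \<and> \<alpha> r = r \<and> (\<forall>h < m. \<alpha> h = h \<longrightarrow> h = r) \<and>
        \<comment> \<open>transitivity of the group generated by sigma, alpha (finite case: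
            reachability by forward steps equals the group orbit)\<close>
        (\<forall>h < m. (r, h) \<in> {(x, y). x < m \<and> (y = \<sigma> x \<or> y = \<alpha> x)}\<^sup>*))"

definition map_size :: "cmap \<Rightarrow> nat" where
  "map_size M = (case M of (m, \<sigma>, \<alpha>, r) \<Rightarrow> card {orbit \<alpha> h | h. h < m})"

text \<open>Underlying graph: vertices are sigma-orbits, edges are alpha-orbits, an edge
  being incident to the vertices it meets.\<close>

definition map_vertices :: "cmap \<Rightarrow> nat set set" where
  "map_vertices M = (case M of (m, \<sigma>, \<alpha>, r) \<Rightarrow> {orbit \<sigma> h | h. h < m})"

definition map_edges :: "cmap \<Rightarrow> nat set set" where
  "map_edges M = (case M of (m, \<sigma>, \<alpha>, r) \<Rightarrow> {orbit \<alpha> h | h. h < m})"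

text \<open>Adjacency of vertices in the underlying graph with the edge e deleted.\<close>
definition adj_without :: "cmap \<Rightarrow> nat set \<Rightarrow> (nat set \<times> nat set) set" where
  "adj_without M e = {(v, w). v \<in> map_vertices M \<and> w \<in> map_vertices M \<and>
      (\<exists>e' \<in> map_edges M - {e}. v \<inter> e' \<noteq> {} \<and> w \<inter> e' \<noteq> {})}"

definition is_bridge :: "cmap \<Rightarrow> nat set \<Rightarrow> bool" where
  "is_bridge M e \<longleftrightarrow> e \<in> map_edges M \<and>
     \<not> (\<forall>v \<in> map_vertices M. \<forall>w \<in> map_vertices M. (v, w) \<in> (adj_without M e)\<^sup>*)"

definition bridgeless :: "cmap \<Rightarrow> bool" where
  "bridgeless M \<longleftrightarrow> (\<forall>e. \<not> is_bridge M e)"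

definition map_iso :: "cmap \<Rightarrow> cmap \<Rightarrow> bool" where
  "map_iso M M' \<longleftrightarrow>
     (case M of (m, \<sigma>, \<alpha>, r) \<Rightarrow> case M' of (m', \<sigma>', \<alpha>', r') \<Rightarrow>
        (\<exists>\<phi>. bij_betw \<phi> {0..<m} {0..<m'} \<and>
             (\<forall>h < m. \<phi> (\<sigma> h) = \<sigma>' (\<phi> h) \<and> \<phi> (\<alpha> h) = \<alpha>' (\<phi> h)) \<and> \<phi> r = r'))"

definition bridgeless_maps :: "nat \<Rightarrow> cmap set" where
  "bridgeless_maps n = {M. is_closed_rooted_map M \<and> map_size M = n \<and> bridgeless M}"

text \<open>Number of isomorphism classes of rooted bridgeless closed maps of size n.\<close>
definition num_bridgeless_maps :: "nat \<Rightarrow> nat" where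
  "num_bridgeless_maps n =
     card (bridgeless_maps n // {(M, M'). M \<in> bridgeless_maps n \<and> M' \<in> bridgeless_maps n \<and> map_iso M M'})"

end

theory Submission
  imports Defs "HOL-Combinatorics.Permutations" "HOL-Library.Infinite_Set"
begin

text \<open>
  Both sequences satisfy \<open>a\<^sub>1 = 1\<close> and \<open>a\<^sub>n = (\<Sum>k=1..n-1. (2k-1) a\<^sub>k a\<^bsub>n-k\<^esub>)\<close>.

  For diagrams, remove the root chord of a connected diagram and let \<open>X\<close> be the component of the chord
  at the point 1. The other components all cross the root chord but not \<open>X\<close>, so apart from the point
  0 everything outside \<open>X\<close> lies in a single one of the \<open>2k-1\<close> inner gaps of \<open>X\<close>.

  For maps, let \<open>x = \<sigma> r\<close>. Deleting the edge \<open>{x, \<alpha> x}\<close> of a bridgeless map leaves a chain of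
  bridgeless maps joined by bridges, running from the root to \<open>\<alpha> x\<close>. Cut the first bridge
  \<open>{u, v}\<close>: the part of the root is a bridgeless map with a marked corner (where \<open>u\<close> was attached,
  \<open>2k-1\<close> choices), and the other part, rooted at \<open>v\<close> and with \<open>x\<close> moved next to \<open>v\<close>, is bridgeless too.
  Since rooted maps have no automorphisms, this is a bijection on isomorphism classes.
\<close>

section \<open>Rooted maps and gluing\<close>

text \<open>The factor \<open>2k-1\<close> arises twice for unrelated reasons. A closed map of size
  \<open>k\<close> has \<open>k-1\<close> edges with two half-edges and a root with one, and each
  half-edge is followed by one corner; a diagram with \<open>k\<close> chords has \<open>2k\<close>
  points, hence \<open>2k-1\<close> gaps between consecutive points. Moving \<open>x\<close> next to
  the root is what makes gluing preserve bridgelessness: on its own the new edge would be a bridge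
  between the two pieces, but the edge of \<open>x\<close> now joins them a second time. The
  obstacle is undoing the gluing. A chain of bridges is awkward to handle, so the place of the cut
  is described by sets with a single exit: the first piece together with \<open>u\<close> is
  contained in every such set of the glued map. It is therefore intrinsic, and every isomorphism of
  glued maps respects it. A corner has a name only in a labelled representative of a class. Counting
  pairs of a class and a corner is legitimate because no automorphism can exchange two
  corners.\<close>

type_synonym 'a rmap = "'a set \<times> ('a \<Rightarrow> 'a) \<times> ('a \<Rightarrow> 'a) \<times> 'a"

text \<open>The cut condition says that at least two edges leave every union of vertices avoiding the
  root, i.e. connectedness and bridgelessness at once.\<close>

fun good_map :: "'a rmap \<Rightarrow> bool" where
  "good_map (H, \<sigma>, \<alpha>, r) \<longleftrightarrow>
     finite H \<and> \<sigma> permutes H \<and> \<alpha> permutes H \<and> (\<forall>h\<in>H. \<alpha> (\<alpha> h) = h) \<and>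
     r \<in> H \<and> (\<forall>h\<in>H. \<alpha> h = h \<longleftrightarrow> h = r) \<and>
     (\<forall>T\<subseteq>H. T \<noteq> {} \<longrightarrow> r \<notin> T \<longrightarrow> (\<forall>h\<in>T. \<sigma> h \<in> T) \<longrightarrow>
        (\<exists>g\<in>T. \<exists>h\<in>T. g \<noteq> h \<and> \<alpha> g \<notin> T \<and> \<alpha> h \<notin> T))"

declare good_map.simps [simp del]

fun map_isom :: "('a \<Rightarrow> 'b) \<Rightarrow> 'a rmap \<Rightarrow> 'b rmap \<Rightarrow> bool" where
  "map_isom \<phi> (H, \<sigma>, \<alpha>, r) (H', \<sigma>', \<alpha>', r') \<longleftrightarrow>
     bij_betw \<phi> H H' \<and> (\<forall>h\<in>H. \<phi> (\<sigma> h) = \<sigma>' (\<phi> h) \<and> \<phi> (\<alpha> h) = \<alpha>' (\<phi> h)) \<and> \<phi> r = r'"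

declare map_isom.simps [simp del]

text \<open>With \<open>x = \<sigma>\<^sub>2 r\<^sub>2\<close>, the half-edge \<open>u\<close> is inserted into the corner after \<open>i\<close>, joined to \<open>r\<^sub>2\<close>
  by a new edge, and then \<open>x\<close> is moved to the corner after \<open>r\<^sub>1\<close>. If the second map has size 1 then
  \<open>x = r\<^sub>2\<close>, and the result is the first map with an edge \<open>{x, u}\<close> attached.\<close>

fun glue :: "'a rmap \<Rightarrow> 'a \<Rightarrow> 'a rmap \<Rightarrow> 'a \<Rightarrow> 'a rmap" where
  "glue (H\<^sub>1, \<sigma>\<^sub>1, \<alpha>\<^sub>1, r\<^sub>1) i (H\<^sub>2, \<sigma>\<^sub>2, \<alpha>\<^sub>2, r\<^sub>2) u =
     (insert u (H\<^sub>1 \<union> H\<^sub>2),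
      \<sigma>\<^sub>1 \<circ> \<sigma>\<^sub>2 \<circ> transpose i u \<circ> transpose r\<^sub>1 r\<^sub>2 \<circ> transpose r\<^sub>2 (\<sigma>\<^sub>2 r\<^sub>2),
      \<alpha>\<^sub>1 \<circ> \<alpha>\<^sub>2 \<circ> transpose u r\<^sub>2, r\<^sub>1)"

text \<open>\<open>S\<close> is closed under the rotation that skips \<open>\<sigma> r\<close>, and \<open>u\<close> is the only half-edge leading out of
  it: after deleting the edge of \<open>\<sigma> r\<close>, the edge of \<open>u\<close> is a bridge (or \<open>u = \<alpha> (\<sigma> r)\<close>).\<close>

fun single_exit :: "'a rmap \<Rightarrow> 'a set \<Rightarrow> 'a \<Rightarrow> bool" where
  "single_exit (H, \<sigma>, \<alpha>, r) S u \<longleftrightarrow>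
     S \<subseteq> H \<and> r \<in> S \<and> \<sigma> r \<notin> S \<and> \<sigma> (\<sigma> r) \<in> S \<and> (\<forall>h\<in>S. \<sigma> h \<in> insert (\<sigma> r) S) \<and>
     u \<in> S \<and> \<alpha> u \<notin> S \<and> (\<forall>h\<in>S. \<alpha> h \<notin> S \<longrightarrow> h = u)"

declare single_exit.simps [simp del]

text \<open>Finiteness turns forward closure into invariance: an injective map sending a finite set
  into itself is onto it, so nothing can enter from outside. This is why closure under
  \<open>\<sigma>\<close> alone describes unions of vertices.\<close>

lemma inj_closed_iff:
  assumes "finite T" "inj f" "\<forall>h\<in>T. f h \<in> T"
  shows "f h \<in> T \<longleftrightarrow> h \<in> T"
proof -
  have "f ` T = T" using assms by (intro endo_inj_surj) (auto intro: inj_on_subset)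
  then show ?thesis using assms(2) by (metis inj_image_mem_iff)
qed

text \<open>The cut condition in the form in which it is refuted: a bad \<open>T\<close> has at most
  one exit, and by \<open>inj_closed_iff\<close> it may be taken invariant in both directions, so
  that membership also passes to predecessors.\<close>

lemma good_mapI:
  assumes "finite H" "\<sigma> permutes H" "\<alpha> permutes H" "\<And>h. h \<in> H \<Longrightarrow> \<alpha> (\<alpha> h) = h"
    "r \<in> H" "\<And>h. h \<in> H \<Longrightarrow> \<alpha> h = h \<longleftrightarrow> h = r"
    "\<And>T. T \<subseteq> H \<Longrightarrow> T \<noteq> {} \<Longrightarrow> r \<notin> T \<Longrightarrow> (\<And>h. \<sigma> h \<in> T \<longleftrightarrow> h \<in> T) \<Longrightarrow>
       (\<And>g h. g \<in> T \<Longrightarrow> h \<in> T \<Longrightarrow> \<alpha> g \<notin> T \<Longrightarrow> \<alpha> h \<notin> T \<Longrightarrow> g = h) \<Longrightarrow> False"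
  shows "good_map (H, \<sigma>, \<alpha>, r)"
  unfolding good_map.simps
proof (intro conjI allI impI)
  fix T assume T: "T \<subseteq> H" "T \<noteq> {}" "r \<notin> T" "\<forall>h\<in>T. \<sigma> h \<in> T"
  have "\<sigma> h \<in> T \<longleftrightarrow> h \<in> T" for h
    using T assms(1,2) by (intro inj_closed_iff) (auto intro: finite_subset permutes_inj)
  with T assms(7)[of T] show "\<exists>g\<in>T. \<exists>h\<in>T. g \<noteq> h \<and> \<alpha> g \<notin> T \<and> \<alpha> h \<notin> T" by metis
qed (use assms in auto)

lemma good_mapD:
  assumes "good_map (H, \<sigma>, \<alpha>, r)"
  shows "finite H" "\<sigma> permutes H" "\<alpha> permutes H" "\<And>h. h \<in> H \<Longrightarrow> \<alpha> (\<alpha> h) = h"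
    "r \<in> H" "\<And>h. h \<in> H \<Longrightarrow> \<alpha> h = h \<longleftrightarrow> h = r"
  using assms unfolding good_map.simps by auto

lemma good_map_exits:
  assumes "good_map (H, \<sigma>, \<alpha>, r)" "T \<subseteq> H" "T \<noteq> {}" "r \<notin> T" "\<And>h. h \<in> T \<Longrightarrow> \<sigma> h \<in> T"
  obtains g h where "g \<in> T" "h \<in> T" "g \<noteq> h" "\<alpha> g \<notin> T" "\<alpha> h \<notin> T"
  using assms unfolding good_map.simps by meson

text \<open>The half-edges moved by \<open>\<phi>\<close> form a union of vertices avoiding the
  root. An edge leaving this set has a fixed end, and commuting with \<open>\<alpha>\<close> then
  fixes the other end as well.\<close>

lemma good_map_rigid:
  assumes g: "good_map (H, \<sigma>, \<alpha>, r)" and "map_isom \<phi> (H, \<sigma>, \<alpha>, r) (H, \<sigma>, \<alpha>, r)" "h \<in> H"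
  shows "\<phi> h = h"
proof (rule ccontr)
  assume nh: "\<phi> h \<noteq> h"
  note D = good_mapD[OF g]
  have \<phi>: "bij_betw \<phi> H H" "\<phi> r = r" "\<And>h. h \<in> H \<Longrightarrow> \<phi> (\<sigma> h) = \<sigma> (\<phi> h)"
     "\<And>h. h \<in> H \<Longrightarrow> \<phi> (\<alpha> h) = \<alpha> (\<phi> h)"
    using assms(2) by (auto simp: map_isom.simps)
  let ?T = "{h\<in>H. \<phi> h \<noteq> h}"
  obtain g where "g \<in> ?T" "\<alpha> g \<notin> ?T"
  proof (rule good_map_exits[OF g, of ?T])
    show "\<sigma> h \<in> ?T" if "h \<in> ?T" for h
      using that \<phi>(3)[of h] permutes_in_image[OF D(2), of h] permutes_inj[OF D(2)]
      by (auto dest: injD)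
  qed (use nh \<phi>(2) assms(3) in auto)
  then have "g \<in> H" "\<phi> g \<noteq> g" "\<alpha> g \<in> H" "\<phi> (\<alpha> g) = \<alpha> g" using permutes_in_image[OF D(3)] by auto
  then show False using \<phi>(4)[of g] permutes_inj[OF D(3)] by (auto dest: injD)
qed

lemma map_isom_refl: "map_isom id M M"
  by (cases M) (auto simp: map_isom.simps)

lemma map_isom_trans:
  assumes "map_isom \<phi> M M'" "map_isom \<psi> M' M''"
  shows "map_isom (\<psi> \<circ> \<phi>) M M''"
  using assms
  by (cases M; cases M'; cases M'')
     (auto simp: map_isom.simps bij_betw_trans dest: bij_betwE)

lemma map_isom_sym:
  assumes "good_map M" "map_isom \<phi> M M'"
  shows "map_isom (inv_into (fst M) \<phi>) M' M"
proof -
  obtain H \<sigma> \<alpha> r H' \<sigma>' \<alpha>' r' where M: "M = (H, \<sigma>, \<alpha>, r)" "M' = (H', \<sigma>', \<alpha>', r')"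
    by (cases M; cases M') auto
  note D = good_mapD[OF assms(1)[unfolded M]]
  have \<phi>: "bij_betw \<phi> H H'" "\<phi> r = r'" "\<And>h. h \<in> H \<Longrightarrow> \<phi> (\<sigma> h) = \<sigma>' (\<phi> h)"
     "\<And>h. h \<in> H \<Longrightarrow> \<phi> (\<alpha> h) = \<alpha>' (\<phi> h)"
    using assms(2) unfolding M by (auto simp: map_isom.simps)
  have "inv_into H \<phi> (\<sigma>' h') = \<sigma> (inv_into H \<phi> h') \<and> inv_into H \<phi> (\<alpha>' h') = \<alpha> (inv_into H \<phi> h')"
    if h': "h' \<in> H'" for h'
  proof -
    obtain h where h: "h \<in> H" "h' = \<phi> h" using h' \<phi>(1) unfolding bij_betw_def by blast
    have "\<sigma> h \<in> H" "\<alpha> h \<in> H" using h permutes_in_image[OF D(2)] permutes_in_image[OF D(3)] by auto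
    then show ?thesis using h \<phi> by (metis bij_betw_inv_into_left)
  qed
  then show ?thesis unfolding M map_isom.simps
    using bij_betw_inv_into[OF \<phi>(1)] \<phi>(1,2) D(5) by (auto simp: bij_betw_inv_into_left)
qed

text \<open>Conjugation by \<open>\<phi>\<close>, continued by the identity. It serves to make
  half-edge sets disjoint before gluing and to return to an initial segment afterwards.\<close>

lemma map_isom_transport:
  assumes g: "good_map (H, \<sigma>, \<alpha>, r)" and b: "bij_betw \<phi> H H'"
  obtains \<sigma>' \<alpha>' where "good_map (H', \<sigma>', \<alpha>', \<phi> r)" "map_isom \<phi> (H, \<sigma>, \<alpha>, r) (H', \<sigma>', \<alpha>', \<phi> r)"
proof -
  note D = good_mapD[OF g]
  let ?i = "inv_into H \<phi>"
  let ?t = "\<lambda>f h. if h \<in> H' then \<phi> (f (?i h)) else h"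
  have ib: "bij_betw ?i H' H" using b by (rule bij_betw_inv_into)
  have inv[simp]: "?i (\<phi> h) = h" if "h \<in> H" for h using b that by (rule bij_betw_inv_into_left)
  have p: "?t f permutes H'" if "f permutes H" for f
  proof (rule bij_imp_permutes)
    have "bij_betw (\<phi> \<circ> f \<circ> ?i) H' H'"
      using ib permutes_imp_bij[OF that] b by (blast intro: bij_betw_trans)
    then show "bij_betw (?t f) H' H'" by (rule bij_betw_cong[THEN iffD1, rotated]) auto
  qed auto
  have \<phi>H: "\<phi> h \<in> H'" if "h \<in> H" for h using b that by (auto simp: bij_betw_def)
  have ex: "\<exists>h\<in>H. h' = \<phi> h" if "h' \<in> H'" for h' using b that by (auto simp: bij_betw_def)
  have inH: "\<sigma> h \<in> H" "\<alpha> h \<in> H" if "h \<in> H" for h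
    using that permutes_in_image[OF D(2)] permutes_in_image[OF D(3)] by auto
  have inj: "\<phi> h = \<phi> h' \<longleftrightarrow> h = h'" if "h \<in> H" "h' \<in> H" for h h'
    using that b by (auto simp: bij_betw_def dest: inj_onD)
  have "good_map (H', ?t \<sigma>, ?t \<alpha>, \<phi> r)"
  proof (rule good_mapI)
    show "finite H'" using D(1) b by (metis bij_betw_finite)
    show "?t \<alpha> (?t \<alpha> h) = h" if "h \<in> H'" for h
      using ex[OF that] \<phi>H inH D(4) by auto
    show "(?t \<alpha> h = h) = (h = \<phi> r)" if "h \<in> H'" for h
      using ex[OF that] \<phi>H inH D(5,6) inj by auto
  next
    fix T assume T: "T \<subseteq> H'" "T \<noteq> {}" "\<phi> r \<notin> T" "\<And>h. (?t \<sigma> h \<in> T) = (h \<in> T)"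
      "\<And>g h. g \<in> T \<Longrightarrow> h \<in> T \<Longrightarrow> ?t \<alpha> g \<notin> T \<Longrightarrow> ?t \<alpha> h \<notin> T \<Longrightarrow> g = h"
    let ?T = "{h\<in>H. \<phi> h \<in> T}"
    obtain g h where gh: "g \<in> ?T" "h \<in> ?T" "g \<noteq> h" "\<alpha> g \<notin> ?T" "\<alpha> h \<notin> ?T"
    proof (rule good_map_exits[OF g, of ?T])
      show "?T \<noteq> {}" using T(1,2) ex by fast
      show "\<sigma> h \<in> ?T" if "h \<in> ?T" for h
        using that inH T(4)[of "\<phi> h"] \<phi>H[of h] by auto
    qed (use T in auto)
    then have "\<phi> g = \<phi> h" by (intro T(5)) (use \<phi>H inH in auto)
    then show False using gh inj by auto
  qed (use p D \<phi>H in auto)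
  moreover have "map_isom \<phi> (H, \<sigma>, \<alpha>, r) (H', ?t \<sigma>, ?t \<alpha>, \<phi> r)"
    using b \<phi>H by (auto simp: map_isom.simps)
  ultimately show ?thesis by (rule that)
qed

lemma single_exit_isom:
  assumes "good_map M" "good_map M'" "single_exit M S u" "map_isom \<phi> M M'"
  shows "single_exit M' (\<phi> ` S) (\<phi> u)"
proof -
  obtain H \<sigma> \<alpha> r H' \<sigma>' \<alpha>' r' where M: "M = (H, \<sigma>, \<alpha>, r)" "M' = (H', \<sigma>', \<alpha>', r')"
    by (cases M; cases M') auto
  note D = good_mapD[OF assms(1)[unfolded M]]
  have \<phi>: "bij_betw \<phi> H H'" "\<phi> r = r'" "\<And>h. h \<in> H \<Longrightarrow> \<sigma>' (\<phi> h) = \<phi> (\<sigma> h)"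
     "\<And>h. h \<in> H \<Longrightarrow> \<alpha>' (\<phi> h) = \<phi> (\<alpha> h)"
    using assms(4) unfolding M by (auto simp: map_isom.simps)
  have S: "S \<subseteq> H" "r \<in> S" "\<sigma> r \<notin> S" "\<sigma> (\<sigma> r) \<in> S" "\<And>h. h\<in>S \<Longrightarrow> \<sigma> h \<in> insert (\<sigma> r) S"
     "u \<in> S" "\<alpha> u \<notin> S" "\<And>h. h\<in>S \<Longrightarrow> \<alpha> h \<notin> S \<Longrightarrow> h = u"
    using assms(3) unfolding M single_exit.simps by auto
  have inH: "\<sigma> h \<in> H" "\<alpha> h \<in> H" if "h \<in> H" for h
    using that permutes_in_image[OF D(2)] permutes_in_image[OF D(3)] by auto
  have im: "\<phi> h \<in> \<phi> ` S \<longleftrightarrow> h \<in> S" if "h \<in> H" for h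
    using that S(1) \<phi>(1) by (auto simp: bij_betw_def inj_on_def)
  have SH: "h \<in> H" if "h \<in> S" for h using that S by auto
  have rH: "\<sigma> r \<in> H" "r \<in> H" "\<sigma> (\<sigma> r) \<in> H" using D(5) inH by auto
  have "\<phi> ` S \<subseteq> H'" using S(1) \<phi>(1) by (auto simp: bij_betw_def)
  moreover have "\<sigma>' (\<phi> h) \<in> insert (\<sigma>' r') (\<phi> ` S)" if "h \<in> S" for h
    using S(5)[OF that] \<phi>(3)[OF SH[OF that]] \<phi>(2) \<phi>(3)[OF rH(2)] by auto
  moreover have "\<phi> h = \<phi> u" if "h \<in> S" "\<alpha>' (\<phi> h) \<notin> \<phi> ` S" for h
    using S(8)[OF that(1)] that \<phi>(4)[OF SH[OF that(1)]] by auto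
  moreover have "\<sigma>' r' \<notin> \<phi> ` S" "\<sigma>' (\<sigma>' r') \<in> \<phi> ` S"
    using \<phi>(2) \<phi>(3)[OF rH(2)] \<phi>(3)[OF rH(1)] im[OF rH(1)] S(3,4) by auto
  moreover have "\<alpha>' (\<phi> u) \<notin> \<phi> ` S"
    using \<phi>(4)[OF SH[OF S(6)]] im[OF inH(2)[OF SH[OF S(6)]]] S(7) by simp
  ultimately show ?thesis unfolding M single_exit.simps using S(2,6) \<phi>(2) by blast
qed

section \<open>The glued map: its permutations, its bridgelessness, its least single-exit
  set\<close>

locale gluing =
  fixes H\<^sub>1 H\<^sub>2 :: "'a set" and \<sigma>\<^sub>1 \<alpha>\<^sub>1 \<sigma>\<^sub>2 \<alpha>\<^sub>2 :: "'a \<Rightarrow> 'a" and r\<^sub>1 i r\<^sub>2 u :: 'a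
  assumes good\<^sub>1: "good_map (H\<^sub>1, \<sigma>\<^sub>1, \<alpha>\<^sub>1, r\<^sub>1)" and good\<^sub>2: "good_map (H\<^sub>2, \<sigma>\<^sub>2, \<alpha>\<^sub>2, r\<^sub>2)"
    and i: "i \<in> H\<^sub>1" and disj: "H\<^sub>1 \<inter> H\<^sub>2 = {}" and u: "u \<notin> H\<^sub>1" "u \<notin> H\<^sub>2"
begin

definition "H = insert u (H\<^sub>1 \<union> H\<^sub>2)"
definition "x = \<sigma>\<^sub>2 r\<^sub>2"
definition "\<sigma> = \<sigma>\<^sub>1 \<circ> \<sigma>\<^sub>2 \<circ> transpose i u \<circ> transpose r\<^sub>1 r\<^sub>2 \<circ> transpose r\<^sub>2 (\<sigma>\<^sub>2 r\<^sub>2)"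
definition "\<alpha> = \<alpha>\<^sub>1 \<circ> \<alpha>\<^sub>2 \<circ> transpose u r\<^sub>2"

lemma glue_eq: "glue (H\<^sub>1, \<sigma>\<^sub>1, \<alpha>\<^sub>1, r\<^sub>1) i (H\<^sub>2, \<sigma>\<^sub>2, \<alpha>\<^sub>2, r\<^sub>2) u = (H, \<sigma>, \<alpha>, r\<^sub>1)"
  by (simp add: H_def \<sigma>_def \<alpha>_def)

lemmas D\<^sub>1 = good_mapD[OF good\<^sub>1]
lemmas D\<^sub>2 = good_mapD[OF good\<^sub>2]

lemma in_H\<^sub>1: "\<sigma>\<^sub>1 h \<in> H\<^sub>1 \<longleftrightarrow> h \<in> H\<^sub>1" "\<alpha>\<^sub>1 h \<in> H\<^sub>1 \<longleftrightarrow> h \<in> H\<^sub>1"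
  and in_H\<^sub>2: "\<sigma>\<^sub>2 h \<in> H\<^sub>2 \<longleftrightarrow> h \<in> H\<^sub>2" "\<alpha>\<^sub>2 h \<in> H\<^sub>2 \<longleftrightarrow> h \<in> H\<^sub>2"
  using D\<^sub>1(2,3) D\<^sub>2(2,3) by (auto simp: permutes_in_image)

lemma outside:
  "h \<notin> H\<^sub>1 \<Longrightarrow> \<sigma>\<^sub>1 h = h" "h \<notin> H\<^sub>1 \<Longrightarrow> \<alpha>\<^sub>1 h = h"
  "h \<notin> H\<^sub>2 \<Longrightarrow> \<sigma>\<^sub>2 h = h" "h \<notin> H\<^sub>2 \<Longrightarrow> \<alpha>\<^sub>2 h = h"
  using D\<^sub>1(2,3) D\<^sub>2(2,3) by (auto simp: permutes_not_in)

lemma x_in: "x \<in> H\<^sub>2" using D\<^sub>2(5) in_H\<^sub>2 by (auto simp: x_def)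

lemma not_both: "h \<in> H\<^sub>1 \<Longrightarrow> h \<notin> H\<^sub>2" "h \<in> H\<^sub>2 \<Longrightarrow> h \<notin> H\<^sub>1" using disj by auto

lemma neqs:
  "r\<^sub>1 \<noteq> u" "i \<noteq> u" "r\<^sub>2 \<noteq> u" "x \<noteq> u" "r\<^sub>1 \<noteq> r\<^sub>2" "i \<noteq> r\<^sub>2" "i \<noteq> x" "r\<^sub>1 \<noteq> x"
  using D\<^sub>1(5) D\<^sub>2(5) i x_in u disj by auto

lemma \<sigma>12: "h \<in> H\<^sub>1 \<Longrightarrow> \<sigma>\<^sub>1 (\<sigma>\<^sub>2 h) = \<sigma>\<^sub>1 h" "h \<in> H\<^sub>2 \<Longrightarrow> \<sigma>\<^sub>1 (\<sigma>\<^sub>2 h) = \<sigma>\<^sub>2 h" "\<sigma>\<^sub>1 (\<sigma>\<^sub>2 u) = u"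
  using outside not_both in_H\<^sub>2 u by auto

lemma \<sigma>_r\<^sub>1: "\<sigma> r\<^sub>1 = x"
  using neqs neqs[symmetric] \<sigma>12(2)[OF D\<^sub>2(5)] by (simp add: \<sigma>_def x_def[symmetric] transpose_def)

text \<open>If \<open>i = r\<^sub>1\<close>, both new half-edges enter the corner after the root, in
  the order \<open>x\<close>, \<open>u\<close>. This degenerate case is the source of the case
  splits here and in \<open>i_eq\<close>.\<close>

lemma \<sigma>_x: "\<sigma> x = (if i = r\<^sub>1 then u else \<sigma>\<^sub>1 r\<^sub>1)"
  using neqs neqs[symmetric] \<sigma>12(1)[OF D\<^sub>1(5)] \<sigma>12(3) by (auto simp: \<sigma>_def x_def[symmetric] transpose_def)

lemma \<sigma>_i: "i \<noteq> r\<^sub>1 \<Longrightarrow> \<sigma> i = u"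
  using neqs neqs[symmetric] \<sigma>12(3) by (auto simp: \<sigma>_def x_def[symmetric] transpose_def)

lemma \<sigma>_u: "\<sigma> u = \<sigma>\<^sub>1 i"
  using neqs neqs[symmetric] \<sigma>12(1)[OF i] by (auto simp: \<sigma>_def x_def[symmetric] transpose_def)

lemma \<sigma>_H\<^sub>1: "h \<in> H\<^sub>1 \<Longrightarrow> h \<noteq> r\<^sub>1 \<Longrightarrow> h \<noteq> i \<Longrightarrow> \<sigma> h = \<sigma>\<^sub>1 h"
  using \<sigma>12(1)[of h] not_both(1)[of h] D\<^sub>2(5) x_in u
  by (auto simp: \<sigma>_def x_def[symmetric] transpose_def)

lemma \<sigma>_r\<^sub>2: "x \<noteq> r\<^sub>2 \<Longrightarrow> \<sigma> r\<^sub>2 = \<sigma>\<^sub>2 x"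
  using neqs neqs[symmetric] \<sigma>12(2)[OF x_in] by (auto simp: \<sigma>_def x_def[symmetric] transpose_def)

lemma \<sigma>_H\<^sub>2: "h \<in> H\<^sub>2 \<Longrightarrow> h \<noteq> r\<^sub>2 \<Longrightarrow> h \<noteq> x \<Longrightarrow> \<sigma> h = \<sigma>\<^sub>2 h"
  using \<sigma>12(2)[of h] not_both(2)[of h] D\<^sub>1(5) i u
  by (auto simp: \<sigma>_def x_def[symmetric] transpose_def)

lemma \<alpha>_u: "\<alpha> u = r\<^sub>2" and \<alpha>_r\<^sub>2: "\<alpha> r\<^sub>2 = u"
  using D\<^sub>2(6)[OF D\<^sub>2(5)] not_both(2)[OF D\<^sub>2(5)] outside u by (auto simp: \<alpha>_def)

lemma \<alpha>_H\<^sub>1: "h \<in> H\<^sub>1 \<Longrightarrow> \<alpha> h = \<alpha>\<^sub>1 h"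
  using D\<^sub>2(5) not_both(1)[of h] outside u by (auto simp: \<alpha>_def transpose_def)

lemma \<alpha>_H\<^sub>2: "h \<in> H\<^sub>2 \<Longrightarrow> h \<noteq> r\<^sub>2 \<Longrightarrow> \<alpha> h = \<alpha>\<^sub>2 h"
  using not_both(2)[of "\<alpha>\<^sub>2 h"] in_H\<^sub>2 outside u by (auto simp: \<alpha>_def transpose_def)

lemma \<sigma>_permutes: "\<sigma> permutes H"
  unfolding \<sigma>_def H_def
  by (intro permutes_compose permutes_swap_id)
     (use D\<^sub>1 D\<^sub>2 i in_H\<^sub>2 in \<open>auto intro: permutes_subset\<close>)

lemma \<alpha>_permutes: "\<alpha> permutes H"
  unfolding \<alpha>_def H_def
  by (intro permutes_compose permutes_swap_id)
     (use D\<^sub>1 D\<^sub>2 i in_H\<^sub>2 in \<open>auto intro: permutes_subset\<close>)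

text \<open>A bad cut \<open>T\<close> misses \<open>x\<close>, the successor of the root. It misses
  \<open>H\<^sub>1\<close>, since its part there would violate the cut condition of the first map,
  and then also \<open>u\<close>. So it lies inside the second map. If it avoids
  \<open>r\<^sub>2\<close>, the second cut condition refutes it; otherwise that condition is applied
  to its complement.\<close>

lemma glue_good: "good_map (H, \<sigma>, \<alpha>, r\<^sub>1)"
proof (rule good_mapI)
  show "finite H" using D\<^sub>1(1) D\<^sub>2(1) by (simp add: H_def)
  show "r\<^sub>1 \<in> H" using D\<^sub>1(5) by (simp add: H_def)
  fix h assume h: "h \<in> H"
  consider "h = u" | "h \<in> H\<^sub>1" | "h = r\<^sub>2" | "h \<in> H\<^sub>2" "h \<noteq> r\<^sub>2" using h by (auto simp: H_def)
  then have "\<alpha> (\<alpha> h) = h \<and> (\<alpha> h = h \<longleftrightarrow> h = r\<^sub>1)"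
  proof cases
    case 4
    then have "\<alpha>\<^sub>2 h \<noteq> r\<^sub>2" "\<alpha>\<^sub>2 h \<in> H\<^sub>2" "\<alpha>\<^sub>2 (\<alpha>\<^sub>2 h) = h" using D\<^sub>2(4,5,6) in_H\<^sub>2 by metis+
    then show ?thesis using 4 D\<^sub>2(6) not_both(1)[OF D\<^sub>1(5)] by (auto simp: \<alpha>_H\<^sub>2)
  qed (use neqs in \<open>auto simp: \<alpha>_u \<alpha>_r\<^sub>2 \<alpha>_H\<^sub>1 D\<^sub>1(4,6) in_H\<^sub>1\<close>)
  then show "\<alpha> (\<alpha> h) = h" "\<alpha> h = h \<longleftrightarrow> h = r\<^sub>1" by auto
next
  fix T assume T: "T \<subseteq> H" "T \<noteq> {}" "r\<^sub>1 \<notin> T" and cl: "\<And>h. \<sigma> h \<in> T \<longleftrightarrow> h \<in> T"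
    and one: "\<And>g h. g \<in> T \<Longrightarrow> h \<in> T \<Longrightarrow> \<alpha> g \<notin> T \<Longrightarrow> \<alpha> h \<notin> T \<Longrightarrow> g = h"
  have xT: "x \<notin> T" using cl[of r\<^sub>1] T(3) \<sigma>_r\<^sub>1 by simp
  have T1: "T \<inter> H\<^sub>1 = {}"
  proof (rule ccontr)
    assume "T \<inter> H\<^sub>1 \<noteq> {}"
    note ne = this
    obtain g h where gh: "g \<in> T \<inter> H\<^sub>1" "h \<in> T \<inter> H\<^sub>1" "g \<noteq> h" "\<alpha>\<^sub>1 g \<notin> T \<inter> H\<^sub>1" "\<alpha>\<^sub>1 h \<notin> T \<inter> H\<^sub>1"
    proof (rule good_map_exits[OF good\<^sub>1 _ ne])
      fix h assume h: "h \<in> T \<inter> H\<^sub>1"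
      then have "h \<noteq> r\<^sub>1" using T(3) by auto
      with h show "\<sigma>\<^sub>1 h \<in> T \<inter> H\<^sub>1"
        using cl[of h] cl[of u] \<sigma>_i \<sigma>_u \<sigma>_H\<^sub>1[of h] T(3) in_H\<^sub>1 by (cases "h = i") auto
    qed (use T in auto)
    then show False using one[of g h] by (auto simp: \<alpha>_H\<^sub>1 in_H\<^sub>1)
  qed
  have "u \<notin> T"
  proof (cases "i = r\<^sub>1")
    case True then show ?thesis using cl[of x] \<sigma>_x xT by auto
  next
    case False then show ?thesis using cl[of i] \<sigma>_i T1 i by auto
  qed
  then have T2: "T \<subseteq> H\<^sub>2 - {x}" using T(1) T1 xT by (auto simp: H_def)
  show False
  proof (cases "r\<^sub>2 \<in> T")
    case False
    obtain g h where gh: "g \<in> T" "h \<in> T" "g \<noteq> h" "\<alpha>\<^sub>2 g \<notin> T" "\<alpha>\<^sub>2 h \<notin> T"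
    proof (rule good_map_exits[OF good\<^sub>2 _ T(2) False])
      fix h assume h: "h \<in> T"
      then show "\<sigma>\<^sub>2 h \<in> T" using cl[of h] False xT T2 \<sigma>_H\<^sub>2[of h] by force
    qed (use T2 in auto)
    then show False using one[of g h] \<alpha>_H\<^sub>2 False T2 by (metis DiffD1 subsetD)
  next
    case True
    have ex2: "\<alpha> r\<^sub>2 \<notin> T" using \<alpha>_r\<^sub>2 \<open>u \<notin> T\<close> by simp
    have xr: "x \<noteq> r\<^sub>2" using True xT by auto
    have only: "h \<notin> T" if "h \<in> H\<^sub>2" "\<alpha>\<^sub>2 h \<notin> T" "h \<noteq> r\<^sub>2" for h
      using one[of h r\<^sub>2] that True ex2 \<alpha>_H\<^sub>2[of h] by auto
    \<comment> \<open>The edge from \<open>r\<^sub>2\<close> to \<open>u\<close> already is the one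
      exit of \<open>T\<close>. The complement without \<open>x\<close> is closed under
      \<open>\<sigma>\<^sub>2\<close>, because only \<open>r\<^sub>2\<close> precedes
      \<open>x\<close>. None of its edges can go into \<open>T\<close>, so its exits all lead to
      \<open>x\<close>, and there is at most one.\<close>
    let ?T = "H\<^sub>2 - T - {x}"
    show False
    proof (cases "?T = {}")
      case True
      \<comment> \<open>If the complement is empty, the partner of \<open>x\<close> lies in
        \<open>T\<close> and is a second exit.\<close>
      have "\<alpha>\<^sub>2 x \<in> H\<^sub>2" "\<alpha>\<^sub>2 x \<noteq> x" "\<alpha>\<^sub>2 (\<alpha>\<^sub>2 x) = x" "\<alpha>\<^sub>2 x \<noteq> r\<^sub>2"
        using x_in xr in_H\<^sub>2 D\<^sub>2(4-6) by metis+
      then show False using only[of "\<alpha>\<^sub>2 x"] True xT by auto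
    next
      case False
      obtain g h where gh: "g \<in> ?T" "h \<in> ?T" "g \<noteq> h" "\<alpha>\<^sub>2 g \<notin> ?T" "\<alpha>\<^sub>2 h \<notin> ?T"
      proof (rule good_map_exits[OF good\<^sub>2 _ False])
        fix h assume h: "h \<in> ?T"
        then have "h \<noteq> r\<^sub>2" "h \<noteq> x" "h \<in> H\<^sub>2" using True by auto
        then have "\<sigma>\<^sub>2 h \<notin> T" using h cl[of h] \<sigma>_H\<^sub>2[of h] by auto
        moreover have "\<sigma>\<^sub>2 h \<noteq> x" using \<open>h \<noteq> r\<^sub>2\<close> permutes_inj[OF D\<^sub>2(2)] by (auto simp: x_def dest: injD)
        ultimately show "\<sigma>\<^sub>2 h \<in> ?T" using \<open>h \<in> H\<^sub>2\<close> in_H\<^sub>2 by auto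
      qed (use True in auto)
      have "\<alpha>\<^sub>2 k = x" if "k \<in> ?T" "\<alpha>\<^sub>2 k \<notin> ?T" for k
      proof (rule ccontr)
        assume "\<alpha>\<^sub>2 k \<noteq> x"
        have "\<alpha>\<^sub>2 k \<noteq> r\<^sub>2" using that(1) D\<^sub>2(4-6) True by (metis Diff_iff)
        then show False using only[of "\<alpha>\<^sub>2 k"] that in_H\<^sub>2 D\<^sub>2(4) \<open>\<alpha>\<^sub>2 k \<noteq> x\<close> by auto
      qed
      then show False using gh permutes_inj[OF D\<^sub>2(3)] by (metis injD)
    qed
  qed
qed (use \<sigma>_permutes \<alpha>_permutes in auto)

lemma single_exit_glue: "single_exit (H, \<sigma>, \<alpha>, r\<^sub>1) (insert u H\<^sub>1) u"
proof -
  have "\<sigma> h \<in> insert x (insert u H\<^sub>1)" if h: "h \<in> insert u H\<^sub>1" for h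
  proof -
    consider "h = u" | "h = r\<^sub>1" | "h = i" "i \<noteq> r\<^sub>1" | "h \<in> H\<^sub>1" "h \<noteq> r\<^sub>1" "h \<noteq> i" using h by auto
    then show ?thesis by cases (simp_all add: \<sigma>_u \<sigma>_i \<sigma>_r\<^sub>1 \<sigma>_H\<^sub>1 in_H\<^sub>1 i)
  qed
  then show ?thesis unfolding single_exit.simps
    using D\<^sub>1(5) not_both(2)[OF x_in] neqs not_both(2)[OF D\<^sub>2(5)]
    by (auto simp: \<sigma>_r\<^sub>1 \<sigma>_x \<alpha>_u \<alpha>_H\<^sub>1 in_H\<^sub>1 H_def)
qed

text \<open>With \<open>single_exit_glue\<close> this characterises
  \<open>insert u H\<^sub>1\<close> as the least single-exit set. If \<open>S\<close> missed part of
  \<open>H\<^sub>1\<close>, that part would be a union of vertices of the first map avoiding its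
  root. Its exits would lead to half-edges by which \<open>S\<close> is left, hence all to
  \<open>w\<close>, while the cut condition demands two.\<close>

lemma single_exit_min:
  assumes S: "single_exit (H, \<sigma>, \<alpha>, r\<^sub>1) S w"
  shows "insert u H\<^sub>1 \<subseteq> S"
proof -
  have S: "S \<subseteq> H" "r\<^sub>1 \<in> S" "x \<notin> S" "\<sigma> x \<in> S" "\<And>h. h\<in>S \<Longrightarrow> \<sigma> h \<in> insert x S"
     "\<And>h. h\<in>S \<Longrightarrow> \<alpha> h \<notin> S \<Longrightarrow> h = w"
    using S unfolding single_exit.simps \<sigma>_r\<^sub>1 by auto
  have cl: "\<sigma> h \<in> insert x S \<longleftrightarrow> h \<in> insert x S" for h
    using S(4,5) finite_subset[OF S(1) good_mapD(1)[OF glue_good]] permutes_inj[OF \<sigma>_permutes]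
    by (intro inj_closed_iff) auto
  have "H\<^sub>1 \<subseteq> S"
  proof (rule ccontr)
    assume n: "\<not> H\<^sub>1 \<subseteq> S"
    obtain g h where gh: "g \<in> H\<^sub>1 - S" "h \<in> H\<^sub>1 - S" "g \<noteq> h" "\<alpha>\<^sub>1 g \<notin> H\<^sub>1 - S" "\<alpha>\<^sub>1 h \<notin> H\<^sub>1 - S"
    proof (rule good_map_exits[OF good\<^sub>1])
      show "\<sigma>\<^sub>1 h \<in> H\<^sub>1 - S" if "h \<in> H\<^sub>1 - S" for h
      proof -
        have "h \<notin> insert x S" "h \<noteq> r\<^sub>1" using that S(2) not_both(2)[OF x_in] by auto
        then show ?thesis
          using that cl[of h] cl[of u] \<sigma>_i \<sigma>_u \<sigma>_H\<^sub>1[of h] in_H\<^sub>1 by (cases "h = i") auto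
      qed
    qed (use n S in auto)
    have "\<alpha>\<^sub>1 k = w" if "k \<in> H\<^sub>1 - S" "\<alpha>\<^sub>1 k \<notin> H\<^sub>1 - S" for k
      using S(6)[of "\<alpha>\<^sub>1 k"] that in_H\<^sub>1 \<alpha>_H\<^sub>1[of "\<alpha>\<^sub>1 k"] D\<^sub>1(4)[of k] by auto
    then show False using gh permutes_inj[OF D\<^sub>1(3)] by (metis injD)
  qed
  moreover have "u \<in> S"
    using S(2,4) cl[of i] \<sigma>_x \<sigma>_i i neqs calculation by (cases "i = r\<^sub>1") auto
  ultimately show ?thesis by auto
qed

text \<open>This and \<open>\<sigma>\<^sub>2_eq\<close> write the rotations of the pieces in terms
  of the glued map, so that an isomorphism of glued maps can be restricted to the pieces.\<close>

lemma \<sigma>\<^sub>1_eq: "h \<in> H\<^sub>1 \<Longrightarrow> \<sigma>\<^sub>1 h = (if h = i then \<sigma> u else if h = r\<^sub>1 then \<sigma> x else \<sigma> h)"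
  using \<sigma>_u \<sigma>_x \<sigma>_H\<^sub>1 by auto

lemma \<sigma>\<^sub>2_eq: "h \<in> H\<^sub>2 \<Longrightarrow> \<sigma>\<^sub>2 h = (if h = r\<^sub>2 then x else if h = x then \<sigma> r\<^sub>2 else \<sigma> h)"
  using \<sigma>_r\<^sub>2 \<sigma>_H\<^sub>2 by (auto simp: x_def)

text \<open>Reads the marked corner off the glued map: \<open>i\<close> is the predecessor of
  \<open>u\<close>, unless \<open>x\<close> has been put between the two, which happens exactly for
  \<open>i = r\<^sub>1\<close>.\<close>

lemma i_eq: "h \<in> H\<^sub>1 \<Longrightarrow> h = i \<longleftrightarrow> (if \<sigma> x = u then h = r\<^sub>1 else \<sigma> h = u)"
proof -
  assume h: "h \<in> H\<^sub>1"
  have "\<sigma>\<^sub>1 r\<^sub>1 \<noteq> u" using in_H\<^sub>1 D\<^sub>1(5) u by metis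
  moreover have "\<sigma> h = u \<Longrightarrow> \<sigma> i = u \<Longrightarrow> h = i" using permutes_inj[OF \<sigma>_permutes] by (metis injD)
  ultimately show ?thesis using \<sigma>_x \<sigma>_i h by auto
qed

end

section \<open>Gluing and isomorphisms\<close>

lemma glue_isom:
  assumes "gluing H\<^sub>1 H\<^sub>2 \<sigma>\<^sub>1 \<alpha>\<^sub>1 \<sigma>\<^sub>2 \<alpha>\<^sub>2 r\<^sub>1 i r\<^sub>2 u"
    and "gluing H\<^sub>1' H\<^sub>2' \<sigma>\<^sub>1' \<alpha>\<^sub>1' \<sigma>\<^sub>2' \<alpha>\<^sub>2' r\<^sub>1' i' r\<^sub>2' u'"
    and i1: "map_isom \<phi>\<^sub>1 (H\<^sub>1, \<sigma>\<^sub>1, \<alpha>\<^sub>1, r\<^sub>1) (H\<^sub>1', \<sigma>\<^sub>1', \<alpha>\<^sub>1', r\<^sub>1')" and i: "\<phi>\<^sub>1 i = i'"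
    and i2: "map_isom \<phi>\<^sub>2 (H\<^sub>2, \<sigma>\<^sub>2, \<alpha>\<^sub>2, r\<^sub>2) (H\<^sub>2', \<sigma>\<^sub>2', \<alpha>\<^sub>2', r\<^sub>2')"
  shows "\<exists>\<phi>. map_isom \<phi> (glue (H\<^sub>1, \<sigma>\<^sub>1, \<alpha>\<^sub>1, r\<^sub>1) i (H\<^sub>2, \<sigma>\<^sub>2, \<alpha>\<^sub>2, r\<^sub>2) u)
                       (glue (H\<^sub>1', \<sigma>\<^sub>1', \<alpha>\<^sub>1', r\<^sub>1') i' (H\<^sub>2', \<sigma>\<^sub>2', \<alpha>\<^sub>2', r\<^sub>2') u')"
proof -
  interpret A: gluing H\<^sub>1 H\<^sub>2 \<sigma>\<^sub>1 \<alpha>\<^sub>1 \<sigma>\<^sub>2 \<alpha>\<^sub>2 r\<^sub>1 i r\<^sub>2 u by fact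
  interpret B: gluing H\<^sub>1' H\<^sub>2' \<sigma>\<^sub>1' \<alpha>\<^sub>1' \<sigma>\<^sub>2' \<alpha>\<^sub>2' r\<^sub>1' i' r\<^sub>2' u' by fact
  have p1: "bij_betw \<phi>\<^sub>1 H\<^sub>1 H\<^sub>1'" "\<phi>\<^sub>1 r\<^sub>1 = r\<^sub>1'" "\<And>h. h \<in> H\<^sub>1 \<Longrightarrow> \<phi>\<^sub>1 (\<sigma>\<^sub>1 h) = \<sigma>\<^sub>1' (\<phi>\<^sub>1 h)"
     "\<And>h. h \<in> H\<^sub>1 \<Longrightarrow> \<phi>\<^sub>1 (\<alpha>\<^sub>1 h) = \<alpha>\<^sub>1' (\<phi>\<^sub>1 h)" using i1 by (auto simp: map_isom.simps)
  have p2: "bij_betw \<phi>\<^sub>2 H\<^sub>2 H\<^sub>2'" "\<phi>\<^sub>2 r\<^sub>2 = r\<^sub>2'" "\<And>h. h \<in> H\<^sub>2 \<Longrightarrow> \<phi>\<^sub>2 (\<sigma>\<^sub>2 h) = \<sigma>\<^sub>2' (\<phi>\<^sub>2 h)"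
     "\<And>h. h \<in> H\<^sub>2 \<Longrightarrow> \<phi>\<^sub>2 (\<alpha>\<^sub>2 h) = \<alpha>\<^sub>2' (\<phi>\<^sub>2 h)" using i2 by (auto simp: map_isom.simps)
  have in1: "\<phi>\<^sub>1 h \<in> H\<^sub>1'" if "h \<in> H\<^sub>1" for h using p1(1) that by (rule bij_betw_apply)
  have in2: "\<phi>\<^sub>2 h \<in> H\<^sub>2'" if "h \<in> H\<^sub>2" for h using p2(1) that by (rule bij_betw_apply)
  have inj1: "\<phi>\<^sub>1 h = \<phi>\<^sub>1 k \<longleftrightarrow> h = k" if "h \<in> H\<^sub>1" "k \<in> H\<^sub>1" for h k
    using p1(1) that by (auto simp: bij_betw_def inj_on_def)
  have inj2: "\<phi>\<^sub>2 h = \<phi>\<^sub>2 k \<longleftrightarrow> h = k" if "h \<in> H\<^sub>2" "k \<in> H\<^sub>2" for h k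
    using p2(1) that by (auto simp: bij_betw_def inj_on_def)
  define \<phi> where "\<phi> h = (if h = u then u' else if h \<in> H\<^sub>1 then \<phi>\<^sub>1 h else \<phi>\<^sub>2 h)" for h
  have \<phi>u: "\<phi> u = u'" and \<phi>1: "h \<in> H\<^sub>1 \<Longrightarrow> \<phi> h = \<phi>\<^sub>1 h" and \<phi>2: "h \<in> H\<^sub>2 \<Longrightarrow> \<phi> h = \<phi>\<^sub>2 h" for h
    using A.u A.not_both by (auto simp: \<phi>_def)
  have x: "\<phi>\<^sub>2 A.x = B.x" using p2(3)[OF A.D\<^sub>2(5)] p2(2) by (simp add: A.x_def B.x_def)
  have i'r: "i' = r\<^sub>1' \<longleftrightarrow> i = r\<^sub>1" using inj1[OF A.i A.D\<^sub>1(5)] p1(2) i by simp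
  have x'r: "B.x = r\<^sub>2' \<longleftrightarrow> A.x = r\<^sub>2" using inj2[OF A.x_in A.D\<^sub>2(5)] p2(2) x by simp
  have "bij_betw \<phi> ({u} \<union> (H\<^sub>1 \<union> H\<^sub>2)) ({u'} \<union> (H\<^sub>1' \<union> H\<^sub>2'))"
  proof (intro bij_betw_combine)
    show "bij_betw \<phi> {u} {u'}" by (simp add: \<phi>u)
    show "bij_betw \<phi> H\<^sub>1 H\<^sub>1'" using p1(1) \<phi>1 by (metis bij_betw_cong)
    show "bij_betw \<phi> H\<^sub>2 H\<^sub>2'" using p2(1) \<phi>2 by (metis bij_betw_cong)
  qed (use B.disj B.u in auto)
  then have bij: "bij_betw \<phi> A.H B.H" by (simp add: A.H_def B.H_def)
  have s: "\<phi> (A.\<sigma> h) = B.\<sigma> (\<phi> h)" if h: "h \<in> A.H" for h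
  proof -
    consider "h = r\<^sub>1" | "h = A.x" | "h = i" "i \<noteq> r\<^sub>1" | "h = u"
      | "h \<in> H\<^sub>1" "h \<noteq> r\<^sub>1" "h \<noteq> i" | "h = r\<^sub>2" "A.x \<noteq> r\<^sub>2" | "h \<in> H\<^sub>2" "h \<noteq> r\<^sub>2" "h \<noteq> A.x"
      using h by (cases "h = r\<^sub>2"; cases "h = i"; cases "h = A.x"; auto simp: A.H_def)
    then show ?thesis
    proof cases
      case 1 then show ?thesis
        using A.\<sigma>_r\<^sub>1 B.\<sigma>_r\<^sub>1 \<phi>1[OF A.D\<^sub>1(5)] \<phi>2[OF A.x_in] x p1(2) by simp
    next
      case 2 then show ?thesis
        using A.\<sigma>_x B.\<sigma>_x \<phi>1[of "\<sigma>\<^sub>1 r\<^sub>1"] A.in_H\<^sub>1 A.D\<^sub>1(5) p1(2) p1(3)[of r\<^sub>1] \<phi>2[OF A.x_in] x i'r \<phi>u by auto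
    next
      case 3 then show ?thesis
        using A.\<sigma>_i B.\<sigma>_i \<phi>1[OF A.i] i i'r \<phi>u by auto
    next
      case 4 then show ?thesis
        using A.\<sigma>_u B.\<sigma>_u \<phi>1[of "\<sigma>\<^sub>1 i"] A.in_H\<^sub>1 A.i p1(3)[of i] i \<phi>u by auto
    next
      case 5
      then have "\<phi>\<^sub>1 h \<noteq> r\<^sub>1'" "\<phi>\<^sub>1 h \<noteq> i'" using inj1 A.D\<^sub>1(5) A.i p1(2) i by metis+
      with 5 show ?thesis
        using A.\<sigma>_H\<^sub>1[of h] B.\<sigma>_H\<^sub>1[of "\<phi>\<^sub>1 h"] \<phi>1[of h] \<phi>1[of "\<sigma>\<^sub>1 h"] A.in_H\<^sub>1 in1 p1(3)[of h] by auto
    next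
      case 6 then show ?thesis
        using A.\<sigma>_r\<^sub>2 B.\<sigma>_r\<^sub>2 \<phi>2[OF A.D\<^sub>2(5)] \<phi>2[of "\<sigma>\<^sub>2 A.x"] A.in_H\<^sub>2 A.x_in p2(2) p2(3)[of "A.x"] x x'r by auto
    next
      case 7
      then have "\<phi>\<^sub>2 h \<noteq> r\<^sub>2'" "\<phi>\<^sub>2 h \<noteq> B.x" using inj2 A.D\<^sub>2(5) A.x_in p2(2) x by metis+
      with 7 show ?thesis
        using A.\<sigma>_H\<^sub>2[of h] B.\<sigma>_H\<^sub>2[of "\<phi>\<^sub>2 h"] \<phi>2[of h] \<phi>2[of "\<sigma>\<^sub>2 h"] A.in_H\<^sub>2 in2 p2(3)[of h] by auto
    qed
  qed
  have a: "\<phi> (A.\<alpha> h) = B.\<alpha> (\<phi> h)" if h: "h \<in> A.H" for h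
  proof -
    consider "h = u" | "h \<in> H\<^sub>1" | "h = r\<^sub>2" | "h \<in> H\<^sub>2" "h \<noteq> r\<^sub>2" using h by (auto simp: A.H_def)
    then show ?thesis
    proof cases
      case 4
      then have "\<phi>\<^sub>2 h \<noteq> r\<^sub>2'" using inj2 A.D\<^sub>2(5) p2(2) by metis
      with 4 show ?thesis
        using A.\<alpha>_H\<^sub>2[of h] B.\<alpha>_H\<^sub>2[of "\<phi>\<^sub>2 h"] \<phi>2[of h] \<phi>2[of "\<alpha>\<^sub>2 h"] A.in_H\<^sub>2 in2 p2(4)[of h] by auto
    qed (simp_all add: A.\<alpha>_u B.\<alpha>_u A.\<alpha>_r\<^sub>2 B.\<alpha>_r\<^sub>2 \<phi>u \<phi>2 \<phi>1 A.D\<^sub>2(5) p2(2) A.\<alpha>_H\<^sub>1 B.\<alpha>_H\<^sub>1 in1 A.in_H\<^sub>1 p1(4))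
  qed
  have "map_isom \<phi> (A.H, A.\<sigma>, A.\<alpha>, r\<^sub>1) (B.H, B.\<sigma>, B.\<alpha>, r\<^sub>1')"
    using bij s a \<phi>1[OF A.D\<^sub>1(5)] p1(2) by (auto simp: map_isom.simps)
  then show ?thesis unfolding A.glue_eq B.glue_eq by blast
qed

text \<open>The image of the least single-exit set is a single-exit set of the other map and so
  contains its least one; the inverse isomorphism gives the reverse inclusion. Hence
  \<open>\<phi>\<close> respects the first piece and \<open>u\<close>, and with them
  \<open>r\<^sub>2\<close>, \<open>x\<close>, the corner and the second piece, which are all
  determined by these.\<close>

lemma glue_isom_cancel:
  assumes "gluing H\<^sub>1 H\<^sub>2 \<sigma>\<^sub>1 \<alpha>\<^sub>1 \<sigma>\<^sub>2 \<alpha>\<^sub>2 r\<^sub>1 i r\<^sub>2 u"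
    and "gluing H\<^sub>1' H\<^sub>2' \<sigma>\<^sub>1' \<alpha>\<^sub>1' \<sigma>\<^sub>2' \<alpha>\<^sub>2' r\<^sub>1' i' r\<^sub>2' u'"
    and isom: "map_isom \<phi> (glue (H\<^sub>1, \<sigma>\<^sub>1, \<alpha>\<^sub>1, r\<^sub>1) i (H\<^sub>2, \<sigma>\<^sub>2, \<alpha>\<^sub>2, r\<^sub>2) u)
                    (glue (H\<^sub>1', \<sigma>\<^sub>1', \<alpha>\<^sub>1', r\<^sub>1') i' (H\<^sub>2', \<sigma>\<^sub>2', \<alpha>\<^sub>2', r\<^sub>2') u')"
  shows "map_isom \<phi> (H\<^sub>1, \<sigma>\<^sub>1, \<alpha>\<^sub>1, r\<^sub>1) (H\<^sub>1', \<sigma>\<^sub>1', \<alpha>\<^sub>1', r\<^sub>1')" and "\<phi> i = i'"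
    and "map_isom \<phi> (H\<^sub>2, \<sigma>\<^sub>2, \<alpha>\<^sub>2, r\<^sub>2) (H\<^sub>2', \<sigma>\<^sub>2', \<alpha>\<^sub>2', r\<^sub>2')"
proof -
  interpret A: gluing H\<^sub>1 H\<^sub>2 \<sigma>\<^sub>1 \<alpha>\<^sub>1 \<sigma>\<^sub>2 \<alpha>\<^sub>2 r\<^sub>1 i r\<^sub>2 u by fact
  interpret B: gluing H\<^sub>1' H\<^sub>2' \<sigma>\<^sub>1' \<alpha>\<^sub>1' \<sigma>\<^sub>2' \<alpha>\<^sub>2' r\<^sub>1' i' r\<^sub>2' u' by fact
  have isM: "map_isom \<phi> (A.H, A.\<sigma>, A.\<alpha>, r\<^sub>1) (B.H, B.\<sigma>, B.\<alpha>, r\<^sub>1')"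
    using isom unfolding A.glue_eq B.glue_eq .
  then have p: "bij_betw \<phi> A.H B.H" "\<phi> r\<^sub>1 = r\<^sub>1'" "\<And>h. h \<in> A.H \<Longrightarrow> \<phi> (A.\<sigma> h) = B.\<sigma> (\<phi> h)"
     "\<And>h. h \<in> A.H \<Longrightarrow> \<phi> (A.\<alpha> h) = B.\<alpha> (\<phi> h)" by (auto simp: map_isom.simps)
  have inj: "\<phi> h = \<phi> k \<longleftrightarrow> h = k" if "h \<in> A.H" "k \<in> A.H" for h k
    using p(1) that by (auto simp: bij_betw_def inj_on_def)
  have inA: "h \<in> H\<^sub>1 \<Longrightarrow> h \<in> A.H" "h \<in> H\<^sub>2 \<Longrightarrow> h \<in> A.H" "u \<in> A.H" for h by (auto simp: A.H_def)
  have e: "single_exit (B.H, B.\<sigma>, B.\<alpha>, r\<^sub>1') (\<phi> ` insert u H\<^sub>1) (\<phi> u)"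
    by (rule single_exit_isom[OF A.glue_good B.glue_good A.single_exit_glue isM])
  then have sub: "insert u' H\<^sub>1' \<subseteq> \<phi> ` insert u H\<^sub>1" by (rule B.single_exit_min)
  let ?\<psi> = "inv_into A.H \<phi>"
  have is': "map_isom ?\<psi> (B.H, B.\<sigma>, B.\<alpha>, r\<^sub>1') (A.H, A.\<sigma>, A.\<alpha>, r\<^sub>1)"
    using map_isom_sym[OF A.glue_good isM] by simp
  have "insert u H\<^sub>1 \<subseteq> ?\<psi> ` insert u' H\<^sub>1'"
    by (rule A.single_exit_min)
       (rule single_exit_isom[OF B.glue_good A.glue_good B.single_exit_glue is'])
  then have "\<phi> ` insert u H\<^sub>1 \<subseteq> \<phi> ` ?\<psi> ` insert u' H\<^sub>1'" by (rule image_mono)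
  also have "\<dots> = insert u' H\<^sub>1'"
    using p(1) by (intro image_inv_into_cancel) (auto simp: bij_betw_def B.H_def)
  finally have S: "\<phi> ` insert u H\<^sub>1 = insert u' H\<^sub>1'" using sub by auto
  have pu: "\<phi> u = u'"
    using e B.single_exit_glue unfolding S single_exit.simps by blast
  have S1: "\<phi> ` H\<^sub>1 = H\<^sub>1'"
  proof -
    have "\<phi> ` H\<^sub>1 = \<phi> ` (insert u H\<^sub>1 - {u})" using A.u by simp
    also have "\<dots> = \<phi> ` insert u H\<^sub>1 - \<phi> ` {u}"
      using p(1) by (intro inj_on_image_set_diff[of _ A.H]) (auto simp: bij_betw_def A.H_def)
    finally show ?thesis unfolding S using pu B.u by simp
  qed
  have S2: "\<phi> ` H\<^sub>2 = H\<^sub>2'"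
  proof -
    have "\<phi> ` H\<^sub>2 = \<phi> ` (A.H - insert u H\<^sub>1)" using A.u A.disj by (intro arg_cong[where f="\<lambda>X. \<phi> ` X"]) (auto simp: A.H_def)
    also have "\<dots> = \<phi> ` A.H - \<phi> ` insert u H\<^sub>1"
      using p(1) by (intro inj_on_image_set_diff[of _ A.H]) (auto simp: bij_betw_def A.H_def)
    also have "\<dots> = B.H - insert u' H\<^sub>1'" unfolding S bij_betw_imp_surj_on[OF p(1)] by (rule refl)
    also have "\<dots> = H\<^sub>2'" using B.u B.disj by (auto simp: B.H_def)
    finally show ?thesis .
  qed
  have b1: "bij_betw \<phi> H\<^sub>1 H\<^sub>1'" and b2: "bij_betw \<phi> H\<^sub>2 H\<^sub>2'"
    using S1 S2 p(1) by (auto simp: bij_betw_def A.H_def intro: inj_on_subset)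
  have r2: "\<phi> r\<^sub>2 = r\<^sub>2'" using p(4)[of u] inA(3) A.\<alpha>_u B.\<alpha>_u pu by simp
  have r1H: "r\<^sub>1 \<in> A.H" and r2H: "r\<^sub>2 \<in> A.H" and xH: "A.x \<in> A.H" and iH: "i \<in> A.H"
    using A.D\<^sub>1(5) A.D\<^sub>2(5) A.x_in A.i inA by auto
  have x: "\<phi> A.x = B.x" using p(3)[OF r1H] A.\<sigma>_r\<^sub>1 B.\<sigma>_r\<^sub>1 p(2) by simp
  have \<sigma>H: "A.\<sigma> h \<in> A.H" if "h \<in> A.H" for h using that A.\<sigma>_permutes by (simp add: permutes_in_image)
  show pi: "\<phi> i = i'"
  proof -
    have "A.\<sigma> A.x = u \<longleftrightarrow> B.\<sigma> B.x = u'"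
      using p(3)[OF xH] x pu inj[OF \<sigma>H[OF xH] inA(3)] by simp
    moreover have "A.\<sigma> i = u \<longleftrightarrow> B.\<sigma> (\<phi> i) = u'"
      using p(3)[OF iH] pu inj[OF \<sigma>H[OF iH] inA(3)] by simp
    moreover have "\<phi> i \<in> H\<^sub>1'" using b1 A.i by (rule bij_betw_apply)
    ultimately show ?thesis using A.i_eq[OF A.i] B.i_eq[of "\<phi> i"] p(2) by (auto split: if_splits)
  qed
  have "\<phi> (\<sigma>\<^sub>1 h) = \<sigma>\<^sub>1' (\<phi> h)" "\<phi> (\<alpha>\<^sub>1 h) = \<alpha>\<^sub>1' (\<phi> h)" if "h \<in> H\<^sub>1" for h
  proof -
    note h = inA(1)[OF that]
    have h': "\<phi> h \<in> H\<^sub>1'" using b1 that by (rule bij_betw_apply)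
    have "\<phi> h = i' \<longleftrightarrow> h = i" "\<phi> h = r\<^sub>1' \<longleftrightarrow> h = r\<^sub>1" using inj[OF h iH] inj[OF h r1H] pi p(2) by auto
    then show "\<phi> (\<sigma>\<^sub>1 h) = \<sigma>\<^sub>1' (\<phi> h)"
      using A.\<sigma>\<^sub>1_eq[OF that] B.\<sigma>\<^sub>1_eq[OF h'] p(3)[OF h] p(3)[OF inA(3)] p(3)[OF xH] x pu by auto
    show "\<phi> (\<alpha>\<^sub>1 h) = \<alpha>\<^sub>1' (\<phi> h)" using A.\<alpha>_H\<^sub>1[OF that] B.\<alpha>_H\<^sub>1[OF h'] p(4)[OF h] by simp
  qed
  then show "map_isom \<phi> (H\<^sub>1, \<sigma>\<^sub>1, \<alpha>\<^sub>1, r\<^sub>1) (H\<^sub>1', \<sigma>\<^sub>1', \<alpha>\<^sub>1', r\<^sub>1')"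
    using b1 p(2) by (auto simp: map_isom.simps)
  have "\<phi> (\<sigma>\<^sub>2 h) = \<sigma>\<^sub>2' (\<phi> h)" "\<phi> (\<alpha>\<^sub>2 h) = \<alpha>\<^sub>2' (\<phi> h)" if "h \<in> H\<^sub>2" for h
  proof -
    note h = inA(2)[OF that]
    have h': "\<phi> h \<in> H\<^sub>2'" using b2 that by (rule bij_betw_apply)
    have e: "\<phi> h = r\<^sub>2' \<longleftrightarrow> h = r\<^sub>2" "\<phi> h = B.x \<longleftrightarrow> h = A.x" using inj[OF h r2H] inj[OF h xH] r2 x by auto
    then show "\<phi> (\<sigma>\<^sub>2 h) = \<sigma>\<^sub>2' (\<phi> h)"
      using A.\<sigma>\<^sub>2_eq[OF that] B.\<sigma>\<^sub>2_eq[OF h'] p(3)[OF h] p(3)[OF r2H] r2 x by auto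
    show "\<phi> (\<alpha>\<^sub>2 h) = \<alpha>\<^sub>2' (\<phi> h)"
    proof (cases "h = r\<^sub>2")
      case True
      then show ?thesis using A.D\<^sub>2(5,6) B.D\<^sub>2(5,6) r2 by metis
    next
      case False
      then show ?thesis using A.\<alpha>_H\<^sub>2[OF that] B.\<alpha>_H\<^sub>2[OF h'] p(4)[OF h] e by simp
    qed
  qed
  then show "map_isom \<phi> (H\<^sub>2, \<sigma>\<^sub>2, \<alpha>\<^sub>2, r\<^sub>2) (H\<^sub>2', \<sigma>\<^sub>2', \<alpha>\<^sub>2', r\<^sub>2')"
    using b2 r2 by (auto simp: map_isom.simps)
qed

section \<open>Cutting a map at its first bridge\<close>

lemma permutes_restrict:
  assumes "finite A" "inj f" "\<And>h. h \<in> A \<Longrightarrow> f h \<in> A"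
  shows "(\<lambda>h. if h \<in> A then f h else h) permutes A"
proof (rule bij_imp_permutes)
  have "f ` A = A" using assms by (intro endo_inj_surj) (auto intro: inj_on_subset)
  then show "bij_betw (\<lambda>h. if h \<in> A then f h else h) A A"
    using assms(2) by (auto simp: bij_betw_def inj_on_def dest: injD)
qed auto

text \<open>A single-exit set of least cardinality is the 2-edge-connected component of the root after
  deleting the edge of \<open>\<sigma> r\<close>; its exit is the first bridge on the way to \<open>\<alpha> (\<sigma> r)\<close>.\<close>

lemma good_map_decompose:
  assumes g: "good_map (H, \<sigma>, \<alpha>, r)" and ne: "H \<noteq> {r}"
  shows "\<exists>H\<^sub>1 H\<^sub>2 \<sigma>\<^sub>1 \<alpha>\<^sub>1 \<sigma>\<^sub>2 \<alpha>\<^sub>2 i r\<^sub>2 u. gluing H\<^sub>1 H\<^sub>2 \<sigma>\<^sub>1 \<alpha>\<^sub>1 \<sigma>\<^sub>2 \<alpha>\<^sub>2 r i r\<^sub>2 u \<and>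
           (H, \<sigma>, \<alpha>, r) = glue (H\<^sub>1, \<sigma>\<^sub>1, \<alpha>\<^sub>1, r) i (H\<^sub>2, \<sigma>\<^sub>2, \<alpha>\<^sub>2, r\<^sub>2) u"
proof -
  note D = good_mapD[OF g]
  define x where "x = \<sigma> r"
  have inH: "\<sigma> h \<in> H \<longleftrightarrow> h \<in> H" "\<alpha> h \<in> H \<longleftrightarrow> h \<in> H" for h
    using D(2,3) by (auto simp: permutes_in_image)
  have xH: "x \<in> H" using inH D(5) by (simp add: x_def)
  have inj\<sigma>: "inj \<sigma>" and inj\<alpha>: "inj \<alpha>" using D(2,3) by (auto intro: permutes_inj)
  have \<alpha>r: "\<alpha> r = r" using D(5,6) by auto
  \<comment> \<open>Otherwise the root is a vertex by itself and no edge connects it to the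
    remaining half-edges.\<close>
  have xr: "x \<noteq> r"
  proof
    assume "x = r"
    obtain g where "g \<in> H - {r}" "\<alpha> g \<notin> H - {r}"
    proof (rule good_map_exits[OF g, of "H - {r}"])
      show "\<sigma> h \<in> H - {r}" if "h \<in> H - {r}" for h
        using that inH injD[OF inj\<sigma>, of h r] \<open>x = r\<close> by (auto simp: x_def)
    qed (use ne D(5) in auto)
    then show False using \<alpha>r inH D(4) by (metis Diff_iff singletonD insertI1)
  qed
  have \<alpha>x: "\<alpha> x \<noteq> x" using D(6) xH xr by auto
  \<comment> \<open>A single-exit set exists: all half-edges but \<open>x\<close>, with exit
    \<open>\<alpha> x\<close>. It is the least one when deleting the edge of \<open>x\<close> leaves
    no bridge.\<close>
  have "single_exit (H, \<sigma>, \<alpha>, r) (H - {x}) (\<alpha> x)"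
    unfolding single_exit.simps x_def[symmetric]
    using inH xH xr D(5) D(4) \<alpha>x injD[OF inj\<sigma>, of x r] by (auto simp: x_def[symmetric])
  then have "\<exists>S. \<exists>u. single_exit (H, \<sigma>, \<alpha>, r) S u" by blast
  then obtain S where exS: "\<exists>u. single_exit (H, \<sigma>, \<alpha>, r) S u"
    and min: "\<And>S'. card S' < card S \<Longrightarrow> \<not> (\<exists>u. single_exit (H, \<sigma>, \<alpha>, r) S' u)"
    using ex_has_least_nat[of "\<lambda>S. \<exists>u. single_exit (H, \<sigma>, \<alpha>, r) S u" _ card]
    by (metis not_le)
  then obtain u where "single_exit (H, \<sigma>, \<alpha>, r) S u" by blast
  then have S: "S \<subseteq> H" "r \<in> S" "x \<notin> S" "\<sigma> x \<in> S" "\<And>h. h\<in>S \<Longrightarrow> \<sigma> h \<in> insert x S"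
     "u \<in> S" "\<alpha> u \<notin> S" and Sx: "\<And>h. h\<in>S \<Longrightarrow> \<alpha> h \<notin> S \<Longrightarrow> h = u"
    unfolding single_exit.simps x_def by auto
  have finS: "finite S" using S(1) D(1) by (rule finite_subset)
  have cl: "\<sigma> h \<in> insert x S \<longleftrightarrow> h \<in> insert x S" for h
    using S(4,5) finS inj\<sigma> by (intro inj_closed_iff) auto
  have \<sigma>x: "\<sigma> h = x \<longleftrightarrow> h = r" for h using injD[OF inj\<sigma>, of h r] by (auto simp: x_def)
  define r\<^sub>2 where "r\<^sub>2 = \<alpha> u"
  define H\<^sub>1 where "H\<^sub>1 = S - {u}"
  define H\<^sub>2 where "H\<^sub>2 = H - S"
  have ur: "u \<noteq> r" using S(2,7) \<alpha>r by auto
  have uH: "u \<in> H" using S by auto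
  have r2: "r\<^sub>2 \<in> H\<^sub>2" "x \<in> H\<^sub>2" using S uH inH xH by (auto simp: H\<^sub>2_def r\<^sub>2_def)
  have r1: "r \<in> H\<^sub>1" using S ur by (auto simp: H\<^sub>1_def)
  obtain p where p: "\<sigma> p = u" using permutes_surj[OF D(2)] by (metis surjD)
  have pS: "p \<in> insert x S" using cl[of p] p S by auto
  \<comment> \<open>If \<open>u\<close> were its own predecessor, it would be a vertex of degree
    one, and its edge a bridge.\<close>
  have pu: "p \<noteq> u"
  proof
    assume "p = u"
    obtain g h where "g \<in> {u}" "h \<in> {u}" "g \<noteq> h"
      by (rule good_map_exits[OF g, of "{u}"]) (use uH ur p \<open>p = u\<close> in auto)
    then show False by auto
  qed
  \<comment> \<open>The marked corner is the one after the predecessor of \<open>u\<close>. If that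
    predecessor is \<open>x\<close>, which is about to be moved away, its own predecessor
    \<open>r\<close> takes its place.\<close>
  define i where "i = (if p = x then r else p)"
  have i: "i \<in> H\<^sub>1" using pS pu r1 by (auto simp: i_def H\<^sub>1_def)
  have neqs: "u \<noteq> r" "u \<noteq> r\<^sub>2" "u \<noteq> x" "i \<noteq> u" "r \<noteq> r\<^sub>2" "r \<noteq> x" "i \<noteq> r\<^sub>2" "i \<noteq> x"
    using ur S r2 r1 i by (auto simp: H\<^sub>1_def H\<^sub>2_def)
  \<comment> \<open>The three transpositions of \<open>glue\<close>, undone in reverse order. The
    result fixes \<open>u\<close> and preserves \<open>H\<^sub>1\<close> and
    \<open>H\<^sub>2\<close>; its restrictions are the rotations of the two pieces.\<close>
  define \<tau> where "\<tau> = \<sigma> \<circ> transpose r\<^sub>2 x \<circ> transpose r r\<^sub>2 \<circ> transpose i u"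
  have inj\<tau>: "inj \<tau>" unfolding \<tau>_def by (intro inj_compose inj\<sigma> inj_transpose)
  have \<tau>u: "\<tau> u = u"
    using neqs neqs[symmetric] p \<sigma>x[of r] by (auto simp: \<tau>_def transpose_def i_def split: if_splits)
  have \<tau>i: "\<tau> i = \<sigma> u"
    using neqs neqs[symmetric] by (auto simp: \<tau>_def transpose_def)
  have \<tau>r: "\<tau> r = \<sigma> x" if "i \<noteq> r"
    using neqs neqs[symmetric] that by (auto simp: \<tau>_def transpose_def)
  have \<tau>1: "\<tau> h = \<sigma> h" if "h \<in> H\<^sub>1" "h \<noteq> i" "h \<noteq> r" for h
    using that r2 by (auto simp: \<tau>_def transpose_def H\<^sub>1_def H\<^sub>2_def)
  have \<tau>r2: "\<tau> r\<^sub>2 = x"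
    using neqs neqs[symmetric] by (auto simp: \<tau>_def transpose_def x_def)
  have \<tau>x: "\<tau> x = \<sigma> r\<^sub>2" if "x \<noteq> r\<^sub>2"
    using neqs neqs[symmetric] that by (auto simp: \<tau>_def transpose_def)
  have \<tau>2: "\<tau> h = \<sigma> h" if "h \<in> H\<^sub>2" "h \<noteq> r\<^sub>2" "h \<noteq> x" for h
    using that r1 i S(2,6) by (auto simp: \<tau>_def transpose_def H\<^sub>1_def H\<^sub>2_def)
  have \<tau>out: "\<tau> h = h" if "h \<notin> H" for h
  proof -
    have "h \<noteq> i" "h \<noteq> u" "h \<noteq> r" "h \<noteq> r\<^sub>2" "h \<noteq> x"
      using that i r2 uH S(1) xH D(5) by (auto simp: H\<^sub>1_def H\<^sub>2_def)
    then show ?thesis using permutes_not_in[OF D(2) that] by (simp add: \<tau>_def)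
  qed
  have \<tau>H1: "\<tau> h \<in> H\<^sub>1" if h: "h \<in> H\<^sub>1" for h
  proof -
    have "\<tau> h \<noteq> u" using injD[OF inj\<tau>, of h u] \<tau>u h by (auto simp: H\<^sub>1_def)
    moreover consider "h = i" | "h = r" "i \<noteq> r" | "h \<noteq> i" "h \<noteq> r" by blast
    then have "\<tau> h \<in> S"
    proof cases
      case 1 then show ?thesis using \<tau>i S(5)[OF S(6)] \<sigma>x[of u] ur by auto
    next
      case 2 then show ?thesis using \<tau>r S by auto
    next
      case 3 then show ?thesis using \<tau>1[OF h] S(5)[of h] \<sigma>x[of h] h by (auto simp: H\<^sub>1_def)
    qed
    ultimately show ?thesis by (simp add: H\<^sub>1_def)
  qed
  have \<tau>H2: "\<tau> h \<in> H\<^sub>2" if h: "h \<in> H\<^sub>2" for h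
  proof -
    consider "h = r\<^sub>2" | "h = x" "x \<noteq> r\<^sub>2" | "h \<noteq> r\<^sub>2" "h \<noteq> x" by blast
    then show ?thesis
    proof cases
      case 1 then show ?thesis using \<tau>r2 r2 by simp
    next
      case 2 then show ?thesis using \<tau>x cl[of r\<^sub>2] inH r2 by (auto simp: H\<^sub>2_def)
    next
      case 3 then show ?thesis using \<tau>2[OF h] cl[of h] inH h by (auto simp: H\<^sub>2_def)
    qed
  qed
  define \<sigma>\<^sub>1 where "\<sigma>\<^sub>1 h = (if h \<in> H\<^sub>1 then \<tau> h else h)" for h
  define \<sigma>\<^sub>2 where "\<sigma>\<^sub>2 h = (if h \<in> H\<^sub>2 then \<tau> h else h)" for h
  define \<alpha>\<^sub>1 where "\<alpha>\<^sub>1 h = (if h \<in> H\<^sub>1 then \<alpha> h else h)" for h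
  \<comment> \<open>Cutting the edge between \<open>u\<close> and \<open>r\<^sub>2\<close> discards
    \<open>u\<close> and leaves \<open>r\<^sub>2\<close> fixed, as the root of the second
    piece.\<close>
  define \<alpha>\<^sub>2 where "\<alpha>\<^sub>2 h = (if h \<in> H\<^sub>2 - {r\<^sub>2} then \<alpha> h else h)" for h
  have fin: "finite H\<^sub>1" "finite H\<^sub>2" using D(1) finS by (auto simp: H\<^sub>1_def H\<^sub>2_def)
  have H12: "H\<^sub>1 \<inter> H\<^sub>2 = {}" "H = insert u (H\<^sub>1 \<union> H\<^sub>2)" using S uH by (auto simp: H\<^sub>1_def H\<^sub>2_def)
  have \<alpha>\<alpha>: "\<alpha> (\<alpha> h) = h" if "h \<in> H" for h using that D(4) by blast
  have \<alpha>H1: "\<alpha> h \<in> H\<^sub>1" if "h \<in> H\<^sub>1" for h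
    using that S(1) Sx[of h] \<alpha>\<alpha>[of h] S(7) by (auto simp: H\<^sub>1_def)
  have \<alpha>H2: "\<alpha> h \<in> H\<^sub>2 - {r\<^sub>2}" if h: "h \<in> H\<^sub>2 - {r\<^sub>2}" for h
  proof -
    have "\<alpha> h \<noteq> r\<^sub>2" using injD[OF inj\<alpha>, of h u] h S(6) by (auto simp: r\<^sub>2_def H\<^sub>2_def)
    moreover have "\<alpha> h \<notin> S" using Sx[of "\<alpha> h"] \<alpha>\<alpha>[of h] h by (auto simp: r\<^sub>2_def H\<^sub>2_def)
    ultimately show ?thesis using h inH by (auto simp: H\<^sub>2_def)
  qed
  have \<sigma>1p: "\<sigma>\<^sub>1 permutes H\<^sub>1" unfolding \<sigma>\<^sub>1_def using fin(1) inj\<tau> \<tau>H1 by (rule permutes_restrict)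
  have \<sigma>2p: "\<sigma>\<^sub>2 permutes H\<^sub>2" unfolding \<sigma>\<^sub>2_def using fin(2) inj\<tau> \<tau>H2 by (rule permutes_restrict)
  have \<alpha>1p: "\<alpha>\<^sub>1 permutes H\<^sub>1" unfolding \<alpha>\<^sub>1_def using fin(1) inj\<alpha> \<alpha>H1 by (rule permutes_restrict)
  have "\<alpha>\<^sub>2 permutes H\<^sub>2 - {r\<^sub>2}" unfolding \<alpha>\<^sub>2_def using fin inj\<alpha> \<alpha>H2 by (intro permutes_restrict) auto
  then have \<alpha>2p: "\<alpha>\<^sub>2 permutes H\<^sub>2" by (rule permutes_subset) auto
  have good1: "good_map (H\<^sub>1, \<sigma>\<^sub>1, \<alpha>\<^sub>1, r)"
  proof (rule good_mapI)
    show "\<alpha>\<^sub>1 (\<alpha>\<^sub>1 h) = h" if "h \<in> H\<^sub>1" for h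
      using \<alpha>H1[OF that] that \<alpha>\<alpha>[of h] H12 by (auto simp: \<alpha>\<^sub>1_def)
    show "(\<alpha>\<^sub>1 h = h) = (h = r)" if "h \<in> H\<^sub>1" for h
      using that D(6)[of h] H12 by (auto simp: \<alpha>\<^sub>1_def)
  next
    fix T assume T: "T \<subseteq> H\<^sub>1" "T \<noteq> {}" "r \<notin> T" "\<And>h. \<sigma>\<^sub>1 h \<in> T \<longleftrightarrow> h \<in> T"
      and one: "\<And>g h. g \<in> T \<Longrightarrow> h \<in> T \<Longrightarrow> \<alpha>\<^sub>1 g \<notin> T \<Longrightarrow> \<alpha>\<^sub>1 h \<notin> T \<Longrightarrow> g = h"
    have T\<tau>: "\<tau> h \<in> T \<longleftrightarrow> h \<in> T" if "h \<in> H\<^sub>1" for h using T(4)[of h] that by (simp add: \<sigma>\<^sub>1_def)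
    have T\<alpha>: "\<alpha>\<^sub>1 h = \<alpha> h" if "h \<in> T" for h using that T(1) by (auto simp: \<alpha>\<^sub>1_def)
    have TH: "T \<subseteq> H" using T(1) H12 by auto
    show False
    proof (cases "i \<in> T")
      case False
      obtain g h where gh: "g \<in> T" "h \<in> T" "g \<noteq> h" "\<alpha> g \<notin> T" "\<alpha> h \<notin> T"
      proof (rule good_map_exits[OF g TH T(2,3)])
        fix h assume "h \<in> T"
        then show "\<sigma> h \<in> T" using T\<tau>[of h] \<tau>1[of h] T(1,3) False by (metis subsetD)
      qed
      then show False using one[of g h] T\<alpha> by auto
    next
      case True
      then have ir: "i \<noteq> r" using T(3) by auto
      \<comment> \<open>A cut of the first piece that does not contain \<open>i\<close> is also a
        cut of the whole map. One that contains \<open>i\<close> is not, since \<open>u\<close>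
        follows \<open>i\<close> there. Taking it away from \<open>H\<^sub>1\<close> leaves a
        single-exit set smaller than \<open>S\<close>, against minimality.\<close>
      let ?S = "H\<^sub>1 - T"
      have less: "card ?S < card S"
        using finS T(2) S(6) by (intro psubset_card_mono) (auto simp: H\<^sub>1_def)
      \<comment> \<open>Without an exit of its own, \<open>T\<close> together with \<open>u\<close>
        would be closed in the whole map and have \<open>u\<close> as its only exit.\<close>
      have "\<exists>k. k \<in> T \<and> \<alpha> k \<notin> T"
      proof (rule ccontr)
        assume none: "\<nexists>k. k \<in> T \<and> \<alpha> k \<notin> T"
        obtain g h where gh: "g \<in> insert u T" "h \<in> insert u T" "g \<noteq> h"
          "\<alpha> g \<notin> insert u T" "\<alpha> h \<notin> insert u T"
        proof (rule good_map_exits[OF g, of "insert u T"])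
          fix h assume "h \<in> insert u T"
          then consider "h = u" | "h = i" | "h \<in> T" "h \<noteq> i" by blast
          then show "\<sigma> h \<in> insert u T"
          proof cases
            case 1 then show ?thesis using \<tau>i T\<tau>[OF i] True by simp
          next
            case 2 then show ?thesis using p ir by (auto simp: i_def split: if_splits)
          next
            case 3 then show ?thesis using T\<tau>[of h] \<tau>1[of h] T(1,3) by (metis subsetD insertCI)
          qed
        qed (use TH uH ur T(3) in auto)
        then show False using none by blast
      qed
      then obtain k where k: "k \<in> T" "\<alpha> k \<notin> T" by blast
      have "single_exit (H, \<sigma>, \<alpha>, r) ?S (\<alpha> k)"
        unfolding single_exit.simps x_def[symmetric]
      proof (intro conjI ballI impI)
        show "?S \<subseteq> H" using H12 by auto
        show "r \<in> ?S" using r1 T(3) by auto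
        show "x \<notin> ?S" using r2 H12 by auto
        show "\<sigma> x \<in> ?S" using \<tau>r[OF ir] \<tau>H1[OF r1] T\<tau>[OF r1] T(3) by auto
        show "\<sigma> h \<in> insert x ?S" if "h \<in> ?S" for h
        proof -
          have "h \<noteq> i" using that True by auto
          then show ?thesis
            using that \<tau>1[of h] \<tau>H1[of h] T\<tau>[of h] by (cases "h = r") (auto simp: x_def)
        qed
        show "\<alpha> k \<in> ?S" using k \<alpha>H1[of k] T(1) by auto
        show "\<alpha> (\<alpha> k) \<notin> ?S" using \<alpha>\<alpha>[of k] TH k by auto
        show "h = \<alpha> k" if "h \<in> ?S" "\<alpha> h \<notin> ?S" for h
        proof -
          have h: "h \<in> H" "\<alpha> h \<in> T" "h \<notin> T" using that \<alpha>H1[of h] H12 by auto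
          have "\<alpha> h = k" using one[of "\<alpha> h" k] T\<alpha> k h \<alpha>\<alpha>[OF h(1)] by auto
          then show ?thesis using \<alpha>\<alpha>[OF h(1)] by auto
        qed
      qed
      then show False using min[OF less] by blast
    qed
  qed (use fin \<sigma>1p \<alpha>1p r1 in auto)
  have good2: "good_map (H\<^sub>2, \<sigma>\<^sub>2, \<alpha>\<^sub>2, r\<^sub>2)"
  proof (rule good_mapI)
    show "\<alpha>\<^sub>2 (\<alpha>\<^sub>2 h) = h" if "h \<in> H\<^sub>2" for h
      using \<alpha>H2[of h] that \<alpha>\<alpha>[of h] H12 by (auto simp: \<alpha>\<^sub>2_def)
    show "(\<alpha>\<^sub>2 h = h) = (h = r\<^sub>2)" if "h \<in> H\<^sub>2" for h
      using that D(6)[of h] H12 r1 by (auto simp: \<alpha>\<^sub>2_def)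
  next
    fix T assume T: "T \<subseteq> H\<^sub>2" "T \<noteq> {}" "r\<^sub>2 \<notin> T" "\<And>h. \<sigma>\<^sub>2 h \<in> T \<longleftrightarrow> h \<in> T"
      and one: "\<And>g h. g \<in> T \<Longrightarrow> h \<in> T \<Longrightarrow> \<alpha>\<^sub>2 g \<notin> T \<Longrightarrow> \<alpha>\<^sub>2 h \<notin> T \<Longrightarrow> g = h"
    \<comment> \<open>On \<open>H\<^sub>2\<close> the maps \<open>\<tau>\<close> and
      \<open>\<sigma>\<close> differ only at \<open>r\<^sub>2\<close> and \<open>x\<close>. The cut
      misses both, so it is also a cut of the whole map.\<close>
    have xT: "x \<notin> T" using T(3) T(4)[of r\<^sub>2] \<tau>r2 r2 by (simp add: \<sigma>\<^sub>2_def)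
    obtain g h where gh: "g \<in> T" "h \<in> T" "g \<noteq> h" "\<alpha> g \<notin> T" "\<alpha> h \<notin> T"
    proof (rule good_map_exits[OF g _ T(2)])
      fix h assume h: "h \<in> T"
      then have "h \<in> H\<^sub>2" "h \<noteq> r\<^sub>2" "h \<noteq> x" using T xT by auto
      then show "\<sigma> h \<in> T" using T(4)[of h] \<tau>2[of h] h by (simp add: \<sigma>\<^sub>2_def)
    qed (use T(1) H12 r1 in auto)
    moreover have "\<alpha>\<^sub>2 k = \<alpha> k" if "k \<in> T" for k using that T(1,3) by (auto simp: \<alpha>\<^sub>2_def)
    ultimately show False using one[of g h] by auto
  qed (use fin \<sigma>2p \<alpha>2p r2 in auto)
  have glu: "gluing H\<^sub>1 H\<^sub>2 \<sigma>\<^sub>1 \<alpha>\<^sub>1 \<sigma>\<^sub>2 \<alpha>\<^sub>2 r i r\<^sub>2 u"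
    using good1 good2 i H12(1) S(6) by unfold_locales (auto simp: H\<^sub>1_def H\<^sub>2_def)
  have \<sigma>12: "\<sigma>\<^sub>1 \<circ> \<sigma>\<^sub>2 = \<tau>"
  proof
    fix h
    consider "h \<in> H\<^sub>1" | "h \<in> H\<^sub>2" | "h = u" | "h \<notin> H" using H12 by blast
    then show "(\<sigma>\<^sub>1 \<circ> \<sigma>\<^sub>2) h = \<tau> h"
      by cases (use H12 \<tau>H2[of h] \<tau>u \<tau>out[of h] in \<open>auto simp: \<sigma>\<^sub>1_def \<sigma>\<^sub>2_def\<close>)
  qed
  have "\<sigma>\<^sub>1 \<circ> \<sigma>\<^sub>2 \<circ> transpose i u \<circ> transpose r r\<^sub>2 \<circ> transpose r\<^sub>2 (\<sigma>\<^sub>2 r\<^sub>2) = \<sigma>"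
    using r2(1) \<tau>r2 unfolding \<sigma>12 by (auto simp: fun_eq_iff \<tau>_def \<sigma>\<^sub>2_def)
  moreover have "\<alpha>\<^sub>1 \<circ> \<alpha>\<^sub>2 \<circ> transpose u r\<^sub>2 = \<alpha>"
  proof
    fix h
    have "u \<notin> H\<^sub>1" "u \<notin> H\<^sub>2" using S(6) by (auto simp: H\<^sub>1_def H\<^sub>2_def)
    consider "h = u" | "h = r\<^sub>2" | "h \<in> H\<^sub>1" "h \<noteq> r\<^sub>2" "h \<noteq> u" | "h \<in> H\<^sub>2 - {r\<^sub>2}" "h \<noteq> u" | "h \<notin> H"
      using H12 \<open>u \<notin> H\<^sub>1\<close> \<open>u \<notin> H\<^sub>2\<close> r2 by blast
    then show "(\<alpha>\<^sub>1 \<circ> \<alpha>\<^sub>2 \<circ> transpose u r\<^sub>2) h = \<alpha> h"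
    proof cases
      case 1 then show ?thesis using r2 H12 by (auto simp: \<alpha>\<^sub>1_def \<alpha>\<^sub>2_def r\<^sub>2_def)
    next
      case 2 then show ?thesis using \<open>u \<notin> H\<^sub>1\<close> \<open>u \<notin> H\<^sub>2\<close> \<alpha>\<alpha>[OF uH] by (auto simp: \<alpha>\<^sub>1_def \<alpha>\<^sub>2_def r\<^sub>2_def)
    next
      case 3 then show ?thesis using H12 by (auto simp: \<alpha>\<^sub>1_def \<alpha>\<^sub>2_def)
    next
      case 4 then show ?thesis using H12 \<alpha>H2[of h] by (auto simp: \<alpha>\<^sub>1_def \<alpha>\<^sub>2_def)
    next
      case 5
      then have "h \<noteq> u" "h \<noteq> r\<^sub>2" "h \<notin> H\<^sub>1" "h \<notin> H\<^sub>2" using H12 r2 by auto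
      with 5 show ?thesis using permutes_not_in[OF D(3)] by (auto simp: \<alpha>\<^sub>1_def \<alpha>\<^sub>2_def)
    qed
  qed
  ultimately have "(H, \<sigma>, \<alpha>, r) = glue (H\<^sub>1, \<sigma>\<^sub>1, \<alpha>\<^sub>1, r) i (H\<^sub>2, \<sigma>\<^sub>2, \<alpha>\<^sub>2, r\<^sub>2) u" using H12(2) by simp
  with glu show ?thesis by blast
qed

section \<open>Cuts and bridges\<close>

lemma orbit_self: "h \<in> orbit f h"
proof -
  have "(f ^^ 0) h \<in> orbit f h" unfolding orbit_def by blast
  then show ?thesis by simp
qed

lemma orbit_closed: "k \<in> orbit f h \<Longrightarrow> f k \<in> orbit f h"
proof -
  assume "k \<in> orbit f h"
  then obtain n where "k = (f ^^ n) h" unfolding orbit_def by blast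
  then have "f k = (f ^^ Suc n) h" by simp
  then show ?thesis unfolding orbit_def by blast
qed

lemma orbit_least:
  assumes "h \<in> T" "\<And>k. k \<in> T \<Longrightarrow> f k \<in> T"
  shows "orbit f h \<subseteq> T"
proof -
  have "(f ^^ n) h \<in> T" for n by (induction n) (use assms in auto)
  then show ?thesis by (auto simp: orbit_def)
qed

lemma orbit_apply:
  assumes "finite H" "f permutes H" "h \<in> H"
  shows "orbit f (f h) = orbit f h"
proof (rule subset_antisym)
  show "orbit f (f h) \<subseteq> orbit f h" by (intro orbit_least orbit_closed orbit_self)
  have "orbit f (f h) \<subseteq> H"
    using assms by (intro orbit_least) (auto simp: permutes_in_image)
  then have "finite (orbit f (f h))" using assms(1) by (rule finite_subset)
  then have "h \<in> orbit f (f h)"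
    using inj_closed_iff[of "orbit f (f h)" f h] permutes_inj[OF assms(2)] orbit_self orbit_closed by metis
  then show "orbit f h \<subseteq> orbit f (f h)" by (intro orbit_least orbit_closed)
qed

lemma orbit_involution:
  assumes "f (f h) = h"
  shows "orbit f h = {h, f h}"
proof (rule subset_antisym)
  show "orbit f h \<subseteq> {h, f h}" using assms by (intro orbit_least) auto
  show "{h, f h} \<subseteq> orbit f h" using orbit_self[of h f] orbit_closed[of h f h] by auto
qed

text \<open>A bad cut \<open>T\<close> is joined to the rest by at most one edge. Once this edge is
  deleted, a step of adjacency into \<open>T\<close> would need another exit of \<open>T\<close>; so
  no path from the root vertex reaches \<open>T\<close>, and the edge is a bridge.\<close>

lemma closed_bridgeless_imp_good_map:
  assumes M: "is_closed_rooted_map (m, \<sigma>, \<alpha>, r)" and b: "bridgeless (m, \<sigma>, \<alpha>, r)"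
  shows "good_map ({0..<m}, \<sigma>, \<alpha>, r)"
proof (rule good_mapI)
  let ?M = "(m, \<sigma>, \<alpha>, r)"
  have C: "bij_betw \<sigma> {0..<m} {0..<m}" "\<And>h. m \<le> h \<Longrightarrow> \<sigma> h = h"
    "bij_betw \<alpha> {0..<m} {0..<m}" "\<And>h. m \<le> h \<Longrightarrow> \<alpha> h = h" "\<And>h. h < m \<Longrightarrow> \<alpha> (\<alpha> h) = h"
    "r < m" "\<alpha> r = r" "\<And>h. h < m \<Longrightarrow> \<alpha> h = h \<Longrightarrow> h = r"
    using M unfolding is_closed_rooted_map_def prod.case by blast+
  show "\<sigma> permutes {0..<m}" by (rule bij_imp_permutes[OF C(1)]) (simp add: C(2))
  show "\<alpha> permutes {0..<m}" by (rule bij_imp_permutes[OF C(3)]) (simp add: C(4))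
  show r: "r \<in> {0..<m}" using C(6) by simp
  show aa: "\<alpha> (\<alpha> h) = h" if "h \<in> {0..<m}" for h using C(5) that by simp
  show "\<alpha> h = h \<longleftrightarrow> h = r" if "h \<in> {0..<m}" for h using C(7) C(8)[of h] that by auto
  fix T assume T: "T \<subseteq> {0..<m}" "T \<noteq> {}" "r \<notin> T" "\<And>h. \<sigma> h \<in> T \<longleftrightarrow> h \<in> T"
    and one: "\<And>g h. g \<in> T \<Longrightarrow> h \<in> T \<Longrightarrow> \<alpha> g \<notin> T \<Longrightarrow> \<alpha> h \<notin> T \<Longrightarrow> g = h"
  obtain g where g: "g < m" "\<And>h. h \<in> T \<Longrightarrow> \<alpha> h \<notin> T \<Longrightarrow> h = g"
  proof (cases "\<exists>g\<in>T. \<alpha> g \<notin> T")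
    case True
    then obtain g where g: "g \<in> T" "\<alpha> g \<notin> T" by blast
    show ?thesis
    proof (rule that)
      show "g < m" using g(1) T(1) by auto
      show "h = g" if "h \<in> T" "\<alpha> h \<notin> T" for h using that g by (intro one)
    qed
  next
    case False
    \<comment> \<open>With no exit at all any half-edge may play the part of \<open>g\<close>; the
      root is at hand.\<close>
    then show ?thesis using that[of r] r by auto
  qed
  obtain h where h: "h \<in> T" using T(2) by blast
  then have "h < m" using T(1) by auto
  let ?e = "orbit \<alpha> g"
  have "?e \<in> map_edges ?M" using g(1) by (auto simp: map_edges_def)
  moreover have "orbit \<sigma> r \<in> map_vertices ?M" "orbit \<sigma> h \<in> map_vertices ?M"
    using r \<open>h < m\<close> by (auto simp: map_vertices_def)
  ultimately have "(orbit \<sigma> r, orbit \<sigma> h) \<in> (adj_without ?M ?e)\<^sup>*"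
    using b unfolding bridgeless_def is_bridge_def by blast
  then have "orbit \<sigma> h \<inter> T = {}"
  proof (induction rule: rtrancl_induct)
    case base
    have "orbit \<sigma> r \<subseteq> - T" using T(3,4) by (intro orbit_least) auto
    then show ?case by auto
  next
    case (step v w)
    from step(2) obtain e' where e': "e' \<in> map_edges ?M" "e' \<noteq> ?e" "v \<inter> e' \<noteq> {}" "w \<inter> e' \<noteq> {}"
      and w: "w \<in> map_vertices ?M"
      by (auto simp: adj_without_def)
    obtain c where "c < m" "e' = orbit \<alpha> c" using e'(1) unfolding map_edges_def by auto
    then have c: "c < m" "e' = {c, \<alpha> c}" using orbit_involution[of \<alpha> c] aa[of c] by auto
    obtain d where d: "w = orbit \<sigma> d" using w by (auto simp: map_vertices_def)
    show ?case
    proof (cases "d \<in> T")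
      case False
      then have "orbit \<sigma> d \<subseteq> - T" using T(4) by (intro orbit_least) auto
      then show ?thesis using d by auto
    next
      case True
      then have wT: "orbit \<sigma> d \<subseteq> T" using T(4) by (intro orbit_least) auto
      obtain p q where pq: "p \<in> v" "p \<in> e'" "q \<in> w" "q \<in> e'" using e' by auto
      then have pT: "p \<notin> T" "q \<in> T" using step.IH wT d by auto
      then have "q < m" "\<alpha> q = p" using pq c aa[of c] T(1) by auto
      then have "q = g" using g(2) pT by blast
      moreover have "e' = {q, \<alpha> q}" using pq(4) c aa[of c] by auto
      ultimately have "e' = ?e" using orbit_involution[of \<alpha> g] aa[of g] g(1) by simp
      then show ?thesis using e' by blast
    qed
  qed
  then show False using h orbit_self by blast
qed auto

text \<open>In both parts the cut condition is applied to the half-edges not reached from the root.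
  One exit is enough for transitivity; the second one is there for the case that an edge has been
  deleted.\<close>

lemma good_map_imp_closed_bridgeless:
  assumes g: "good_map ({0..<m}, \<sigma>, \<alpha>, r)"
  shows "is_closed_rooted_map (m, \<sigma>, \<alpha>, r)" and "bridgeless (m, \<sigma>, \<alpha>, r)"
proof -
  let ?M = "(m, \<sigma>, \<alpha>, r)"
  note D = good_mapD[OF g]
  have inH: "\<sigma> h < m \<longleftrightarrow> h < m" "\<alpha> h < m \<longleftrightarrow> h < m" for h
    using permutes_in_image[OF D(2), of h] permutes_in_image[OF D(3), of h] by auto
  have aa: "\<alpha> (\<alpha> h) = h" if "h < m" for h using D(4) that by auto
  have rm: "r < m" using D(5) by simp
  let ?R = "{(x, y). x < m \<and> (y = \<sigma> x \<or> y = \<alpha> x)}\<^sup>*"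
  have "(r, h) \<in> ?R" if hm: "h < m" for h
  proof (rule ccontr)
    assume nh: "(r, h) \<notin> ?R"
    let ?S = "{h. h < m \<and> (r, h) \<in> ?R}"
    let ?T = "{h. h < m \<and> (r, h) \<notin> ?R}"
    \<comment> \<open>Reachability uses forward steps only; by finiteness the reached set is
      nevertheless invariant, so its complement is closed under \<open>\<sigma>\<close> too.\<close>
    have cl: "\<sigma> h \<in> ?S \<longleftrightarrow> h \<in> ?S" for h
      using inH permutes_inj[OF D(2)]
      by (intro inj_closed_iff) (auto intro: rtrancl_into_rtrancl)
    obtain k where k: "k \<in> ?T" "\<alpha> k \<notin> ?T"
    proof (rule good_map_exits[OF g, of ?T])
      show "\<sigma> h \<in> ?T" if "h \<in> ?T" for h using that cl[of h] inH by auto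
    qed (use nh hm in auto)
    then have "(r, \<alpha> k) \<in> ?R" "\<alpha> k < m" using inH by auto
    then have "(r, \<alpha> (\<alpha> k)) \<in> ?R" by (auto intro: rtrancl_into_rtrancl)
    then show False using k aa by auto
  qed
  then show "is_closed_rooted_map ?M"
    using D permutes_imp_bij[OF D(2)] permutes_imp_bij[OF D(3)]
      permutes_not_in[OF D(2)] permutes_not_in[OF D(3)]
    unfolding is_closed_rooted_map_def by auto
  show "bridgeless ?M" unfolding bridgeless_def
  proof
    fix e
    let ?A = "adj_without ?M e"
    have sym: "sym (?A\<^sup>*)" by (intro sym_rtrancl) (auto simp: sym_def adj_without_def)
    show "\<not> is_bridge ?M e"
    proof
      assume br: "is_bridge ?M e"
      then obtain c where "c < m" "e = orbit \<alpha> c" unfolding is_bridge_def map_edges_def by auto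
      then have c: "c < m" "e = {c, \<alpha> c}" using orbit_involution[of \<alpha> c] aa[of c] by auto
      have all: "(orbit \<sigma> r, orbit \<sigma> h) \<in> ?A\<^sup>*" if hm: "h < m" for h
      proof (rule ccontr)
        assume nh: "(orbit \<sigma> r, orbit \<sigma> h) \<notin> ?A\<^sup>*"
        let ?T = "{h. h < m \<and> (orbit \<sigma> r, orbit \<sigma> h) \<notin> ?A\<^sup>*}"
        obtain k l where kl: "k \<in> ?T" "l \<in> ?T" "k \<noteq> l" "\<alpha> k \<notin> ?T" "\<alpha> l \<notin> ?T"
        proof (rule good_map_exits[OF g, of ?T])
          show "\<sigma> h \<in> ?T" if "h \<in> ?T" for h using that inH orbit_apply[OF D(1,2), of h] by auto
        qed (use nh hm in auto)
        \<comment> \<open>The two exits belong to different edges, because \<open>\<alpha> k\<close>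
          lies outside the set and \<open>l\<close> inside. So at most one of them is on the deleted
          edge.\<close>
        have "\<exists>k\<in>?T. \<alpha> k \<notin> ?T \<and> k \<notin> e"
        proof (cases "k \<in> e")
          case True
          have "\<alpha> k \<noteq> l" using kl by auto
          then have "l \<notin> e" using True c aa[of c] kl(3) by auto
          then show ?thesis using kl by blast
        qed (use kl in blast)
        then obtain k where k: "k < m" "(orbit \<sigma> r, orbit \<sigma> k) \<notin> ?A\<^sup>*" "\<alpha> k \<notin> ?T" "k \<notin> e" by blast
        have "orbit \<alpha> k \<noteq> e" using k(4) orbit_self by blast
        moreover have "orbit \<alpha> k \<in> map_edges ?M" using k by (auto simp: map_edges_def)
        moreover have "k \<in> orbit \<sigma> k \<inter> orbit \<alpha> k" "\<alpha> k \<in> orbit \<sigma> (\<alpha> k) \<inter> orbit \<alpha> k"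
          using orbit_self orbit_closed by blast+
        moreover have "orbit \<sigma> k \<in> map_vertices ?M" "orbit \<sigma> (\<alpha> k) \<in> map_vertices ?M"
          using k inH by (auto simp: map_vertices_def)
        ultimately have "(orbit \<sigma> (\<alpha> k), orbit \<sigma> k) \<in> ?A" unfolding adj_without_def by blast
        moreover have "(orbit \<sigma> r, orbit \<sigma> (\<alpha> k)) \<in> ?A\<^sup>*" using k inH by auto
        ultimately show False using k(2) by (meson rtrancl_into_rtrancl)
      qed
      have "(v, w) \<in> ?A\<^sup>*" if "v \<in> map_vertices ?M" "w \<in> map_vertices ?M" for v w
        using that all symD[OF sym] by (auto simp: map_vertices_def intro: rtrancl_trans)
      then show False using br unfolding is_bridge_def by blast
    qed
  qed
qed

text \<open>Every edge has two half-edges except the root, which has one.\<close>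

lemma card_good_map:
  assumes "good_map (H, \<sigma>, \<alpha>, r)"
  shows "card H + 1 = 2 * card ((\<lambda>h. {h, \<alpha> h}) ` H)"
proof -
  note D = good_mapD[OF assms]
  have inH: "\<alpha> h \<in> H \<longleftrightarrow> h \<in> H" for h using permutes_in_image[OF D(3)] by auto
  let ?E = "(\<lambda>h. {h, \<alpha> h}) ` (H - {r})"
  have \<alpha>r: "\<alpha> r = r" using D(5,6) by auto
  have *: "\<alpha> h \<noteq> h" "\<alpha> h \<noteq> r" if "h \<in> H - {r}" for h
    using that D(4)[of h] D(6)[of h] \<alpha>r by auto
  have U: "\<Union> ?E = H - {r}" using inH * by auto
  have "2 * card ?E = card (\<Union> ?E)"
  proof (rule card_partition)
    show "card c = 2" if c: "c \<in> ?E" for c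
    proof -
      obtain h where "h \<in> H - {r}" "c = {h, \<alpha> h}" using c by blast
      then show ?thesis using *(1)[of h] by auto
    qed
    show "c1 \<inter> c2 = {}" if "c1 \<in> ?E" "c2 \<in> ?E" "c1 \<noteq> c2" for c1 c2
      using that D(4) by (auto; metis)
  qed (use D(1) U in auto)
  then have "2 * card ?E = card H - 1" using U D(1,5) by simp
  moreover have "(\<lambda>h. {h, \<alpha> h}) ` H = insert {r} ?E" using D(5) \<alpha>r by auto
  moreover have "{r} \<notin> ?E" by auto
  moreover have "card H > 0" using D(1,5) by (auto simp: card_gt_0_iff)
  ultimately show ?thesis using D(1) by simp
qed

fun rmap_of :: "cmap \<Rightarrow> nat rmap" where
  "rmap_of (m, \<sigma>, \<alpha>, r) = ({0..<m}, \<sigma>, \<alpha>, r)"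

lemma bridgeless_maps_iff:
  assumes "n \<ge> 1"
  shows "M \<in> bridgeless_maps n \<longleftrightarrow> good_map (rmap_of M) \<and> fst M = 2 * n - 1"
proof -
  obtain m \<sigma> \<alpha> r where M: "M = (m, \<sigma>, \<alpha>, r)" by (cases M)
  have "map_size M = n \<longleftrightarrow> m = 2 * n - 1" if g: "good_map (rmap_of M)"
  proof -
    note D = good_mapD[OF g[unfolded M rmap_of.simps]]
    have "orbit \<alpha> h = {h, \<alpha> h}" if "h < m" for h using D(4)[of h] that by (intro orbit_involution) auto
    then have "orbit \<alpha> ` {0..<m} = (\<lambda>h. {h, \<alpha> h}) ` {0..<m}" by (intro image_cong) auto
    moreover have "{orbit \<alpha> h |h. h < m} = orbit \<alpha> ` {0..<m}" by auto
    ultimately have "m + 1 = 2 * map_size M"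
      using card_good_map[OF g[unfolded M rmap_of.simps]] by (simp add: M map_size_def)
    then show ?thesis using assms by auto
  qed
  then show ?thesis
    using closed_bridgeless_imp_good_map[of m \<sigma> \<alpha> r] good_map_imp_closed_bridgeless[of m \<sigma> \<alpha> r]
    by (auto simp: bridgeless_maps_def M)
qed

lemma map_iso_iff: "map_iso M M' \<longleftrightarrow> (\<exists>\<phi>. map_isom \<phi> (rmap_of M) (rmap_of M'))"
  by (cases M; cases M') (simp add: map_iso_def map_isom.simps Ball_def)

section \<open>Counting isomorphism classes of maps\<close>

text \<open>A relation up to isomorphism, since the labels of \<open>cmap\<close> do not permit
  direct gluing: both pieces occupy initial segments, which overlap, and the result must be an
  initial segment again. The corner \<open>i\<close> is named in the labelling of
  \<open>M\<^sub>1\<close>.\<close>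

definition glued :: "cmap \<Rightarrow> nat \<Rightarrow> cmap \<Rightarrow> cmap \<Rightarrow> bool" where
  "glued M\<^sub>1 i M\<^sub>2 M \<longleftrightarrow> (\<exists>H\<^sub>1 H\<^sub>2 \<sigma>\<^sub>1 \<alpha>\<^sub>1 \<sigma>\<^sub>2 \<alpha>\<^sub>2 r\<^sub>1 r\<^sub>2 u \<phi>\<^sub>1 \<phi>\<^sub>2 \<psi>.
     gluing H\<^sub>1 H\<^sub>2 \<sigma>\<^sub>1 \<alpha>\<^sub>1 \<sigma>\<^sub>2 \<alpha>\<^sub>2 r\<^sub>1 (\<phi>\<^sub>1 i) r\<^sub>2 (u :: nat) \<and>
     map_isom \<phi>\<^sub>1 (rmap_of M\<^sub>1) (H\<^sub>1, \<sigma>\<^sub>1, \<alpha>\<^sub>1, r\<^sub>1) \<and> map_isom \<phi>\<^sub>2 (rmap_of M\<^sub>2) (H\<^sub>2, \<sigma>\<^sub>2, \<alpha>\<^sub>2, r\<^sub>2) \<and>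
     map_isom \<psi> (glue (H\<^sub>1, \<sigma>\<^sub>1, \<alpha>\<^sub>1, r\<^sub>1) (\<phi>\<^sub>1 i) (H\<^sub>2, \<sigma>\<^sub>2, \<alpha>\<^sub>2, r\<^sub>2) u) (rmap_of M))"

abbreviation "map_rel n \<equiv> {(M, M'). M \<in> bridgeless_maps n \<and> M' \<in> bridgeless_maps n \<and> map_iso M M'}"

lemma fst_rmap_of: "fst (rmap_of M) = {0..<fst M}"
  by (cases M) simp

lemma map_isom_card:
  assumes "map_isom \<phi> M M'"
  shows "card (fst M) = card (fst M')"
  using assms by (cases M; cases M') (auto simp: map_isom.simps intro: bij_betw_same_card)

lemma map_iso_trans: "map_iso M M' \<Longrightarrow> map_iso M' M'' \<Longrightarrow> map_iso M M''"
  unfolding map_iso_iff by (blast intro: map_isom_trans)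

lemma map_iso_sym: "good_map (rmap_of M) \<Longrightarrow> map_iso M M' \<Longrightarrow> map_iso M' M"
  unfolding map_iso_iff by (blast intro: map_isom_sym)

lemma equiv_map_rel:
  assumes "n \<ge> 1"
  shows "equiv (bridgeless_maps n) (map_rel n)"
proof (rule equivI)
  show "map_rel n \<subseteq> bridgeless_maps n \<times> bridgeless_maps n" by auto
  show "refl_on (bridgeless_maps n) (map_rel n)"
    by (rule refl_onI) (simp add: map_iso_iff, blast intro: map_isom_refl)
  show "sym (map_rel n)"
    using map_iso_sym bridgeless_maps_iff[OF assms] by (auto simp: sym_def)
  show "trans (map_rel n)"
    using map_iso_trans by (auto simp: trans_def)
qed

text \<open>Finite because both permutations are normalised to be the identity outside the
  half-edges. This makes the cardinality of the quotient meaningful.\<close>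

lemma finite_bridgeless_maps:
  assumes "n \<ge> 1"
  shows "finite (bridgeless_maps n)"
proof -
  let ?H = "{0..<2 * n - 1}"
  have "bridgeless_maps n \<subseteq> {2 * n - 1} \<times> {\<sigma>. \<sigma> permutes ?H} \<times> {\<alpha>. \<alpha> permutes ?H} \<times> ?H"
  proof
    fix M assume "M \<in> bridgeless_maps n"
    then have "good_map (rmap_of M)" "fst M = 2 * n - 1" using bridgeless_maps_iff[OF assms] by auto
    then show "M \<in> {2 * n - 1} \<times> {\<sigma>. \<sigma> permutes ?H} \<times> {\<alpha>. \<alpha> permutes ?H} \<times> ?H"
      by (cases M) (auto dest: good_mapD(2,3,5))
  qed
  then show ?thesis by (rule finite_subset) (auto intro: finite_permutations)
qed

lemma transport_to_cmap:
  fixes H :: "'a set"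
  assumes g: "good_map (H, \<sigma>, \<alpha>, r)"
  obtains M n \<phi> where "n \<ge> 1" "card H = 2 * n - 1" "M \<in> bridgeless_maps n" "map_isom \<phi> (H, \<sigma>, \<alpha>, r) (rmap_of M)"
proof -
  let ?n = "card ((\<lambda>h. {h, \<alpha> h}) ` H)"
  have c: "card H + 1 = 2 * ?n" by (rule card_good_map[OF g])
  then have n: "?n \<ge> 1" "card H = 2 * ?n - 1" by auto
  obtain \<phi> where "bij_betw \<phi> H {0..<card H}" using ex_bij_betw_finite_nat good_mapD(1)[OF g] by blast
  then obtain \<sigma>' \<alpha>' where "good_map ({0..<card H}, \<sigma>', \<alpha>', \<phi> r)"
    "map_isom \<phi> (H, \<sigma>, \<alpha>, r) ({0..<card H}, \<sigma>', \<alpha>', \<phi> r)"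
    by (rule map_isom_transport[OF g])
  then show thesis
    using that[of ?n "(card H, \<sigma>', \<alpha>', \<phi> r)" \<phi>] n by (simp add: bridgeless_maps_iff)
qed

lemma card_glue:
  assumes "gluing H\<^sub>1 H\<^sub>2 \<sigma>\<^sub>1 \<alpha>\<^sub>1 \<sigma>\<^sub>2 \<alpha>\<^sub>2 r\<^sub>1 i r\<^sub>2 u"
  shows "card (fst (glue (H\<^sub>1, \<sigma>\<^sub>1, \<alpha>\<^sub>1, r\<^sub>1) i (H\<^sub>2, \<sigma>\<^sub>2, \<alpha>\<^sub>2, r\<^sub>2) u)) = card H\<^sub>1 + card H\<^sub>2 + 1"
proof -
  interpret gluing H\<^sub>1 H\<^sub>2 \<sigma>\<^sub>1 \<alpha>\<^sub>1 \<sigma>\<^sub>2 \<alpha>\<^sub>2 r\<^sub>1 i r\<^sub>2 u by fact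
  show ?thesis using D\<^sub>1(1) D\<^sub>2(1) u disj by (simp add: card_Un_disjoint)
qed

lemma glued_exists:
  assumes k: "k \<ge> 1" and j: "j \<ge> 1" and M1: "M\<^sub>1 \<in> bridgeless_maps k" and M2: "M\<^sub>2 \<in> bridgeless_maps j"
    and i: "i < 2 * k - 1"
  shows "\<exists>M \<in> bridgeless_maps (k + j). glued M\<^sub>1 i M\<^sub>2 M"
proof -
  obtain m \<sigma>\<^sub>1 \<alpha>\<^sub>1 r\<^sub>1 m' \<sigma>' \<alpha>' r' where M: "M\<^sub>1 = (m, \<sigma>\<^sub>1, \<alpha>\<^sub>1, r\<^sub>1)" "M\<^sub>2 = (m', \<sigma>', \<alpha>', r')"
    by (cases M\<^sub>1; cases M\<^sub>2)
  have g1: "good_map ({0..<m}, \<sigma>\<^sub>1, \<alpha>\<^sub>1, r\<^sub>1)" and m: "m = 2 * k - 1" using M1 bridgeless_maps_iff[OF k] by (auto simp: M)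
  have g2: "good_map ({0..<m'}, \<sigma>', \<alpha>', r')" and m': "m' = 2 * j - 1" using M2 bridgeless_maps_iff[OF j] by (auto simp: M)
  \<comment> \<open>Shifting the second map by \<open>m\<close> makes the two sets of half-edges
    disjoint, and \<open>m + m'\<close> is the next free label, to be used for
    \<open>u\<close>.\<close>
  have "bij_betw (\<lambda>h. h + m) {0..<m'} {m..<m + m'}"
    by (rule bij_betwI[where g="\<lambda>h. h - m"]) auto
  then obtain \<sigma>\<^sub>2 \<alpha>\<^sub>2 where g2': "good_map ({m..<m + m'}, \<sigma>\<^sub>2, \<alpha>\<^sub>2, r' + m)"
    and iso2: "map_isom (\<lambda>h. h + m) ({0..<m'}, \<sigma>', \<alpha>', r') ({m..<m + m'}, \<sigma>\<^sub>2, \<alpha>\<^sub>2, r' + m)"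
    by (rule map_isom_transport[OF g2])
  have gl: "gluing {0..<m} {m..<m + m'} \<sigma>\<^sub>1 \<alpha>\<^sub>1 \<sigma>\<^sub>2 \<alpha>\<^sub>2 r\<^sub>1 (id i) (r' + m) (m + m')"
    using g1 g2' i m by unfold_locales auto
  then interpret gluing "{0..<m}" "{m..<m + m'}" \<sigma>\<^sub>1 \<alpha>\<^sub>1 \<sigma>\<^sub>2 \<alpha>\<^sub>2 r\<^sub>1 "id i" "r' + m" "m + m'" .
  obtain M n \<psi> where n: "n \<ge> 1" "card H = 2 * n - 1" and M: "M \<in> bridgeless_maps n"
    "map_isom \<psi> (H, \<sigma>, \<alpha>, r\<^sub>1) (rmap_of M)"
    by (rule transport_to_cmap[OF glue_good])
  have "card H = card {0..<m} + card {m..<m + m'} + 1" using card_glue[OF gl] unfolding glue_eq by simp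
  then have "n = k + j" using n m m' k j by simp
  moreover have "glued M\<^sub>1 i M\<^sub>2 M" unfolding glued_def
    using gl iso2 M(2) map_isom_refl[of "rmap_of M\<^sub>1"] unfolding glue_eq[symmetric]
      \<open>M\<^sub>1 = _\<close> \<open>M\<^sub>2 = _\<close> rmap_of.simps by blast
  ultimately show ?thesis using M by blast
qed

lemma glued_unique:
  assumes g1: "good_map (rmap_of M\<^sub>1)" and g2: "good_map (rmap_of M\<^sub>2)" and i: "i < fst M\<^sub>1"
    and G: "glued M\<^sub>1 i M\<^sub>2 M" and G': "glued M\<^sub>1 i M\<^sub>2 M'"
  shows "map_iso M M'"
proof -
  from G obtain H\<^sub>1 H\<^sub>2 \<sigma>\<^sub>1 \<alpha>\<^sub>1 \<sigma>\<^sub>2 \<alpha>\<^sub>2 r\<^sub>1 r\<^sub>2 u \<phi>\<^sub>1 \<phi>\<^sub>2 \<psi> where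
    A: "gluing H\<^sub>1 H\<^sub>2 \<sigma>\<^sub>1 \<alpha>\<^sub>1 \<sigma>\<^sub>2 \<alpha>\<^sub>2 r\<^sub>1 (\<phi>\<^sub>1 i) r\<^sub>2 (u :: nat)"
     "map_isom \<phi>\<^sub>1 (rmap_of M\<^sub>1) (H\<^sub>1, \<sigma>\<^sub>1, \<alpha>\<^sub>1, r\<^sub>1)" "map_isom \<phi>\<^sub>2 (rmap_of M\<^sub>2) (H\<^sub>2, \<sigma>\<^sub>2, \<alpha>\<^sub>2, r\<^sub>2)"
     "map_isom \<psi> (glue (H\<^sub>1, \<sigma>\<^sub>1, \<alpha>\<^sub>1, r\<^sub>1) (\<phi>\<^sub>1 i) (H\<^sub>2, \<sigma>\<^sub>2, \<alpha>\<^sub>2, r\<^sub>2) u) (rmap_of M)"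
    unfolding glued_def by blast
  from G' obtain H\<^sub>1' H\<^sub>2' \<sigma>\<^sub>1' \<alpha>\<^sub>1' \<sigma>\<^sub>2' \<alpha>\<^sub>2' r\<^sub>1' r\<^sub>2' u' \<phi>\<^sub>1' \<phi>\<^sub>2' \<psi>' where
    B: "gluing H\<^sub>1' H\<^sub>2' \<sigma>\<^sub>1' \<alpha>\<^sub>1' \<sigma>\<^sub>2' \<alpha>\<^sub>2' r\<^sub>1' (\<phi>\<^sub>1' i) r\<^sub>2' (u' :: nat)"
     "map_isom \<phi>\<^sub>1' (rmap_of M\<^sub>1) (H\<^sub>1', \<sigma>\<^sub>1', \<alpha>\<^sub>1', r\<^sub>1')" "map_isom \<phi>\<^sub>2' (rmap_of M\<^sub>2) (H\<^sub>2', \<sigma>\<^sub>2', \<alpha>\<^sub>2', r\<^sub>2')"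
     "map_isom \<psi>' (glue (H\<^sub>1', \<sigma>\<^sub>1', \<alpha>\<^sub>1', r\<^sub>1') (\<phi>\<^sub>1' i) (H\<^sub>2', \<sigma>\<^sub>2', \<alpha>\<^sub>2', r\<^sub>2') u') (rmap_of M')"
    unfolding glued_def by blast
  interpret A: gluing H\<^sub>1 H\<^sub>2 \<sigma>\<^sub>1 \<alpha>\<^sub>1 \<sigma>\<^sub>2 \<alpha>\<^sub>2 r\<^sub>1 "\<phi>\<^sub>1 i" r\<^sub>2 u by fact
  let ?\<rho>\<^sub>1 = "\<phi>\<^sub>1' \<circ> inv_into (fst (rmap_of M\<^sub>1)) \<phi>\<^sub>1" and ?\<rho>\<^sub>2 = "\<phi>\<^sub>2' \<circ> inv_into (fst (rmap_of M\<^sub>2)) \<phi>\<^sub>2"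
  have 1: "map_isom ?\<rho>\<^sub>1 (H\<^sub>1, \<sigma>\<^sub>1, \<alpha>\<^sub>1, r\<^sub>1) (H\<^sub>1', \<sigma>\<^sub>1', \<alpha>\<^sub>1', r\<^sub>1')"
    using map_isom_trans[OF map_isom_sym[OF g1 A(2)] B(2)] .
  have 2: "map_isom ?\<rho>\<^sub>2 (H\<^sub>2, \<sigma>\<^sub>2, \<alpha>\<^sub>2, r\<^sub>2) (H\<^sub>2', \<sigma>\<^sub>2', \<alpha>\<^sub>2', r\<^sub>2')"
    using map_isom_trans[OF map_isom_sym[OF g2 A(3)] B(3)] .
  have "inj_on \<phi>\<^sub>1 (fst (rmap_of M\<^sub>1))"
    using A(2) by (cases M\<^sub>1) (auto simp: map_isom.simps bij_betw_def)
  then have "?\<rho>\<^sub>1 (\<phi>\<^sub>1 i) = \<phi>\<^sub>1' i" using i by (simp add: fst_rmap_of)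
  then obtain \<rho> where "map_isom \<rho> (glue (H\<^sub>1, \<sigma>\<^sub>1, \<alpha>\<^sub>1, r\<^sub>1) (\<phi>\<^sub>1 i) (H\<^sub>2, \<sigma>\<^sub>2, \<alpha>\<^sub>2, r\<^sub>2) u)
      (glue (H\<^sub>1', \<sigma>\<^sub>1', \<alpha>\<^sub>1', r\<^sub>1') (\<phi>\<^sub>1' i) (H\<^sub>2', \<sigma>\<^sub>2', \<alpha>\<^sub>2', r\<^sub>2') u')"
    using glue_isom[OF A(1) B(1) 1 _ 2] by blast
  moreover have "good_map (glue (H\<^sub>1, \<sigma>\<^sub>1, \<alpha>\<^sub>1, r\<^sub>1) (\<phi>\<^sub>1 i) (H\<^sub>2, \<sigma>\<^sub>2, \<alpha>\<^sub>2, r\<^sub>2) u)"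
    unfolding A.glue_eq by (rule A.glue_good)
  ultimately show ?thesis unfolding map_iso_iff
    using A(4) B(4) map_isom_sym map_isom_trans by metis
qed

text \<open>The isomorphism of the first pieces is returned together with its effect on the corner;
  rigidity will later turn \<open>\<phi> i = i'\<close> into \<open>i = i'\<close>.\<close>

lemma glued_cancel:
  assumes g1: "good_map (rmap_of M\<^sub>1')" and g2: "good_map (rmap_of M\<^sub>2')" and g: "good_map (rmap_of M')"
    and i': "i' < fst M\<^sub>1'"
    and G: "glued M\<^sub>1 i M\<^sub>2 M" and G': "glued M\<^sub>1' i' M\<^sub>2' M'" and "map_iso M M'"
  shows "\<exists>\<phi>. map_isom \<phi> (rmap_of M\<^sub>1) (rmap_of M\<^sub>1') \<and> \<phi> i = i'" and "map_iso M\<^sub>2 M\<^sub>2'"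
proof -
  from G obtain H\<^sub>1 H\<^sub>2 \<sigma>\<^sub>1 \<alpha>\<^sub>1 \<sigma>\<^sub>2 \<alpha>\<^sub>2 r\<^sub>1 r\<^sub>2 u \<phi>\<^sub>1 \<phi>\<^sub>2 \<psi> where
    A: "gluing H\<^sub>1 H\<^sub>2 \<sigma>\<^sub>1 \<alpha>\<^sub>1 \<sigma>\<^sub>2 \<alpha>\<^sub>2 r\<^sub>1 (\<phi>\<^sub>1 i) r\<^sub>2 (u :: nat)"
     "map_isom \<phi>\<^sub>1 (rmap_of M\<^sub>1) (H\<^sub>1, \<sigma>\<^sub>1, \<alpha>\<^sub>1, r\<^sub>1)" "map_isom \<phi>\<^sub>2 (rmap_of M\<^sub>2) (H\<^sub>2, \<sigma>\<^sub>2, \<alpha>\<^sub>2, r\<^sub>2)"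
     "map_isom \<psi> (glue (H\<^sub>1, \<sigma>\<^sub>1, \<alpha>\<^sub>1, r\<^sub>1) (\<phi>\<^sub>1 i) (H\<^sub>2, \<sigma>\<^sub>2, \<alpha>\<^sub>2, r\<^sub>2) u) (rmap_of M)"
    unfolding glued_def by blast
  from G' obtain H\<^sub>1' H\<^sub>2' \<sigma>\<^sub>1' \<alpha>\<^sub>1' \<sigma>\<^sub>2' \<alpha>\<^sub>2' r\<^sub>1' r\<^sub>2' u' \<phi>\<^sub>1' \<phi>\<^sub>2' \<psi>' where
    B: "gluing H\<^sub>1' H\<^sub>2' \<sigma>\<^sub>1' \<alpha>\<^sub>1' \<sigma>\<^sub>2' \<alpha>\<^sub>2' r\<^sub>1' (\<phi>\<^sub>1' i') r\<^sub>2' (u' :: nat)"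
     "map_isom \<phi>\<^sub>1' (rmap_of M\<^sub>1') (H\<^sub>1', \<sigma>\<^sub>1', \<alpha>\<^sub>1', r\<^sub>1')" "map_isom \<phi>\<^sub>2' (rmap_of M\<^sub>2') (H\<^sub>2', \<sigma>\<^sub>2', \<alpha>\<^sub>2', r\<^sub>2')"
     "map_isom \<psi>' (glue (H\<^sub>1', \<sigma>\<^sub>1', \<alpha>\<^sub>1', r\<^sub>1') (\<phi>\<^sub>1' i') (H\<^sub>2', \<sigma>\<^sub>2', \<alpha>\<^sub>2', r\<^sub>2') u') (rmap_of M')"
    unfolding glued_def by blast
  interpret B: gluing H\<^sub>1' H\<^sub>2' \<sigma>\<^sub>1' \<alpha>\<^sub>1' \<sigma>\<^sub>2' \<alpha>\<^sub>2' r\<^sub>1' "\<phi>\<^sub>1' i'" r\<^sub>2' u' by fact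
  have gg: "good_map (glue (H\<^sub>1', \<sigma>\<^sub>1', \<alpha>\<^sub>1', r\<^sub>1') (\<phi>\<^sub>1' i') (H\<^sub>2', \<sigma>\<^sub>2', \<alpha>\<^sub>2', r\<^sub>2') u')"
    unfolding B.glue_eq by (rule B.glue_good)
  obtain \<theta> where \<theta>: "map_isom \<theta> (rmap_of M) (rmap_of M')" using assms(7) map_iso_iff by blast
  then obtain \<rho> where \<rho>: "map_isom \<rho> (glue (H\<^sub>1, \<sigma>\<^sub>1, \<alpha>\<^sub>1, r\<^sub>1) (\<phi>\<^sub>1 i) (H\<^sub>2, \<sigma>\<^sub>2, \<alpha>\<^sub>2, r\<^sub>2) u)
      (glue (H\<^sub>1', \<sigma>\<^sub>1', \<alpha>\<^sub>1', r\<^sub>1') (\<phi>\<^sub>1' i') (H\<^sub>2', \<sigma>\<^sub>2', \<alpha>\<^sub>2', r\<^sub>2') u')"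
    using map_isom_trans[OF map_isom_trans[OF A(4) \<theta>] map_isom_sym[OF gg B(4)]] by blast
  note C = glue_isom_cancel[OF A(1) B(1) \<rho>]
  show "map_iso M\<^sub>2 M\<^sub>2'" unfolding map_iso_iff
    using map_isom_trans[OF map_isom_trans[OF A(3) C(3)] map_isom_sym[OF g2 B(3)]] by blast
  have "inj_on \<phi>\<^sub>1' (fst (rmap_of M\<^sub>1'))"
    using B(2) by (cases M\<^sub>1') (auto simp: map_isom.simps bij_betw_def)
  then have "inv_into (fst (rmap_of M\<^sub>1')) \<phi>\<^sub>1' (\<phi>\<^sub>1' i') = i'" using i' by (simp add: fst_rmap_of)
  then show "\<exists>\<phi>. map_isom \<phi> (rmap_of M\<^sub>1) (rmap_of M\<^sub>1') \<and> \<phi> i = i'"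
    using map_isom_trans[OF map_isom_trans[OF A(2) C(1)] map_isom_sym[OF g1 B(2)]] C(2)
    by (intro exI[of _ "inv_into (fst (rmap_of M\<^sub>1')) \<phi>\<^sub>1' \<circ> (\<rho> \<circ> \<phi>\<^sub>1)"]) simp
qed

text \<open>Permits a change to the chosen representatives of the classes of the pieces; the corner
  has to travel along \<open>\<phi>\<close>.\<close>

lemma glued_transfer:
  assumes "good_map (rmap_of M\<^sub>1)" "good_map (rmap_of M\<^sub>2)" "i < fst M\<^sub>1"
    "glued M\<^sub>1 i M\<^sub>2 M" "map_isom \<phi> (rmap_of M\<^sub>1) (rmap_of M\<^sub>1')" "map_iso M\<^sub>2 M\<^sub>2'"
  shows "glued M\<^sub>1' (\<phi> i) M\<^sub>2' M"
proof -
  from assms(4) obtain H\<^sub>1 H\<^sub>2 \<sigma>\<^sub>1 \<alpha>\<^sub>1 \<sigma>\<^sub>2 \<alpha>\<^sub>2 r\<^sub>1 r\<^sub>2 u \<phi>\<^sub>1 \<phi>\<^sub>2 \<psi> where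
    A: "gluing H\<^sub>1 H\<^sub>2 \<sigma>\<^sub>1 \<alpha>\<^sub>1 \<sigma>\<^sub>2 \<alpha>\<^sub>2 r\<^sub>1 (\<phi>\<^sub>1 i) r\<^sub>2 (u :: nat)"
     "map_isom \<phi>\<^sub>1 (rmap_of M\<^sub>1) (H\<^sub>1, \<sigma>\<^sub>1, \<alpha>\<^sub>1, r\<^sub>1)" "map_isom \<phi>\<^sub>2 (rmap_of M\<^sub>2) (H\<^sub>2, \<sigma>\<^sub>2, \<alpha>\<^sub>2, r\<^sub>2)"
     "map_isom \<psi> (glue (H\<^sub>1, \<sigma>\<^sub>1, \<alpha>\<^sub>1, r\<^sub>1) (\<phi>\<^sub>1 i) (H\<^sub>2, \<sigma>\<^sub>2, \<alpha>\<^sub>2, r\<^sub>2) u) (rmap_of M)"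
    unfolding glued_def by blast
  let ?\<phi>\<^sub>1 = "\<phi>\<^sub>1 \<circ> inv_into (fst (rmap_of M\<^sub>1)) \<phi>"
  have "map_isom ?\<phi>\<^sub>1 (rmap_of M\<^sub>1') (H\<^sub>1, \<sigma>\<^sub>1, \<alpha>\<^sub>1, r\<^sub>1)"
    using map_isom_trans[OF map_isom_sym[OF assms(1,5)] A(2)] .
  moreover have "inj_on \<phi> (fst (rmap_of M\<^sub>1))"
    using assms(5) by (cases M\<^sub>1; cases M\<^sub>1') (auto simp: map_isom.simps bij_betw_def)
  then have "?\<phi>\<^sub>1 (\<phi> i) = \<phi>\<^sub>1 i" using assms(3) by (simp add: fst_rmap_of)
  moreover obtain \<phi>' where "map_isom \<phi>' (rmap_of M\<^sub>2') (rmap_of M\<^sub>2)"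
    using assms(2,6) map_iso_sym map_iso_iff by blast
  then have "map_isom (\<phi>\<^sub>2 \<circ> \<phi>') (rmap_of M\<^sub>2') (H\<^sub>2, \<sigma>\<^sub>2, \<alpha>\<^sub>2, r\<^sub>2)" using A(3) map_isom_trans by blast
  ultimately show ?thesis unfolding glued_def using A(1,4) by metis
qed

lemma glued_decompose:
  assumes n: "n \<ge> 2" and M: "M \<in> bridgeless_maps n"
  shows "\<exists>k\<in>{1..<n}. \<exists>M\<^sub>1\<in>bridgeless_maps k. \<exists>M\<^sub>2\<in>bridgeless_maps (n - k). \<exists>i<2 * k - 1. glued M\<^sub>1 i M\<^sub>2 M"
proof -
  obtain m \<sigma> \<alpha> r where Meq: "M = (m, \<sigma>, \<alpha>, r)" by (cases M)
  have g: "good_map ({0..<m}, \<sigma>, \<alpha>, r)" and m: "m = 2 * n - 1"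
    using M bridgeless_maps_iff[of n M] n by (auto simp: Meq)
  have "card {0..<m} \<noteq> card {r}" using m n by simp
  then have "{0..<m} \<noteq> {r}" by metis
  from good_map_decompose[OF g this] obtain H\<^sub>1 H\<^sub>2 \<sigma>\<^sub>1 \<alpha>\<^sub>1 \<sigma>\<^sub>2 \<alpha>\<^sub>2 i r\<^sub>2 u where
    gl: "gluing H\<^sub>1 H\<^sub>2 \<sigma>\<^sub>1 \<alpha>\<^sub>1 \<sigma>\<^sub>2 \<alpha>\<^sub>2 r i r\<^sub>2 u"
    and eq: "({0..<m}, \<sigma>, \<alpha>, r) = glue (H\<^sub>1, \<sigma>\<^sub>1, \<alpha>\<^sub>1, r) i (H\<^sub>2, \<sigma>\<^sub>2, \<alpha>\<^sub>2, r\<^sub>2) u" by blast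
  interpret G: gluing H\<^sub>1 H\<^sub>2 \<sigma>\<^sub>1 \<alpha>\<^sub>1 \<sigma>\<^sub>2 \<alpha>\<^sub>2 r i r\<^sub>2 u by fact
  obtain M1 k \<phi> where k: "k \<ge> 1" "card H\<^sub>1 = 2 * k - 1" "M1 \<in> bridgeless_maps k"
    "map_isom \<phi> (H\<^sub>1, \<sigma>\<^sub>1, \<alpha>\<^sub>1, r) (rmap_of M1)" by (rule transport_to_cmap[OF G.good\<^sub>1])
  obtain M2 j \<psi> where j: "j \<ge> 1" "card H\<^sub>2 = 2 * j - 1" "M2 \<in> bridgeless_maps j"
    "map_isom \<psi> (H\<^sub>2, \<sigma>\<^sub>2, \<alpha>\<^sub>2, r\<^sub>2) (rmap_of M2)" by (rule transport_to_cmap[OF G.good\<^sub>2])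
  have "m = card H\<^sub>1 + card H\<^sub>2 + 1" using card_glue[OF gl] unfolding eq[symmetric] by simp
  then have nkj: "n = k + j" using m k(1,2) j(1,2) n by simp
  have fM1: "fst M1 = 2 * k - 1" using k bridgeless_maps_iff by blast
  have b: "bij_betw \<phi> H\<^sub>1 {0..<2 * k - 1}"
    using k(4) fM1 by (cases M1) (auto simp: map_isom.simps)
  then have "\<phi> i < 2 * k - 1" using G.i by (auto dest: bij_betwE)
  moreover have "glued M1 (\<phi> i) M2 M"
  proof -
    have "inv_into H\<^sub>1 \<phi> (\<phi> i) = i" using b G.i by (rule bij_betw_inv_into_left)
    moreover have "map_isom (inv_into H\<^sub>1 \<phi>) (rmap_of M1) (H\<^sub>1, \<sigma>\<^sub>1, \<alpha>\<^sub>1, r)"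
      using map_isom_sym[OF G.good\<^sub>1 k(4)] by simp
    moreover have "map_isom (inv_into H\<^sub>2 \<psi>) (rmap_of M2) (H\<^sub>2, \<sigma>\<^sub>2, \<alpha>\<^sub>2, r\<^sub>2)"
      using map_isom_sym[OF G.good\<^sub>2 j(4)] by simp
    moreover have "map_isom id (glue (H\<^sub>1, \<sigma>\<^sub>1, \<alpha>\<^sub>1, r) i (H\<^sub>2, \<sigma>\<^sub>2, \<alpha>\<^sub>2, r\<^sub>2) u) (rmap_of M)"
      unfolding eq[symmetric] Meq rmap_of.simps by (rule map_isom_refl)
    ultimately show ?thesis unfolding glued_def using gl by metis
  qed
  ultimately show ?thesis using k j nkj by (intro bexI[of _ k] bexI[of _ M1] bexI[of _ M2]) auto
qed

lemma num_bridgeless_maps_1: "num_bridgeless_maps 1 = 1"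
proof -
  have "good_map ({0}, id, id, 0::nat)" by (rule good_mapI) (auto simp: permutes_id)
  then have M: "(1, id, id, 0) \<in> bridgeless_maps 1" by (simp add: bridgeless_maps_iff)
  have "map_iso M M'" if MM': "M \<in> bridgeless_maps 1" "M' \<in> bridgeless_maps 1" for M M'
  proof -
    obtain \<sigma> \<alpha> r \<sigma>' \<alpha>' r' where eq: "M = (1, \<sigma>, \<alpha>, r)" "M' = (1, \<sigma>', \<alpha>', r')"
      using MM' by (cases M; cases M') (auto simp: bridgeless_maps_iff)
    have g: "good_map ({0}, \<sigma>, \<alpha>, r)" "good_map ({0}, \<sigma>', \<alpha>', r')"
      using that by (auto simp: bridgeless_maps_iff eq)
    have "r = 0" "\<sigma> 0 = 0" "\<alpha> 0 = 0" "r' = 0" "\<sigma>' 0 = 0" "\<alpha>' 0 = 0"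
      using good_mapD(2,3,5)[OF g(1)] good_mapD(2,3,5)[OF g(2)] by (auto simp: permutes_sing)
    then show ?thesis by (auto simp: map_iso_def eq intro!: exI[of _ id])
  qed
  then have "map_rel 1 = bridgeless_maps 1 \<times> bridgeless_maps 1" by auto
  then have "bridgeless_maps 1 // map_rel 1 = {bridgeless_maps 1}"
    using M unfolding quotient_def by auto
  then show ?thesis by (simp add: num_bridgeless_maps_def)
qed

text \<open>\<open>D\<close> consists of a size, a class, a corner of the representative of that
  class, and a second class. \<open>F\<close> is injective by \<open>glued_cancel\<close> and
  rigidity; it is surjective by \<open>glued_decompose\<close>, after moving to
  representatives.\<close>

lemma num_bridgeless_maps_rec:
  assumes n: "n \<ge> 2"
  shows "num_bridgeless_maps n =
    (\<Sum>k\<in>{1..<n}. (2 * k - 1) * num_bridgeless_maps k * num_bridgeless_maps (n - k))"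
proof -
  let ?B = bridgeless_maps
  let ?Q = "\<lambda>n. ?B n // map_rel n"
  define rep where "rep c = (SOME M. M \<in> c)" for c :: "cmap set"
  define D where "D = (SIGMA k:{1..<n}. ?Q k \<times> {0..<2 * k - 1} \<times> ?Q (n - k))"
  define F where "F = (\<lambda>(k :: nat, c\<^sub>1, i, c\<^sub>2).
    map_rel n `` {SOME M. M \<in> ?B n \<and> glued (rep c\<^sub>1) i (rep c\<^sub>2) M})"
  have rep: "rep c \<in> ?B k" "c = map_rel k `` {rep c}" if k: "k \<ge> 1" and c: "c \<in> ?Q k" for k c
  proof -
    obtain M where M: "M \<in> ?B k" "c = map_rel k `` {M}" using c by (auto elim: quotientE)
    then have "M \<in> c" using equiv_class_self[OF equiv_map_rel[OF k]] by blast
    then have "rep c \<in> c" unfolding rep_def by (rule someI)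
    then show "rep c \<in> ?B k" "c = map_rel k `` {rep c}"
      using M(2) equiv_class_eq[OF equiv_map_rel[OF k], of M "rep c"] by auto
  qed
  have class_eq: "map_rel k `` {M} = map_rel k `` {M'} \<longleftrightarrow> map_iso M M'"
    if "k \<ge> 1" "M \<in> ?B k" "M' \<in> ?B k" for k M M'
    using eq_equiv_class_iff[OF equiv_map_rel[OF that(1)] that(2,3)] that by auto
  have FD: "\<exists>M. M \<in> ?B n \<and> glued (rep c\<^sub>1) i (rep c\<^sub>2) M \<and> F (k, c\<^sub>1, i, c\<^sub>2) = map_rel n `` {M}"
    if "(k, c\<^sub>1, i, c\<^sub>2) \<in> D" for k c\<^sub>1 i c\<^sub>2
  proof -
    have k: "k \<ge> 1" "n - k \<ge> 1" "k + (n - k) = n" "c\<^sub>1 \<in> ?Q k" "c\<^sub>2 \<in> ?Q (n - k)" "i < 2 * k - 1"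
      using that by (auto simp: D_def)
    let ?M = "SOME M. M \<in> ?B n \<and> glued (rep c\<^sub>1) i (rep c\<^sub>2) M"
    have "\<exists>M. M \<in> ?B n \<and> glued (rep c\<^sub>1) i (rep c\<^sub>2) M"
      using glued_exists[OF k(1,2) rep(1)[OF k(1,4)] rep(1)[OF k(2,5)] k(6)] k(3) by auto
    then have "?M \<in> ?B n \<and> glued (rep c\<^sub>1) i (rep c\<^sub>2) ?M" by (rule someI_ex)
    then show ?thesis by (intro exI[of _ ?M]) (simp add: F_def)
  qed
  have "bij_betw F D (?Q n)"
  proof (rule bij_betw_imageI)
    show "inj_on F D"
    proof (rule inj_onI)
      fix p p' assume p: "p \<in> D" "p' \<in> D" "F p = F p'"
      obtain k c\<^sub>1 i c\<^sub>2 k' c\<^sub>1' i' c\<^sub>2' where eq: "p = (k, c\<^sub>1, i, c\<^sub>2)" "p' = (k', c\<^sub>1', i', c\<^sub>2')"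
        by (cases p; cases p')
      have k: "k \<ge> 1" "n - k \<ge> 1" "k < n" "c\<^sub>1 \<in> ?Q k" "c\<^sub>2 \<in> ?Q (n - k)" "i < 2 * k - 1"
        using p by (auto simp: D_def eq)
      have k': "k' \<ge> 1" "n - k' \<ge> 1" "k' < n" "c\<^sub>1' \<in> ?Q k'" "c\<^sub>2' \<in> ?Q (n - k')" "i' < 2 * k' - 1"
        using p by (auto simp: D_def eq)
      obtain M where M: "M \<in> ?B n" "glued (rep c\<^sub>1) i (rep c\<^sub>2) M" "F p = map_rel n `` {M}"
        using FD p(1) unfolding eq by blast
      obtain M' where M': "M' \<in> ?B n" "glued (rep c\<^sub>1') i' (rep c\<^sub>2') M'" "F p' = map_rel n `` {M'}"
        using FD p(2) unfolding eq by blast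
      have n1: "n \<ge> 1" using n by simp
      have iso: "map_iso M M'" using class_eq[OF n1 M(1) M'(1)] p(3) M(3) M'(3) by simp
      note r = rep[OF k(1,4)] rep[OF k(2,5)]
      note r' = rep[OF k'(1,4)] rep[OF k'(2,5)]
      have g: "good_map (rmap_of (rep c\<^sub>1'))" "good_map (rmap_of (rep c\<^sub>2'))" "good_map (rmap_of M')"
        "i' < fst (rep c\<^sub>1')" "fst (rep c\<^sub>1') = 2 * k' - 1" "fst (rep c\<^sub>1) = 2 * k - 1"
        using bridgeless_maps_iff[OF k'(1), of "rep c\<^sub>1'"] bridgeless_maps_iff[OF k'(2), of "rep c\<^sub>2'"]
          bridgeless_maps_iff[OF n1, of M'] bridgeless_maps_iff[OF k(1), of "rep c\<^sub>1"]
          r(1) r'(1,3) M'(1) k'(6) by auto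
      note C = glued_cancel[OF g(1-4) M(2) M'(2) iso]
      obtain \<phi> where \<phi>: "map_isom \<phi> (rmap_of (rep c\<^sub>1)) (rmap_of (rep c\<^sub>1'))" "\<phi> i = i'"
        using C(1) by blast
      have kk: "k = k'"
        using map_isom_card[OF \<phi>(1)] g(5,6) k(1) k'(1) by (simp add: fst_rmap_of)
      have iso1: "map_iso (rep c\<^sub>1) (rep c\<^sub>1')" using \<phi>(1) map_iso_iff by blast
      have c1: "c\<^sub>1 = c\<^sub>1'"
        using class_eq[OF k(1) r(1), of "rep c\<^sub>1'"] r(2) r'(1,2) iso1 kk by simp
      have c2: "c\<^sub>2 = c\<^sub>2'"
        using class_eq[OF k(2) r(3), of "rep c\<^sub>2'"] r(4) r'(3,4) C(2) kk by simp
      \<comment> \<open>By now \<open>\<phi>\<close> is an automorphism of a single representative,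
        hence trivial on its half-edges. So different corners give non-isomorphic maps.\<close>
      have "\<phi> i = i"
      proof -
        obtain m \<sigma> \<alpha> r where R: "rep c\<^sub>1' = (m, \<sigma>, \<alpha>, r)" by (cases "rep c\<^sub>1'")
        show ?thesis
          using good_map_rigid[of "{0..<m}" \<sigma> \<alpha> r \<phi> i] \<phi>(1) g(1) g(5) c1 R k(6) kk by simp
      qed
      then show "p = p'" using \<phi>(2) c1 c2 kk eq by simp
    qed
    show "F ` D = ?Q n"
    proof (intro subset_antisym subsetI)
      fix c assume "c \<in> F ` D"
      then obtain p where p: "p \<in> D" "c = F p" by blast
      obtain k c\<^sub>1 i c\<^sub>2 where eq: "p = (k, c\<^sub>1, i, c\<^sub>2)" by (cases p)
      obtain M where "M \<in> ?B n" "c = map_rel n `` {M}"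
        using FD[OF p(1)[unfolded eq]] p(2) unfolding eq by blast
      then show "c \<in> ?Q n" by (simp only: quotientI)
    next
      fix c assume "c \<in> ?Q n"
      then obtain M where M: "M \<in> ?B n" "c = map_rel n `` {M}" by (auto elim: quotientE)
      obtain k M\<^sub>1 M\<^sub>2 i where k: "k \<in> {1..<n}" and M12: "M\<^sub>1 \<in> ?B k" "M\<^sub>2 \<in> ?B (n - k)"
        and i: "i < 2 * k - 1" and G: "glued M\<^sub>1 i M\<^sub>2 M"
        using glued_decompose[OF n M(1)] by blast
      have k': "k \<ge> 1" "n - k \<ge> 1" "n \<ge> 1" using k by auto
      define c\<^sub>1 where "c\<^sub>1 = map_rel k `` {M\<^sub>1}"
      define c\<^sub>2 where "c\<^sub>2 = map_rel (n - k) `` {M\<^sub>2}"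
      have Q: "c\<^sub>1 \<in> ?Q k" "c\<^sub>2 \<in> ?Q (n - k)"
        using M12 unfolding c\<^sub>1_def c\<^sub>2_def by (simp_all only: quotientI)
      note r = rep[OF k'(1) Q(1)] rep[OF k'(2) Q(2)]
      have "map_iso M\<^sub>1 (rep c\<^sub>1)" using class_eq[OF k'(1) M12(1) r(1)] r(2) c\<^sub>1_def by simp
      then obtain \<phi> where \<phi>: "map_isom \<phi> (rmap_of M\<^sub>1) (rmap_of (rep c\<^sub>1))" using map_iso_iff by blast
      have iso2: "map_iso M\<^sub>2 (rep c\<^sub>2)" using class_eq[OF k'(2) M12(2) r(3)] r(4) c\<^sub>2_def by simp
      have g: "good_map (rmap_of M\<^sub>1)" "good_map (rmap_of M\<^sub>2)" "i < fst M\<^sub>1" "fst M\<^sub>1 = 2 * k - 1"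
        "good_map (rmap_of (rep c\<^sub>1))" "good_map (rmap_of (rep c\<^sub>2))" "fst (rep c\<^sub>1) = 2 * k - 1"
        using bridgeless_maps_iff[OF k'(1), of "rep c\<^sub>1"] bridgeless_maps_iff[OF k'(2), of "rep c\<^sub>2"]
          bridgeless_maps_iff[OF k'(1), of M\<^sub>1] bridgeless_maps_iff[OF k'(2), of M\<^sub>2]
          r(1,3) M12 i by auto
      have G': "glued (rep c\<^sub>1) (\<phi> i) (rep c\<^sub>2) M" by (rule glued_transfer[OF g(1-3) G \<phi> iso2])
      have \<phi>i: "\<phi> i < 2 * k - 1"
      proof -
        have "bij_betw \<phi> {0..<2 * k - 1} {0..<2 * k - 1}"
          using \<phi> g(4,7) by (cases M\<^sub>1; cases "rep c\<^sub>1") (simp add: map_isom.simps)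
        then show ?thesis using i by (auto dest: bij_betwE)
      qed
      then have D: "(k, c\<^sub>1, \<phi> i, c\<^sub>2) \<in> D" using k Q by (simp add: D_def)
      obtain M' where M': "M' \<in> ?B n" "glued (rep c\<^sub>1) (\<phi> i) (rep c\<^sub>2) M'"
        "F (k, c\<^sub>1, \<phi> i, c\<^sub>2) = map_rel n `` {M'}" using FD[OF D] by blast
      have "map_iso M M'"
        using glued_unique[OF g(5,6) _ G' M'(2)] \<phi>i g(7) by simp
      then have "c = F (k, c\<^sub>1, \<phi> i, c\<^sub>2)" using class_eq[OF k'(3) M(1) M'(1)] M(2) M'(3) by simp
      then show "c \<in> F ` D" using D by blast
    qed
  qed
  then have "card (?Q n) = card D" by (simp add: bij_betw_same_card)
  also have "\<dots> = (\<Sum>k\<in>{1..<n}. card (?Q k \<times> {0..<2 * k - 1} \<times> ?Q (n - k)))"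
    unfolding D_def
  proof (rule card_SigmaI)
    have "finite (?Q k)" if "k \<ge> 1" for k
      using finite_bridgeless_maps[OF that] by (rule finite_quotient) auto
    then show "\<forall>k\<in>{1..<n}. finite (?Q k \<times> {0..<2 * k - 1} \<times> ?Q (n - k))" by auto
  qed simp
  finally show ?thesis by (simp add: num_bridgeless_maps_def card_cartesian_product mult.assoc mult.left_commute)
qed

section \<open>Connected chord diagrams\<close>

definition ends :: "(nat \<times> nat) set \<Rightarrow> nat set" where
  "ends C = (\<Union>p\<in>C. {fst p, snd p})"

text \<open>The point set is arbitrary so that parts of a diagram keep their points and need no
  relabelling.\<close>

definition matching :: "nat set \<Rightarrow> (nat \<times> nat) set \<Rightarrow> bool" where
  "matching A C \<longleftrightarrow> (\<forall>p\<in>C. fst p < snd p) \<and> ends C = A \<and>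
     (\<forall>p\<in>C. \<forall>q\<in>C. p \<noteq> q \<longrightarrow> {fst p, snd p} \<inter> {fst q, snd q} = {})"

text \<open>Connectedness by cuts instead of paths, equivalent to \<open>connected_diagram\<close>.
  A part of a diagram is handled by exhibiting a crossing that leaves it.\<close>

definition conn :: "(nat \<times> nat) set \<Rightarrow> bool" where
  "conn C \<longleftrightarrow> (\<forall>D\<subseteq>C. D \<noteq> {} \<longrightarrow> D \<noteq> C \<longrightarrow> (\<exists>p\<in>D. \<exists>q\<in>C - D. crosses p q))"

definition conn_matchings :: "nat set \<Rightarrow> (nat \<times> nat) set set" where
  "conn_matchings A = {C. matching A C \<and> conn C}"

lemma crosses_sym: "crosses p q \<longleftrightarrow> crosses q p"
  by (auto simp: crosses_def)

lemma connE:
  assumes "conn C" "D \<subseteq> C" "D \<noteq> {}" "D \<noteq> C"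
  obtains p q where "p \<in> D" "q \<in> C" "q \<notin> D" "crosses p q"
  using assms unfolding conn_def by blast

lemma connected_diagram_iff_conn: "connected_diagram C \<longleftrightarrow> conn C"
proof
  let ?R = "{(p, q). p \<in> C \<and> q \<in> C \<and> crosses p q}"
  assume c: "connected_diagram C"
  show "conn C" unfolding conn_def
  proof (intro allI impI)
    fix D assume D: "D \<subseteq> C" "D \<noteq> {}" "D \<noteq> C"
    then obtain c d where cd: "c \<in> D" "d \<in> C" "d \<notin> D" by blast
    then have "(c, d) \<in> ?R\<^sup>*" using c D by (auto simp: connected_diagram_def)
    then show "\<exists>p\<in>D. \<exists>q\<in>C - D. crosses p q" using cd(1,3)
      by (induction rule: rtrancl_induct) auto
  qed
next
  let ?R = "{(p, q). p \<in> C \<and> q \<in> C \<and> crosses p q}"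
  assume c: "conn C"
  show "connected_diagram C" unfolding connected_diagram_def
  proof (intro ballI)
    fix c d assume cd: "c \<in> C" "d \<in> C"
    let ?D = "{d \<in> C. (c, d) \<in> ?R\<^sup>*}"
    have "?D = C"
    proof (rule ccontr)
      assume ne: "?D \<noteq> C"
      obtain p q where pq: "p \<in> ?D" "q \<in> C" "q \<notin> ?D" "crosses p q"
        by (rule connE[OF c _ _ ne]) (use cd in blast)+
      then have "(p, q) \<in> ?R" "(c, p) \<in> ?R\<^sup>*" by auto
      then have "(c, q) \<in> ?R\<^sup>*" by (rule rtrancl_into_rtrancl[rotated])
      then show False using pq(2,3) by blast
    qed
    then show "(c, d) \<in> ?R\<^sup>*" using cd by auto
  qed
qed

lemma matchingD:
  assumes "matching A C"
  shows "\<And>p. p \<in> C \<Longrightarrow> fst p < snd p" "\<And>p. p \<in> C \<Longrightarrow> fst p \<in> A" "\<And>p. p \<in> C \<Longrightarrow> snd p \<in> A"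
    "ends C = A"
    "\<And>p q. p \<in> C \<Longrightarrow> q \<in> C \<Longrightarrow> p \<noteq> q \<Longrightarrow> fst p \<noteq> fst q \<and> fst p \<noteq> snd q \<and> snd p \<noteq> fst q \<and> snd p \<noteq> snd q"
  using assms by (auto simp: matching_def ends_def)

lemma chord_diagram_iff_matching: "chord_diagram n C \<longleftrightarrow> matching {0..<2 * n} C"
proof
  assume c: "chord_diagram n C"
  have sub: "fst p < snd p \<and> snd p < 2 * n" if "p \<in> C" for p
    using c that by (auto simp: chord_diagram_def)
  have ex: "\<exists>!p. p \<in> C \<and> (x = fst p \<or> x = snd p)" if "x < 2 * n" for x
    using c that by (auto simp: chord_diagram_def)
  have "p = q" if "p \<in> C" "q \<in> C" "x \<in> {fst p, snd p}" "x \<in> {fst q, snd q}" for p q x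
  proof -
    have "x < 2 * n" using sub[OF that(1)] that(3) by auto
    then show ?thesis using ex[of x] that by blast
  qed
  then have "{fst p, snd p} \<inter> {fst q, snd q} = {}" if "p \<in> C" "q \<in> C" "p \<noteq> q" for p q
    using that by blast
  moreover have "ends C = {0..<2 * n}"
  proof (intro subset_antisym subsetI)
    fix x assume "x \<in> ends C"
    then show "x \<in> {0..<2 * n}" using sub by (fastforce simp: ends_def)
  next
    fix x assume "x \<in> {0..<2 * n}"
    then have "x < 2 * n" by simp
    from ex[OF this] obtain p where "p \<in> C" "x = fst p \<or> x = snd p" by blast
    then show "x \<in> ends C" unfolding ends_def by blast
  qed
  ultimately show "matching {0..<2 * n} C" using sub by (simp add: matching_def)
next
  assume m: "matching {0..<2 * n} C"
  note D = matchingD[OF m]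
  have "\<exists>!p. p \<in> C \<and> (x = fst p \<or> x = snd p)" if "x < 2 * n" for x
  proof -
    have "x \<in> ends C" using D(4) that by simp
    then obtain p where "p \<in> C" "x = fst p \<or> x = snd p" by (auto simp: ends_def)
    then show ?thesis using D(5) by metis
  qed
  moreover have "C \<subseteq> {(a, b). a < b \<and> b < 2 * n}" using D(1,3) by fastforce
  ultimately show "chord_diagram n C" unfolding chord_diagram_def by blast
qed

lemma connected_chord_diagrams_eq: "connected_chord_diagrams n = conn_matchings {0..<2 * n}"
  by (simp add: connected_chord_diagrams_def conn_matchings_def connected_diagram_iff_conn
      chord_diagram_iff_matching)

lemma matching_subset:
  assumes "matching A C" "D \<subseteq> C"
  shows "matching (ends D) D"
  using assms unfolding matching_def by blast

lemma ends_Diff: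
  assumes "matching A C" "D \<subseteq> C"
  shows "ends (C - D) = A - ends D"
proof -
  have "ends C = A" "\<And>p q. p \<in> C \<Longrightarrow> q \<in> C \<Longrightarrow> p \<noteq> q \<Longrightarrow> {fst p, snd p} \<inter> {fst q, snd q} = {}"
    using assms by (auto simp: matching_def)
  then show ?thesis using assms(2) unfolding ends_def by blast
qed

lemma matching_Un:
  assumes "matching A C" "matching B D" "A \<inter> B = {}"
  shows "matching (A \<union> B) (C \<union> D)"
proof -
  have E: "ends (C \<union> D) = ends C \<union> ends D" by (auto simp: ends_def)
  have cd: "{fst p, snd p} \<inter> {fst q, snd q} = {}" if "p \<in> C" "q \<in> D" for p q
    using matchingD(2,3)[OF assms(1) that(1)] matchingD(2,3)[OF assms(2) that(2)] assms(3) by auto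
  have "{fst p, snd p} \<inter> {fst q, snd q} = {}" if pq: "p \<in> C \<union> D" "q \<in> C \<union> D" "p \<noteq> q" for p q
  proof -
    consider "p \<in> C" "q \<in> C" | "p \<in> C" "q \<in> D" | "p \<in> D" "q \<in> C" | "p \<in> D" "q \<in> D" using pq by blast
    then show ?thesis
    proof cases
      case 1 then show ?thesis using assms(1) pq(3) unfolding matching_def by blast
    next
      case 2 then show ?thesis by (rule cd)
    next
      case 3 then show ?thesis using cd[of q p] by (simp add: Int_commute)
    next
      case 4 then show ?thesis using assms(2) pq(3) unfolding matching_def by blast
    qed
  qed
  moreover have "\<forall>p\<in>C \<union> D. fst p < snd p" using matchingD(1)[OF assms(1)] matchingD(1)[OF assms(2)] by blast
  ultimately show ?thesis using matchingD(4)[OF assms(1)] matchingD(4)[OF assms(2)] E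
    by (simp add: matching_def)
qed

lemma matching_finite:
  assumes "matching A C" "finite A"
  shows "finite C"
proof (rule finite_subset)
  show "C \<subseteq> A \<times> A" using matchingD(2,3)[OF assms(1)] by (auto simp: mem_Times_iff)
qed (use assms in auto)

lemma matching_card:
  assumes "matching A C" "finite A"
  shows "card A = 2 * card C"
proof -
  note D = matchingD[OF assms(1)]
  have "card (ends C) = (\<Sum>p\<in>C. card {fst p, snd p})" unfolding ends_def
    by (rule card_UN_disjoint) (use matching_finite[OF assms] assms(1) in \<open>auto simp: matching_def\<close>)
  also have "\<dots> = (\<Sum>p\<in>C. 2)"
  proof (rule sum.cong)
    show "card {fst p, snd p} = 2" if "p \<in> C" for p using D(1)[OF that] by auto
  qed simp
  finally show ?thesis using D(4) by simp
qed

lemma finite_conn_matchings: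
  assumes "finite A"
  shows "finite (conn_matchings A)"
proof (rule finite_subset)
  show "conn_matchings A \<subseteq> Pow (A \<times> A)"
    using matchingD(2,3) by (fastforce simp: conn_matchings_def mem_Times_iff)
qed (use assms in auto)

text \<open>A strictly monotone relabelling preserves and reflects crossings, so it acts injectively
  on connected matchings. Applied to the increasing enumeration of \<open>A\<close> and to its
  inverse, it gives the two inequalities of \<open>card_conn_matchings\<close>.\<close>

lemma card_conn_matchings_le:
  assumes "finite A" and f: "strict_mono_on A f"
  shows "card (conn_matchings A) \<le> card (conn_matchings (f ` A))"
proof (rule card_inj_on_le)
  let ?F = "\<lambda>C. map_prod f f ` C"
  have inj: "inj_on f A" using f by (rule strict_mono_on_imp_inj_on)
  have less: "f a < f b \<longleftrightarrow> a < b" if "a \<in> A" "b \<in> A" for a b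
    using strict_mono_on_less[OF f] that by blast
  show "inj_on ?F (conn_matchings A)"
  proof (rule inj_on_subset)
    show "inj_on ?F (Pow (A \<times> A))"
      by (rule inj_on_image_Pow) (use inj in \<open>auto simp: inj_on_def\<close>)
    show "conn_matchings A \<subseteq> Pow (A \<times> A)"
      using matchingD(2,3) by (fastforce simp: conn_matchings_def mem_Times_iff)
  qed
  show "?F ` conn_matchings A \<subseteq> conn_matchings (f ` A)"
  proof
    fix C' assume "C' \<in> ?F ` conn_matchings A"
    then obtain C where C: "matching A C" "conn C" "C' = ?F C" by (auto simp: conn_matchings_def)
    note D = matchingD[OF C(1)]
    have cr: "crosses (map_prod f f p) (map_prod f f q) \<longleftrightarrow> crosses p q" if "p \<in> C" "q \<in> C" for p q
      using that D(2,3) less by (simp add: crosses_def)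
    have "ends C' = f ` ends C" unfolding ends_def C(3) by auto
    moreover have "\<forall>p\<in>C'. fst p < snd p" using D(1-3) less C(3) by auto
    moreover have "{fst p', snd p'} \<inter> {fst q', snd q'} = {}"
      if p': "p' \<in> C'" "q' \<in> C'" "p' \<noteq> q'" for p' q'
    proof -
      from p'(1)[unfolded C(3)] obtain p where p: "p' = map_prod f f p" "p \<in> C" by (rule imageE)
      from p'(2)[unfolded C(3)] obtain q where q: "q' = map_prod f f q" "q \<in> C" by (rule imageE)
      have "p \<noteq> q" using p'(3) p(1) q(1) by blast
      then have "{fst p, snd p} \<inter> {fst q, snd q} = {}" using D(5)[OF p(2) q(2)] by auto
      moreover have "{fst p, snd p} \<subseteq> A" "{fst q, snd q} \<subseteq> A" using D(2,3) p(2) q(2) by auto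
      ultimately have "f ` {fst p, snd p} \<inter> f ` {fst q, snd q} = {}"
        using inj_on_image_Int[OF inj, of "{fst p, snd p}" "{fst q, snd q}"] by simp
      then show ?thesis using p(1) q(1) by simp
    qed
    ultimately have "matching (f ` A) C'" using D(4) by (simp add: matching_def)
    moreover have "conn C'" unfolding conn_def
    proof (intro allI impI)
      fix D' assume D': "D' \<subseteq> C'" "D' \<noteq> {}" "D' \<noteq> C'"
      let ?D = "{p \<in> C. map_prod f f p \<in> D'}"
      have "?D \<noteq> {}" using D'(1,2) C(3) by auto
      moreover have "?D \<noteq> C"
      proof
        assume "?D = C"
        then have "\<forall>p\<in>C. map_prod f f p \<in> D'" by blast
        then have "C' \<subseteq> D'" unfolding C(3) by (simp add: image_subset_iff)
        then show False using D'(1,3) by blast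
      qed
      ultimately obtain p q where pq: "p \<in> ?D" "q \<in> C" "q \<notin> ?D" "crosses p q"
        by (rule connE[OF C(2), rotated]) auto
      then show "\<exists>p\<in>D'. \<exists>q\<in>C' - D'. crosses p q"
        using cr[of p q] C(3) by (intro bexI[of _ "map_prod f f p"] bexI[of _ "map_prod f f q"]) auto
    qed
    ultimately show "C' \<in> conn_matchings (f ` A)" by (simp add: conn_matchings_def)
  qed
qed (use assms in \<open>auto intro: finite_conn_matchings\<close>)

lemma card_conn_matchings:
  assumes "finite A" "card A = 2 * k"
  shows "card (conn_matchings A) = card (connected_chord_diagrams k)"
proof -
  obtain h where h: "bij_betw h {0..<card A} A" "strict_mono_on {0..<card A} h"
    using ex_bij_betw_strict_mono_card[OF assms(1)] unfolding atLeast0LessThan by blast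
  let ?g = "inv_into {0..<card A} h"
  have g: "strict_mono_on A ?g"
  proof (rule strict_mono_onI)
    fix a b assume ab: "a \<in> A" "b \<in> A" "a < b"
    have "h (?g a) = a" "h (?g b) = b" "?g a \<in> {0..<card A}" "?g b \<in> {0..<card A}"
      using ab h(1) bij_betw_inv_into_right[OF h(1)] bij_betw_apply[OF bij_betw_inv_into[OF h(1)]] by auto
    then show "?g a < ?g b" using strict_mono_on_less[OF h(2)] ab(3) by metis
  qed
  have "card (conn_matchings {0..<card A}) \<le> card (conn_matchings A)"
    using card_conn_matchings_le[OF _ h(2)] bij_betw_imp_surj_on[OF h(1)] by simp
  moreover have "card (conn_matchings A) \<le> card (conn_matchings {0..<card A})"
    using card_conn_matchings_le[OF assms(1) g] bij_betw_imp_surj_on[OF bij_betw_inv_into[OF h(1)]] by simp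
  ultimately show ?thesis using assms(2) by (simp add: connected_chord_diagrams_eq)
qed

text \<open>Nesting: a diagram with \<open>n - k\<close> chords, except for its first point 0, sits in the gap after the
  \<open>i\<close>-th point of a diagram with \<open>k\<close> chords.\<close>

definition outer_points :: "nat \<Rightarrow> nat \<Rightarrow> nat \<Rightarrow> nat set" where
  "outer_points n k i = {1..i} \<union> {i + 2 * (n - k)..<2 * n}"

definition inner_points :: "nat \<Rightarrow> nat \<Rightarrow> nat \<Rightarrow> nat set" where
  "inner_points n k i = insert 0 {i + 1..<i + 2 * (n - k)}"

text \<open>The block in the gap has only \<open>2(n-k)-1\<close> points, \<open>i+1\<close> up to
  \<open>i+2(n-k)-1\<close>, because one point of the inner diagram is 0. The bounds on
  \<open>i\<close> say that outer points stand on both sides of the block.\<close>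

lemma points_partition:
  assumes "k \<in> {1..<n}" "i \<in> {1..2 * k - 1}"
  shows "outer_points n k i \<inter> inner_points n k i = {}"
    and "outer_points n k i \<union> inner_points n k i = {0..<2 * n}"
    and "finite (outer_points n k i)" "finite (inner_points n k i)"
    and "card (outer_points n k i) = 2 * k" "card (inner_points n k i) = 2 * (n - k)"
proof -
  show "outer_points n k i \<inter> inner_points n k i = {}" "outer_points n k i \<union> inner_points n k i = {0..<2 * n}"
    "finite (outer_points n k i)" "finite (inner_points n k i)"
    using assms by (auto simp: outer_points_def inner_points_def)
  have "card (outer_points n k i) = card {1..i} + card {i + 2 * (n - k)..<2 * n}"
    unfolding outer_points_def by (rule card_Un_disjoint) (use assms in auto)
  then show "card (outer_points n k i) = 2 * k" using assms by auto
  show "card (inner_points n k i) = 2 * (n - k)" using assms by (auto simp: inner_points_def)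
qed

section \<open>Nesting one connected diagram into a gap of another\<close>

locale nesting =
  fixes n k i :: nat and X R :: "(nat \<times> nat) set"
  assumes k: "k \<in> {1..<n}" and i: "i \<in> {1..2 * k - 1}"
    and X: "X \<in> conn_matchings (outer_points n k i)" and R: "R \<in> conn_matchings (inner_points n k i)"
begin

lemmas mX = X[unfolded conn_matchings_def, THEN CollectD, THEN conjunct1]
lemmas cX = X[unfolded conn_matchings_def, THEN CollectD, THEN conjunct2]
lemmas mR = R[unfolded conn_matchings_def, THEN CollectD, THEN conjunct1]
lemmas cR = R[unfolded conn_matchings_def, THEN CollectD, THEN conjunct2]
lemmas DX = matchingD[OF mX]
lemmas DR = matchingD[OF mR]
lemmas pp = points_partition[OF k i]

text \<open>A chord of \<open>R\<close> that does not start at 0 has both ends in one gap of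
  \<open>X\<close>.\<close>

lemma not_crosses:
  assumes "p \<in> X" "q \<in> R" "fst q \<noteq> 0"
  shows "\<not> crosses p q"
  using DX(1-3)[OF assms(1)] DR(1-3)[OF assms(2)] assms(3)
  by (auto simp: crosses_def outer_points_def inner_points_def)

lemma point_1: "\<exists>p\<in>X. fst p = 1"
proof -
  have "1 \<in> ends X" using DX(4) i by (auto simp: outer_points_def)
  then obtain p where p: "p \<in> X" "fst p = 1 \<or> snd p = 1" by (auto simp: ends_def)
  then have "fst p = 1" using DX(1,2)[OF p(1)] k i by (auto simp: outer_points_def)
  then show ?thesis using p by blast
qed

lemma point_0: "\<exists>q\<in>R. fst q = 0 \<and> i < snd q \<and> snd q < i + 2 * (n - k)"
proof -
  have "0 \<in> ends R" using DR(4) by (auto simp: inner_points_def)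
  then obtain q where q: "q \<in> R" "fst q = 0 \<or> snd q = 0" by (auto simp: ends_def)
  then show ?thesis using DR(1,3)[OF q(1)] by (intro bexI[OF _ q(1)]) (auto simp: inner_points_def)
qed

text \<open>If no chord of \<open>X\<close> spanned the gap, \<open>X\<close> would fall apart into
  a left and a right part, both nonempty. A spanning chord crosses the chord at 0, which ends inside
  the gap.\<close>

lemma crosses_exists: "\<exists>p\<in>X. \<exists>q\<in>R. crosses p q"
proof -
  have "\<exists>p\<in>X. fst p \<le> i \<and> i + 2 * (n - k) \<le> snd p"
  proof (rule ccontr)
    assume "\<not> ?thesis"
    then have ns: "\<not> (fst p \<le> i \<and> i + 2 * (n - k) \<le> snd p)" if "p \<in> X" for p using that by blast
    have dich: "snd p \<le> i \<or> i + 2 * (n - k) \<le> fst p" if "p \<in> X" for p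
      using ns[OF that] DX(2,3)[OF that] by (auto simp: outer_points_def)
    let ?D = "{p \<in> X. snd p \<le> i}"
    obtain p where p: "p \<in> X" "fst p = 1" using point_1 by blast
    then have "snd p \<le> i" using dich[of p] i k by auto
    then have ne: "?D \<noteq> {}" using p by blast
    have "i + 2 * (n - k) \<in> ends X" using DX(4) i k by (auto simp: outer_points_def)
    then obtain q where q: "q \<in> X" "fst q = i + 2 * (n - k) \<or> snd q = i + 2 * (n - k)" by (auto simp: ends_def)
    then have "\<not> snd q \<le> i" using DX(1)[OF q(1)] k by auto
    then have nX: "?D \<noteq> X" using q by blast
    obtain p q where pq: "p \<in> ?D" "q \<in> X" "q \<notin> ?D" "crosses p q"
      by (rule connE[OF cX _ ne nX]) blast+
    then have "snd p \<le> i" "i + 2 * (n - k) \<le> fst q" "fst p < snd p" "fst q < snd q"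
      using dich[of q] DX(1) by auto
    then show False using pq(4) by (auto simp: crosses_def)
  qed
  then obtain p where p: "p \<in> X" "fst p \<le> i" "i + 2 * (n - k) \<le> snd p" by blast
  obtain q where q: "q \<in> R" "fst q = 0" "i < snd q" "snd q < i + 2 * (n - k)" using point_0 by blast
  have "fst p > 0" using DX(2)[OF p(1)] k i by (auto simp: outer_points_def)
  then have "crosses p q" using p q by (auto simp: crosses_def)
  then show ?thesis using p q by blast
qed

lemma union_conn_matching: "X \<union> R \<in> conn_matchings {0..<2 * n}"
proof -
  have "matching {0..<2 * n} (X \<union> R)" using matching_Un[OF mX mR pp(1)] unfolding pp(2) .
  moreover have "conn (X \<union> R)" unfolding conn_def
  proof (intro allI impI, rule ccontr)
    fix D assume D: "D \<subseteq> X \<union> R" "D \<noteq> {}" "D \<noteq> X \<union> R" and "\<not> (\<exists>p\<in>D. \<exists>q\<in>X \<union> R - D. crosses p q)"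
    then have no: "\<not> crosses p q" if "p \<in> D" "q \<in> X \<union> R" "q \<notin> D" for p q using that by blast
    have DX: "D \<inter> X = {} \<or> D \<inter> X = X"
    proof (rule ccontr)
      assume n: "\<not> ?thesis"
      obtain p q where "p \<in> D \<inter> X" "q \<in> X" "q \<notin> D \<inter> X" "crosses p q"
        by (rule connE[OF cX, of "D \<inter> X"]) (use n in blast)+
      then show False using no[of p q] by blast
    qed
    have DR: "D \<inter> R = {} \<or> D \<inter> R = R"
    proof (rule ccontr)
      assume n: "\<not> ?thesis"
      obtain p q where "p \<in> D \<inter> R" "q \<in> R" "q \<notin> D \<inter> R" "crosses p q"
        by (rule connE[OF cR, of "D \<inter> R"]) (use n in blast)+
      then show False using no[of p q] by blast
    qed
    obtain p q where pq: "p \<in> X" "q \<in> R" "crosses p q" using crosses_exists by blast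
    then have "p \<in> D \<longleftrightarrow> q \<in> D" using no[of p q] no[of q p] crosses_sym by blast
    then have "X \<subseteq> D \<and> R \<subseteq> D \<or> D \<inter> X = {} \<and> D \<inter> R = {}" using pq DX DR by blast
    then show False using D by blast
  qed
  ultimately show ?thesis by (simp add: conn_matchings_def)
qed

lemma disjoint: "X \<inter> R = {}"
  using DX(2) DR(2) pp(1) by blast

end

text \<open>Both \<open>X\<close> and \<open>X'\<close> contain the chord at 1. Being connected,
  \<open>X\<close> can leave \<open>X'\<close> only by a crossing with a chord of \<open>R'\<close>,
  and by \<open>not_crosses\<close> this is the chord at 0, which does not belong to
  \<open>X\<close>.\<close>

lemma nesting_subset:
  assumes "nesting n k i X R" "nesting n k' i' X' R'" "X \<union> R = X' \<union> R'"
  shows "X \<subseteq> X'"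
proof -
  interpret A: nesting n k i X R by fact
  interpret B: nesting n k' i' X' R' by fact
  have m: "matching {0..<2 * n} (X \<union> R)" using A.union_conn_matching by (simp add: conn_matchings_def)
  obtain p where p: "p \<in> X" "fst p = 1" using A.point_1 by blast
  obtain p' where p': "p' \<in> X'" "fst p' = 1" using B.point_1 by blast
  have "p = p'" using matchingD(5)[OF m, of p p'] p p' assms(3) by auto
  then have ne: "X \<inter> X' \<noteq> {}" using p p' by blast
  show ?thesis
  proof (rule ccontr)
    assume n: "\<not> X \<subseteq> X'"
    obtain p q where pq: "p \<in> X \<inter> X'" "q \<in> X" "q \<notin> X \<inter> X'" "crosses p q"
      by (rule connE[OF A.cX _ ne]) (use n in blast)+
    then have "q \<in> R'" using assms(3) by blast
    then have "fst q = 0" using B.not_crosses[of p q] pq by blast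
    then show False using A.DX(2)[OF pq(2)] A.k A.i by (auto simp: outer_points_def)
  qed
qed

lemma nesting_unique:
  assumes "nesting n k i X R" "nesting n k' i' X' R'" "X \<union> R = X' \<union> R'"
  shows "k = k' \<and> i = i' \<and> X = X' \<and> R = R'"
proof -
  interpret A: nesting n k i X R by fact
  interpret B: nesting n k' i' X' R' by fact
  have X: "X = X'" using nesting_subset[OF assms] nesting_subset[OF assms(2,1) assms(3)[symmetric]] by blast
  have R: "R = R'" using X A.disjoint B.disjoint assms(3) by blast
  have kk: "k = k'"
    using matching_card[OF A.mX A.pp(3)] matching_card[OF B.mX B.pp(3)] A.pp(5) B.pp(5) X by simp
  \<comment> \<open>The least nonzero inner point is \<open>i + 1\<close>, so the set determines
    \<open>i\<close>.\<close>
  have "inner_points n k i = inner_points n k i'" using A.DR(4) B.DR(4) R kk by simp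
  moreover have "n - k \<ge> 1" using A.k by auto
  then have "i + 1 \<in> inner_points n k i" "i' + 1 \<in> inner_points n k i'" by (auto simp: inner_points_def)
  ultimately have "i + 1 \<in> inner_points n k i'" "i' + 1 \<in> inner_points n k i" by auto
  then have "i = i'" by (auto simp: inner_points_def)
  then show ?thesis using X R kk by blast
qed

text \<open>\<open>X\<close> is the component of the chord at 1 once the root chord
  \<open>q0\<close> is removed, and \<open>R\<close> is everything else. The heart is that the
  nonzero points of \<open>R\<close> form one block: chords of \<open>R\<close> other than
  \<open>q0\<close> surround no point of \<open>X\<close> (\<open>outside\<close>), and no point of
  \<open>X\<close> separates two nonzero points of \<open>R\<close>
  (\<open>between\<close>).\<close>

lemma nesting_exists:
  assumes n: "n \<ge> 2" and C: "C \<in> conn_matchings {0..<2 * n}"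
  shows "\<exists>k i X R. nesting n k i X R \<and> C = X \<union> R"
proof -
  have m: "matching {0..<2 * n} C" and c: "conn C" using C by (auto simp: conn_matchings_def)
  note D = matchingD[OF m]
  have finC: "finite C" using m by (rule matching_finite) simp
  have cardC: "card C = n" using matching_card[OF m] by simp
  have "0 \<in> ends C" "1 \<in> ends C" using D(4) n by auto
  then obtain q0 x1 where q0: "q0 \<in> C" "fst q0 = 0 \<or> snd q0 = 0" and x1: "x1 \<in> C" "fst x1 = 1 \<or> snd x1 = 1"
    by (fastforce simp: ends_def)
  have q00: "fst q0 = 0" using q0 D(1)[OF q0(1)] by auto
  define t where "t = snd q0"
  \<comment> \<open>A root chord from 0 to 1 would cross nothing.\<close>
  have "t \<noteq> 1"
  proof
    assume "t = 1"
    have "{q0} \<noteq> C" using cardC n by auto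
    then obtain q where "crosses q0 q" "q \<in> C" using connE[OF c, of "{q0}"] q0(1) by blast
    then show False using q00 \<open>t = 1\<close> by (auto simp: crosses_def t_def)
  qed
  have x1q0: "x1 \<noteq> q0" using x1 q00 \<open>t \<noteq> 1\<close> by (auto simp: t_def)
  have x11: "fst x1 = 1"
    using x1 D(1)[OF x1(1)] D(5)[OF x1(1) q0(1) x1q0] q00 by auto
  \<comment> \<open>The component is obtained as the least set of chords containing
    \<open>x1\<close> and closed under crossings that ignore \<open>q0\<close>.\<close>
  define fam where "fam = {Y. Y \<subseteq> C - {q0} \<and> x1 \<in> Y \<and> (\<forall>p\<in>Y. \<forall>q\<in>C - {q0}. crosses p q \<longrightarrow> q \<in> Y)}"
  define X where "X = \<Inter> fam"
  define R where "R = C - X"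
  have fam0: "C - {q0} \<in> fam" using x1 x1q0 by (auto simp: fam_def)
  have XC: "X \<subseteq> C - {q0}" using fam0 unfolding X_def by blast
  have x1X: "x1 \<in> X" unfolding X_def fam_def by blast
  have cl: "q \<in> X" if "p \<in> X" "q \<in> C" "q \<noteq> q0" "crosses p q" for p q
    using that unfolding X_def fam_def by blast
  have least: "X \<subseteq> Y" if "Y \<in> fam" for Y using that unfolding X_def by blast
  have CXR: "C = X \<union> R" "X \<inter> R = {}" using XC by (auto simp: R_def)
  have q0R: "q0 \<in> R" using q0 XC by (auto simp: R_def)
  have RX: "\<not> crosses p q" if "p \<in> X" "q \<in> R" "q \<noteq> q0" for p q
    using cl[of p q] that by (auto simp: R_def)
  have cX: "conn X" unfolding conn_def
  proof (intro allI impI, rule ccontr)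
    fix E assume E: "E \<subseteq> X" "E \<noteq> {}" "E \<noteq> X" and "\<not> (\<exists>p\<in>E. \<exists>q\<in>X - E. crosses p q)"
    then have no: "\<not> crosses p q" if "p \<in> E" "q \<in> X - E" for p q using that by blast
    have no': "\<not> crosses q p" if "p \<in> E" "q \<in> X - E" for p q using no[OF that] crosses_sym by blast
    show False
    proof (cases "x1 \<in> E")
      case True
      have "q \<in> E" if "p \<in> E" "q \<in> C - {q0}" "crosses p q" for p q
        using cl[of p q] no[of p q] that E(1) by blast
      then have "E \<in> fam" using True E(1) XC unfolding fam_def by blast
      then show False using least E by blast
    next
      case False
      have "q \<in> X - E" if "p \<in> X - E" "q \<in> C - {q0}" "crosses p q" for p q
        using cl[of p q] no'[of q p] that by blast
      then have "X - E \<in> fam" using False x1X XC unfolding fam_def by blast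
      then show False using least E by blast
    qed
  qed
  \<comment> \<open>Outside \<open>X\<close>, the chords of \<open>X\<close> cross at most
    \<open>q0\<close>. So a part of \<open>R\<close> without \<open>q0\<close> must be tied to the
    rest of the connected diagram within \<open>R\<close>.\<close>
  have cR0: False if F: "F \<subseteq> R" "F \<noteq> {}" "q0 \<notin> F" and no: "\<And>p q. p \<in> F \<Longrightarrow> q \<in> R - F \<Longrightarrow> \<not> crosses p q" for F
  proof -
    have FC: "F \<subseteq> C" "F \<noteq> C" using F q0 by (auto simp: R_def)
    obtain p q where pq: "p \<in> F" "q \<in> C" "q \<notin> F" "crosses p q"
      by (rule connE[OF c FC(1) F(2) FC(2)])
    then have "q \<in> X" using no[of p q] CXR by blast
    then show False using RX[of q p] pq F crosses_sym by blast
  qed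
  have cR: "conn R" unfolding conn_def
  proof (intro allI impI, rule ccontr)
    fix E assume E: "E \<subseteq> R" "E \<noteq> {}" "E \<noteq> R" and "\<not> (\<exists>p\<in>E. \<exists>q\<in>R - E. crosses p q)"
    then have no: "\<not> crosses p q" if "p \<in> E" "q \<in> R - E" for p q using that by blast
    have no': "\<not> crosses q p" if "p \<in> E" "q \<in> R - E" for p q using no[OF that] crosses_sym by blast
    show False
    proof (cases "q0 \<in> E")
      case True
      show False by (rule cR0[of "R - E"]) (use True E no' in blast)+
    next
      case False
      show False by (rule cR0[of E]) (use False E no in blast)+
    qed
  qed
  have mX: "matching (ends X) X" and mR: "matching (ends R) R"
    using matching_subset[OF m] XC unfolding R_def by blast+
  have eR: "ends R = {0..<2 * n} - ends X" using ends_Diff[OF m, of X] XC unfolding R_def by blast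
  have eX: "ends X \<subseteq> {0..<2 * n}" using D(2,3) XC unfolding ends_def by blast
  have t: "t \<in> ends R" "t > 0" using q0R D(1)[OF q0(1)] by (auto simp: ends_def t_def)
  have one: "1 \<in> ends X" using x1X x11 by (force simp: ends_def)
  have zero: "0 \<in> ends R" using q0R q00 by (force simp: ends_def)
  have dist: "z \<noteq> fst q \<and> z \<noteq> snd q" if "z \<in> ends X" "q \<in> R" for z q
    using that eR by (auto simp: ends_def)
  have fstq: "fst q > 1" if "q \<in> R" "q \<noteq> q0" for q
  proof -
    have "fst q \<noteq> 0" using D(5)[of q q0] that q0 q00 by (auto simp: R_def)
    moreover have "fst q \<noteq> 1" using dist[OF one that(1)] by simp
    ultimately show ?thesis by simp
  qed
  \<comment> \<open>If \<open>q\<close> surrounded a point of \<open>X\<close>, the chord at that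
    point, not crossing \<open>q\<close>, would lie inside \<open>q\<close>. The same holds for
    every chord of \<open>X\<close> crossing it, hence for all of \<open>X\<close>; but
    \<open>x1\<close> starts at 1, before \<open>q\<close>.\<close>
  have outside: "snd q < z \<or> z < fst q" if z: "z \<in> ends X" and q: "q \<in> R" "q \<noteq> q0" for z q
  proof (rule ccontr)
    assume "\<not> ?thesis"
    then have zq: "fst q < z" "z < snd q" using dist[OF z q(1)] by auto
    have inside: "fst q < fst p \<and> snd p < snd q"
      if p: "p \<in> X" and w: "w = fst p \<or> w = snd p" "fst q < w" "w < snd q" for p w
    proof -
      have "fst p \<in> ends X" "snd p \<in> ends X" using p by (auto simp: ends_def)
      then have "fst p \<noteq> fst q" "fst p \<noteq> snd q" "snd p \<noteq> fst q" "snd p \<noteq> snd q"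
        using dist[OF _ q(1)] by metis+
      then show ?thesis
        using RX[OF p q] w matchingD(1)[OF mX p] by (auto simp: crosses_def)
    qed
    let ?E = "{p \<in> X. fst q < fst p \<and> snd p < snd q}"
    obtain p where p: "p \<in> X" "z = fst p \<or> z = snd p" using z by (auto simp: ends_def)
    then have "p \<in> ?E" using inside[OF p zq] by blast
    then have E: "?E \<noteq> {}" by blast
    have "x1 \<notin> ?E" using x11 fstq[OF q] by auto
    then have E': "?E \<noteq> X" using x1X by blast
    obtain p p' where pp: "p \<in> ?E" "p' \<in> X" "p' \<notin> ?E" "crosses p p'"
      by (rule connE[OF cX _ E E']) blast+
    have "fst q < fst p' \<and> snd p' < snd q"
      using pp(1,4) inside[OF pp(2), of "fst p'"] inside[OF pp(2), of "snd p'"] by (auto simp: crosses_def)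
    then show False using pp(2,3) by blast
  qed
  \<comment> \<open>The chords of \<open>R\<close> on the side of \<open>z\<close> away from
    \<open>t\<close>, the end of the root chord, cross no other chord of \<open>R\<close>: by
    \<open>outside\<close> the others except \<open>q0\<close> stay on the far side of
    \<open>z\<close>, and \<open>q0\<close> ends before \<open>z\<close> or surrounds them. This
    contradicts \<open>cR0\<close>.\<close>
  have between: False if z: "z \<in> ends X" and a: "a \<in> ends R" "a \<noteq> 0" "a < z" and b: "b \<in> ends R" "z < b" for z a b
  proof -
    have "z \<noteq> t" using t(1) z eR by blast
    then consider "t < z" | "z < t" by linarith
    then show False
    proof cases
      case 1
      obtain q where q: "q \<in> R" "b = fst q \<or> b = snd q" using b(1) by (auto simp: ends_def)
      have "q \<noteq> q0" using q(2) b(2) 1 q00 by (auto simp: t_def)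
      then have "z < fst q" using outside[OF z q(1)] q(2) b(2) matchingD(1)[OF mR q(1)] by auto
      show False
      proof (rule cR0[of "{q \<in> R. q \<noteq> q0 \<and> z < fst q}"])
        show "\<not> crosses p q" if "p \<in> {q \<in> R. q \<noteq> q0 \<and> z < fst q}" "q \<in> R - {q \<in> R. q \<noteq> q0 \<and> z < fst q}" for p q
        proof -
          have "snd q < z" using that(2) outside[OF z, of q] 1 by (auto simp: t_def)
          then show ?thesis using that(1) matchingD(1)[OF mR] that(2) by (auto simp: crosses_def)
        qed
      qed (use q(1) \<open>q \<noteq> q0\<close> \<open>z < fst q\<close> in blast)+
    next
      case 2
      obtain q where q: "q \<in> R" "a = fst q \<or> a = snd q" using a(1) by (auto simp: ends_def)
      have "q \<noteq> q0" using q(2) a(2,3) 2 q00 by (auto simp: t_def)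
      then have "snd q < z" using outside[OF z q(1)] q(2) a(3) matchingD(1)[OF mR q(1)] by auto
      show False
      proof (rule cR0[of "{q \<in> R. q \<noteq> q0 \<and> snd q < z}"])
        show "\<not> crosses p q" if "p \<in> {q \<in> R. q \<noteq> q0 \<and> snd q < z}" "q \<in> R - {q \<in> R. q \<noteq> q0 \<and> snd q < z}" for p q
        proof (cases "q = q0")
          case True
          then show ?thesis using that(1) matchingD(1)[OF mR, of p] q00 2 by (auto simp: crosses_def t_def)
        next
          case False
          then have "z < fst q" using that(2) outside[OF z, of q] by auto
          then show ?thesis using that(1) matchingD(1)[OF mR, of p] matchingD(1)[OF mR, of q] that(2)
            by (auto simp: crosses_def)
        qed
      qed (use q(1) \<open>q \<noteq> q0\<close> \<open>snd q < z\<close> in blast)+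
    qed
  qed
  have "X \<noteq> {}" "X \<noteq> C" "X \<subseteq> C" using x1X XC q0 by auto
  \<comment> \<open>\<open>X\<close> is connected to the rest only by crossing \<open>q0\<close>.
    The chord \<open>p\<close> that does so ends at a point \<open>b\<close> beyond
    \<open>t\<close>, which shows that points of \<open>X\<close> follow the block.\<close>
  then obtain p q where pq: "p \<in> X" "q \<in> C" "q \<notin> X" "crosses p q" by (metis connE[OF c])
  then have "q = q0" using cl by blast
  define b where "b = snd p"
  have b: "b \<in> ends X" "t < b"
    using pq q00 \<open>q = q0\<close> by (auto simp: crosses_def t_def b_def ends_def)
  define P where "P = ends R - {0}"
  have finP: "finite P" "P \<noteq> {}" using t eR by (auto simp: P_def)
  define l where "l = Min P"
  define h where "h = Max P"
  have lP: "l \<in> P" "h \<in> P" using finP by (auto simp: l_def h_def)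
  have Plh: "P = {l..h}"
  proof (intro subset_antisym subsetI)
    fix z assume "z \<in> P"
    then show "z \<in> {l..h}" using finP by (auto simp: l_def h_def)
  next
    fix z assume z: "z \<in> {l..h}"
    show "z \<in> P"
    proof (rule ccontr)
      assume "z \<notin> P"
      moreover have "z \<noteq> 0" "z < 2 * n" using z lP eR by (auto simp: P_def)
      ultimately have "z \<in> ends X" using eR by (auto simp: P_def)
      moreover have "l < z" "z < h" using z \<open>z \<notin> P\<close> lP by (metis atLeastAtMost_iff order_le_less)+
      ultimately show False using between[of z l h] lP by (auto simp: P_def)
    qed
  qed
  have hb: "h < b"
  proof (rule ccontr)
    assume "\<not> h < b"
    moreover have "h \<noteq> b" using b(1) lP eR by (auto simp: P_def)
    ultimately have "b < h" by simp
    then show False using between[OF b(1) t(1) _ b(2), of h] t(2) lP by (auto simp: P_def)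
  qed
  have bn: "b < 2 * n" using b(1) eX by auto
  have l2: "l \<ge> 2" using lP one eR by (cases "l = 1") (auto simp: P_def)
  have lh: "l \<le> h" using lP(1) Plh by auto
  define k where "k = card X"
  define i where "i = l - 1"
  have finX: "finite X" "finite R" using finC CXR by (auto intro: finite_subset)
  have nk: "card R = n - k" "k < n" "k \<ge> 1"
  proof -
    have "card X + card R = n" using card_Un_disjoint[OF finX CXR(2)] CXR(1) cardC by simp
    moreover have "card X \<ge> 1" "card R \<ge> 1" using finX x1X q0R by (auto simp: Suc_le_eq card_gt_0_iff)
    ultimately show "card R = n - k" "k < n" "k \<ge> 1" by (auto simp: k_def)
  qed
  have R0P: "ends R = insert 0 P" using zero by (auto simp: P_def)
  have "card (ends R) = 2 * (n - k)" using matching_card[OF mR] nk(1) eR by simp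
  moreover have "card (ends R) = h - l + 2" unfolding R0P Plh using l2 lh by simp
  ultimately have hl: "h + 1 = i + 2 * (n - k)" using lh l2 by (simp add: i_def)
  have eR': "ends R = inner_points n k i"
    unfolding R0P Plh inner_points_def using hl l2 by (auto simp: i_def)
  \<comment> \<open>The lower bound comes from the point 1 of \<open>X\<close> before the block, the
    upper bound from the point \<open>b\<close> of \<open>X\<close> behind it.\<close>
  have i: "i \<in> {1..2 * k - 1}" using l2 hl hb bn nk by (auto simp: i_def)
  have kn: "k \<in> {1..<n}" using nk by auto
  have "ends X = outer_points n k i"
    using points_partition(1,2)[OF kn i] eR eR' eX by blast
  then have "nesting n k i X R"
    using kn i mX mR cX cR eR' by unfold_locales (auto simp: conn_matchings_def)
  then show ?thesis using CXR by blast
qed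

text \<open>The count of inner and outer diagrams depends only on the numbers of their points, not
  on the gap \<open>i\<close>; summing over the gaps yields the factor \<open>2k-1\<close>.\<close>

lemma card_connected_chord_diagrams_rec:
  assumes n: "n \<ge> 2"
  shows "card (connected_chord_diagrams n) = (\<Sum>k\<in>{1..<n}. (2 * k - 1) *
    card (connected_chord_diagrams k) * card (connected_chord_diagrams (n - k)))"
proof -
  let ?c = "\<lambda>k. card (connected_chord_diagrams k)"
  define I where "I = (SIGMA k:{1..<n}. {1..2 * k - 1})"
  define D where "D = (SIGMA (k, i):I. conn_matchings (outer_points n k i) \<times> conn_matchings (inner_points n k i))"
  have D: "((k, i), (X, R)) \<in> D \<longleftrightarrow> nesting n k i X R" for k i X R
    by (auto simp: D_def I_def nesting_def)
  have "bij_betw (\<lambda>(_, X, R). X \<union> R) D (conn_matchings {0..<2 * n})"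
  proof (rule bij_betw_imageI)
    show "inj_on (\<lambda>(_, X, R). X \<union> R) D"
      using nesting_unique D by (fastforce simp: inj_on_def)
    show "(\<lambda>(_, X, R). X \<union> R) ` D = conn_matchings {0..<2 * n}"
    proof (intro subset_antisym subsetI)
      fix C assume "C \<in> (\<lambda>(_, X, R). X \<union> R) ` D"
      then show "C \<in> conn_matchings {0..<2 * n}" using D nesting.union_conn_matching by fastforce
    next
      fix C assume "C \<in> conn_matchings {0..<2 * n}"
      then obtain k i X R where "nesting n k i X R" "C = X \<union> R" using nesting_exists[OF n] by blast
      then show "C \<in> (\<lambda>(_, X, R). X \<union> R) ` D"
        by (intro image_eqI[of _ _ "((k, i), (X, R))"]) (simp_all add: D)
    qed
  qed
  then have "?c n = card D" unfolding connected_chord_diagrams_eq by (rule bij_betw_same_card[symmetric])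
  also have "\<dots> = (\<Sum>(k, i)\<in>I. card (conn_matchings (outer_points n k i) \<times> conn_matchings (inner_points n k i)))"
    unfolding D_def
  proof (subst card_SigmaI)
    show "\<forall>a\<in>I. finite (case a of (k, i) \<Rightarrow>
        conn_matchings (outer_points n k i) \<times> conn_matchings (inner_points n k i))"
      using points_partition(3,4) finite_conn_matchings unfolding I_def by fastforce
  qed (simp_all add: I_def case_prod_unfold)
  also have "\<dots> = (\<Sum>(k, i)\<in>I. ?c k * ?c (n - k))"
  proof (rule sum.cong)
    fix ki assume "ki \<in> I"
    then obtain k i where "ki = (k, i)" "k \<in> {1..<n}" "i \<in> {1..2 * k - 1}" by (auto simp: I_def)
    then show "(case ki of (k, i) \<Rightarrow> card (conn_matchings (outer_points n k i) \<times> conn_matchings (inner_points n k i)))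
      = (case ki of (k, i) \<Rightarrow> ?c k * ?c (n - k))"
      using points_partition(3-6)[of k n i] card_conn_matchings by (simp add: card_cartesian_product)
  qed simp
  also have "\<dots> = (\<Sum>k\<in>{1..<n}. \<Sum>i\<in>{1..2 * k - 1}. ?c k * ?c (n - k))"
    unfolding I_def by (rule sum.Sigma[symmetric]) auto
  finally show ?thesis by (simp add: mult.assoc)
qed

lemma card_connected_chord_diagrams_1: "card (connected_chord_diagrams 1) = 1"
proof -
  have "conn_matchings {0..<2} = {{(0, 1)}}"
  proof (intro subset_antisym subsetI)
    fix C assume "C \<in> conn_matchings {0..<2}"
    then have m: "matching {0..<2} C" by (simp add: conn_matchings_def)
    note D = matchingD[OF m]
    have "p = (0, 1)" if "p \<in> C" for p using D(1-3)[OF that] by (cases p) auto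
    moreover have "C \<noteq> {}" using D(4) by (auto simp: ends_def)
    ultimately show "C \<in> {{(0, 1)}}" by auto
  next
    fix C :: "(nat \<times> nat) set" assume "C \<in> {{(0, 1)}}"
    then show "C \<in> conn_matchings {0..<2}"
      by (auto simp: conn_matchings_def matching_def conn_def ends_def)
  qed
  then show ?thesis by (simp add: connected_chord_diagrams_eq)
qed

section \<open>Comparison\<close>

theorem theorem1p10:
  fixes n :: nat
  assumes "n \<ge> 1"
  shows "num_bridgeless_maps n = card (connected_chord_diagrams n)"
  using assms
proof (induction n rule: less_induct)
  case (less n)
  show ?case
  proof (cases "n = 1")
    case True
    then show ?thesis
      using num_bridgeless_maps_1 card_connected_chord_diagrams_1 by simp
  next
    case False
    then have n2: "n \<ge> 2" using less.prems by simp
    show ?thesis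
      unfolding num_bridgeless_maps_rec[OF n2] card_connected_chord_diagrams_rec[OF n2]
    proof (rule sum.cong)
      fix k assume "k \<in> {1..<n}"
      then have "k < n" "k \<ge> 1" "n - k < n" "n - k \<ge> 1" by auto
      then show "(2 * k - 1) * num_bridgeless_maps k * num_bridgeless_maps (n - k) =
        (2 * k - 1) * card (connected_chord_diagrams k) * card (connected_chord_diagrams (n - k))"
        by (simp add: less.IH)
    qed simp
  qed
qed

end
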